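(* Let $g$ be a $g$-function on a finite alphabet $A$, with context length function $\ell^g$. Suppose that $$\sup_{\underline x\in\mathcal{X}^-}\mu^{\underline x}\big(\{y_0^{+\infty}:\ell^g(y_0^{n-1})>n\}\big)\longrightarrow 0\quad\text{as } n\to\infty.$$ Then, for every $\underline x\in\mathcal{X}^-$ and every subsequential weak limit $\bar\mu^{\underline x}$ of $(\bar\mu^{\underline x,-k})_{k\ge1}$, $\bar\mu^{\underline x}\in\mathcal{M}_T(g)$. If moreover $g>0$ and, for every $\underline x\in\mathcal{X}^-$, $$\mu^{\underline x}\Big(\Big\{y_0^{+\infty}:\sum_{n\ge1}\mathbf 1_{(n,\infty)}\big(\ell^g(y_0^{n-1})\big)<\infty\Big\}\Big)=1,$$ then there exists a unique stationary measure compatible with $g$ (that is, $\mathcal{M}_T(g)$ has exactly one element), and it is weak-Bernoulli.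
   Context: $A$ is a finite (nonempty) alphabet with the discrete topology, $\mathcal{X}=A^{\mathbb{Z}}$, $\mathcal{X}^-=A^{\{\ldots,-2,-1\}}$ (pasts), $\mathcal{X}^{\le 0}=A^{\{\ldots,-1,0\}}$, all with product topologies; $\mathcal{F}^{\le 0}$, $\mathcal{F}^-$ and $\mathcal{F}^{\ge n}$ are the $\sigma$-algebras generated by the coordinates of index $\le 0$, $\le -1$ and $\ge n$. For $x\in\mathcal{X}$, $\underline x=\ldots x_{-2}x_{-1}$. $T$ is the shift $(Tx)_n=x_{n+1}$, and $[a]_0=\{x: x_0=a\}$. For a finite string $a_m^n$, $\mu(a_m^n)=\mu(\{x:x_m^n=a_m^n\})$. A $g$-function is an $\mathcal{F}^{\le 0}$-measurable $g:\mathcal{X}^{\le 0}\to[0,1]$ with $\sum_{a\in A}g(\underline x a)=1$ for all $\underline x\in\mathcal{X}^-$, where $\underline x a$ is concatenation. By shifting indices, $g$ is applied to any left-infinite sequence. For a past $\underline x$ followed by a string $a_1\ldots a_n$, $g_n(\underline x a_1\ldots a_n)=\prod_{i=1}^n g(\underline x a_1\ldots a_i)$. $g>0$ means that $g$ is strictly positive at every point. The context length function is $\ell^g(\underline x)=\inf\{k\ge1: g(\underline y x_{-k}^{-1}a)=g(\underline z x_{-k}^{-1}a)\ \text{for all } a\in A,\ \underline y,\underline z\in\mathcal{X}^-\}$, with $\inf\emptyset=\infty$. By shifting indices it is applied to any left-infinite sequence $x_{-\infty}^i$. Whether $\ell^g(\underline x)>k$ depends only on $x_{-k}^{-1}$;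 accordingly, for a string $y_0^{n-1}$ of length $n$, "$\ell^g(y_0^{n-1})>n$" means $\ell^g(\underline z y_0^{n-1})>n$ for one (equivalently every) past $\underline z$, and $\mathbf 1_{(n,\infty)}(\ell^g(y_0^{n-1}))$ is the indicator of this event (the value $\ell^g=\infty$ counting as $>n$). $\mathcal{M}_T(g)$ is the set of shift-invariant Borel probability measures $\mu$ on $\mathcal{X}$ compatible with $g$, i.e. such that for every $a\in A$, $\mathbb{E}_\mu(\mathbf 1_{[a]_0}\mid\mathcal{F}^-)(x)=g(\underline x a)$ for $\mu$-a.e. $x$. For $\underline x\in\mathcal{X}^-$, $\mu^{\underline x}$ is the unique probability measure on $\mathcal{X}$ with $\mu^{\underline x}(C)=\mathbf 1_C(\underline x)$ for $C\in\mathcal{F}^-$ and $\mu^{\underline x}(a_0^{n-1})=g_n(\underline x a_0^{n-1})$ for all $n\ge1$, $a_0^{n-1}\in A^n$. Put $\mu^{\underline x,-i}=\mu^{\underline x}\circ T^{-i}$ for $i\ge 0$ and $\bar\mu^{\underline x,-k}=\frac1k\sum_{i=0}^{k-1}\mu^{\underline x,-i}$ for $k\ge1$. By compactness this sequence has weakly convergent subsequences; $\bar\mu^{\underline x}$ denotes such a subsequential limit. A stationary (shift-invariant) measure $\mu$ is weak-Bernoulli (equivalently absolutely regular, or $\beta$-mixing) if $\beta(n)\to0$ as $n\to\infty$, where $\beta(n)=\sup\frac12\sum_{i=1}^I\sum_{j=1}^J|\mu(A_i\cap B_j)-\mu(A_i)\mu(B_j)|$, the supremum being over all finite partitions $\{A_1,\ldots,A_I\}$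 and $\{B_1,\ldots,B_J\}$ of $\mathcal{X}$ with $A_i\in\mathcal{F}^{\le0}$ and $B_j\in\mathcal{F}^{\ge n}$. *)

theory Defs
  imports "HOL-Probability.Probability"
begin

section \<open>Sequences\<close>

text \<open>
  Left-infinite sequences (in particular elements of $A^{\{\ldots,-2,-1\}}$ and of
  $A^{\{\ldots,-1,0\}}$) are read from right to left: \<open>x 0\<close> is the last (rightmost) symbol,
  \<open>x 1\<close> the one before, and so on. This makes all index shifts implicit. For
  $x \in A^{\{\ldots,-2,-1\}}$ the symbol $x_{-k}$ is \<open>x (k - 1)\<close>.
\<close>

type_synonym 'a lseq = "nat \<Rightarrow> 'a"

definition snoc :: "'a lseq \<Rightarrow> 'a \<Rightarrow> 'a lseq" where
  "snoc x a = case_nat a x"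

definition append_word :: "'a lseq \<Rightarrow> 'a list \<Rightarrow> 'a lseq" where
  "append_word x w = foldl snoc x w"

text \<open>The string $x_{-k}\ldots x_{-1}$, and the string $y_0 \ldots y_{n-1}$.\<close>

definition last_word :: "'a lseq \<Rightarrow> nat \<Rightarrow> 'a list" where
  "last_word x k = rev (map x [0..<k])"

definition initial_word :: "(int \<Rightarrow> 'a) \<Rightarrow> nat \<Rightarrow> 'a list" where
  "initial_word y n = map (\<lambda>i. y (int i)) [0..<n]"

text \<open>The past $\ldots x_{-2} x_{-1}$ of a two-sided sequence.\<close>

definition past :: "(int \<Rightarrow> 'a) \<Rightarrow> 'a lseq" where
  "past x = (\<lambda>k. x (- 1 - int k))"

definition shift :: "(int \<Rightarrow> 'a) \<Rightarrow> (int \<Rightarrow> 'a)" where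
  "shift x = (\<lambda>n. x (n + 1))"

definition seq_topology :: "(int \<Rightarrow> 'a) topology" where
  "seq_topology = product_topology (\<lambda>_. discrete_topology UNIV) UNIV"

text \<open>For a finite alphabet this is the Borel \<open>\<sigma>\<close>-algebra of \<open>seq_topology\<close>,
  see \<open>sets_seq_space_borel\<close> below.\<close>

definition seq_space :: "(int \<Rightarrow> 'a) measure" where
  "seq_space = PiM UNIV (\<lambda>_. count_space UNIV)"

definition coord_algebra :: "int set \<Rightarrow> (int \<Rightarrow> 'a) measure" where
  "coord_algebra I = sigma UNIV {(\<lambda>x. x i) -` B | i B. i \<in> I}"

definition cylinder :: "'a list \<Rightarrow> (int \<Rightarrow> 'a) set" where
  "cylinder w = {y. \<forall>i<length w. y (int i) = w ! i}"


section \<open>\<open>g\<close>-functions and context lengths\<close>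

definition g_function :: "('a::finite lseq \<Rightarrow> real) \<Rightarrow> bool" where
  "g_function g \<longleftrightarrow>
     g \<in> borel_measurable (PiM UNIV (\<lambda>_. count_space UNIV)) \<and>
     (\<forall>x. 0 \<le> g x \<and> g x \<le> 1) \<and>
     (\<forall>x. (\<Sum>a\<in>UNIV. g (snoc x a)) = 1)"

definition g_word :: "('a lseq \<Rightarrow> real) \<Rightarrow> 'a lseq \<Rightarrow> 'a list \<Rightarrow> real" where
  "g_word g x w = (\<Prod>i=1..length w. g (append_word x (take i w)))"

definition context_length :: "('a lseq \<Rightarrow> real) \<Rightarrow> 'a lseq \<Rightarrow> enat" where
  "context_length g x = Inf {enat k | k. 1 \<le> k \<and>
     (\<forall>a y z. g (snoc (append_word y (last_word x k)) a) = g (snoc (append_word z (last_word x k)) a))}"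

text \<open>The event $\ell^g(w) > n$ for a string \<open>w\<close> of length \<open>n\<close>; the choice of the past
  is irrelevant, see \<open>context_exceeds_iff\<close> below.\<close>

definition context_exceeds :: "('a lseq \<Rightarrow> real) \<Rightarrow> 'a list \<Rightarrow> bool" where
  "context_exceeds g w \<longleftrightarrow> (\<forall>z. context_length g (append_word z w) > enat (length w))"


section \<open>Measures\<close>

definition compatible_measures :: "('a::finite lseq \<Rightarrow> real) \<Rightarrow> (int \<Rightarrow> 'a) measure set" where
  "compatible_measures g = {\<mu>.
     prob_space \<mu> \<and> sets \<mu> = sets seq_space \<and> distr \<mu> seq_space shift = \<mu> \<and>
     (\<forall>a. AE x in \<mu>. real_cond_exp \<mu> (coord_algebra {..-1}) (indicator {y. y 0 = a}) x
                       = g (snoc (past x) a))}"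

definition is_past_measure ::
    "('a::finite lseq \<Rightarrow> real) \<Rightarrow> 'a lseq \<Rightarrow> (int \<Rightarrow> 'a) measure \<Rightarrow> bool" where
  "is_past_measure g x \<mu> \<longleftrightarrow>
     prob_space \<mu> \<and> sets \<mu> = sets seq_space \<and>
     (\<forall>C\<in>sets (coord_algebra {..-1}). \<forall>y. past y = x \<longrightarrow> measure \<mu> C = indicator C y) \<and>
     (\<forall>w. w \<noteq> [] \<longrightarrow> measure \<mu> (cylinder w) = g_word g x w)"

text \<open>Well-defined for every \<open>g\<close>-function, see \<open>ex1_past_measure\<close> below.\<close>

definition past_measure :: "('a::finite lseq \<Rightarrow> real) \<Rightarrow> 'a lseq \<Rightarrow> (int \<Rightarrow> 'a) measure" where
  "past_measure g x = (THE \<mu>. is_past_measure g x \<mu>)"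

definition shifted_past_measure ::
    "('a::finite lseq \<Rightarrow> real) \<Rightarrow> 'a lseq \<Rightarrow> nat \<Rightarrow> (int \<Rightarrow> 'a) measure" where
  "shifted_past_measure g x i = distr (past_measure g x) seq_space (shift ^^ i)"

definition averaged_past_measure ::
    "('a::finite lseq \<Rightarrow> real) \<Rightarrow> 'a lseq \<Rightarrow> nat \<Rightarrow> (int \<Rightarrow> 'a) measure" where
  "averaged_past_measure g x k = measure_of UNIV (sets seq_space)
     (\<lambda>C. (\<Sum>i<k. emeasure (shifted_past_measure g x i) C) / of_nat k)"

definition weakly_converges ::
    "(nat \<Rightarrow> (int \<Rightarrow> 'a) measure) \<Rightarrow> (int \<Rightarrow> 'a) measure \<Rightarrow> bool" where
  "weakly_converges M \<nu> \<longleftrightarrow>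
     (\<forall>f. continuous_map seq_topology euclideanreal f \<and> bounded (range f) \<longrightarrow>
        (\<lambda>n. integral\<^sup>L (M n) f) \<longlonglongrightarrow> integral\<^sup>L \<nu> f)"

definition subsequential_limit ::
    "('a::finite lseq \<Rightarrow> real) \<Rightarrow> 'a lseq \<Rightarrow> (int \<Rightarrow> 'a) measure \<Rightarrow> bool" where
  "subsequential_limit g x \<nu> \<longleftrightarrow>
     prob_space \<nu> \<and> sets \<nu> = sets seq_space \<and>
     (\<exists>r. strict_mono r \<and> (\<forall>j. 1 \<le> r j) \<and>
        weakly_converges (\<lambda>j. averaged_past_measure g x (r j)) \<nu>)"

text \<open>Empty cells contribute nothing to the sum, so it does not matter that \<open>partition_on\<close>
  excludes them.\<close>

definition beta :: "(int \<Rightarrow> 'a) measure \<Rightarrow> nat \<Rightarrow> real" where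
  "beta \<mu> n =
     (SUP (P, Q) \<in> {(P, Q). finite P \<and> partition_on UNIV P \<and> P \<subseteq> sets (coord_algebra {..0}) \<and>
                           finite Q \<and> partition_on UNIV Q \<and> Q \<subseteq> sets (coord_algebra {int n..})}.
        1 / 2 * (\<Sum>A\<in>P. \<Sum>B\<in>Q. \<bar>measure \<mu> (A \<inter> B) - measure \<mu> A * measure \<mu> B\<bar>))"

definition weak_bernoulli :: "(int \<Rightarrow> 'a) measure \<Rightarrow> bool" where
  "weak_bernoulli \<mu> \<longleftrightarrow> beta \<mu> \<longlonglongrightarrow> 0"


section \<open>Well-definedness\<close>

lemma space_seq_space [simp]: "space seq_space = UNIV"
  by (simp add: seq_space_def space_PiM)

lemma UNIV_in_seq_space [simp]: "UNIV \<in> sets seq_space"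
  using sets.top[of seq_space] by simp

lemma space_coord_algebra [simp]: "space (coord_algebra I) = UNIV"
  by (simp add: coord_algebra_def)

lemma sets_coord_algebra: "sets (coord_algebra I) = sigma_sets UNIV {(\<lambda>x. x i) -` B | i B. i \<in> I}"
  by (simp add: coord_algebra_def)

lemma coord_in_seq_space [measurable]: "(\<lambda>x. x i) -` B \<in> sets seq_space"
proof -
  have "(\<lambda>x. x i) \<in> measurable seq_space (count_space UNIV)"
    unfolding seq_space_def by (rule measurable_component_singleton) simp
  from measurable_sets[OF this, of B] show ?thesis by simp
qed

lemma subalgebra_coord_algebra: "sets (coord_algebra I) \<subseteq> sets seq_space"
  unfolding sets_coord_algebra
  by (rule sets.sigma_sets_subset[of _ seq_space, unfolded space_seq_space])
     (auto intro: coord_in_seq_space)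

lemma sets_coord_algebra_UNIV: "sets (coord_algebra UNIV) = sets seq_space"
  unfolding sets_coord_algebra seq_space_def sets_PiM_single
  by (auto intro!: arg_cong2[where f=sigma_sets])

lemma measurable_shift [measurable]: "shift \<in> measurable seq_space seq_space"
  unfolding shift_def[abs_def] seq_space_def
  by (intro measurable_PiM_single') (auto intro: measurable_component_singleton)

lemma cylinder_sets: "cylinder w \<in> sets seq_space"
proof -
  have "cylinder w = space seq_space \<inter> (\<Inter>i\<in>{..<length w}. (\<lambda>x. x (int i)) -` {w ! i})"
    by (auto simp: cylinder_def)
  also have "\<dots> \<in> sets seq_space"
    by (intro sets.Int sets.top sets.countable_INT'') (auto intro: coord_in_seq_space)
  finally show ?thesis .
qed

lemma sets_seq_space_borel:
  "sets (seq_space :: (int \<Rightarrow> 'a::finite) measure) = sigma_sets UNIV {U. openin seq_topology U}"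
proof (rule antisym)
  have "openin seq_topology ((\<lambda>x. x i) -` B)" for i and B :: "'a set"
  proof -
    have "continuous_map seq_topology (discrete_topology UNIV) (\<lambda>x. x i :: 'a)"
      unfolding seq_topology_def by (rule continuous_map_product_projection) simp
    from openin_continuous_map_preimage[OF this, of B] show ?thesis
      by (simp add: seq_topology_def vimage_def)
  qed
  then show "sets (seq_space :: (int \<Rightarrow> 'a) measure) \<subseteq> sigma_sets UNIV {U. openin seq_topology U}"
    unfolding sets_coord_algebra_UNIV[symmetric] sets_coord_algebra
    by (intro sigma_sets_mono) auto
next
  define cube :: "(int \<times> 'a set) set \<Rightarrow> (int \<Rightarrow> 'a) set" where "cube F = {x. \<forall>(i, B)\<in>F. x i \<in> B}" for F
  have cube: "cube F \<in> sets seq_space" if "finite F" for F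
  proof -
    have "cube F = space seq_space \<inter> (\<Inter>p\<in>F. (\<lambda>x. x (fst p)) -` snd p)"
      by (auto simp: cube_def)
    also have "\<dots> \<in> sets seq_space"
      using that by (intro sets.Int sets.top sets.countable_INT'')
        (auto intro: coord_in_seq_space countable_finite)
    finally show ?thesis .
  qed
  have cnt: "countable {F :: (int \<times> 'a set) set. finite F}"
    by (rule countable_Collect_finite)
  have "U \<in> sets seq_space" if U: "openin seq_topology U" for U :: "(int \<Rightarrow> 'a) set"
  proof -
    have ex: "\<exists>F. finite F \<and> x \<in> cube F \<and> cube F \<subseteq> U" if "x \<in> U" for x
    proof -
      from U that obtain V where V: "finite {i. V i \<noteq> UNIV}" "x \<in> Pi\<^sub>E UNIV V" "Pi\<^sub>E UNIV V \<subseteq> U"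
        unfolding seq_topology_def openin_product_topology_alt by fastforce
      have "cube ((\<lambda>i. (i, V i)) ` {i. V i \<noteq> UNIV}) = Pi\<^sub>E UNIV V"
        by (auto simp: cube_def PiE_iff)
      with V show ?thesis
        by (intro exI[of _ "(\<lambda>i. (i, V i)) ` {i. V i \<noteq> UNIV}"]) auto
    qed
    have "U = (\<Union>F\<in>{F. finite F \<and> cube F \<subseteq> U}. cube F)"
      using ex by blast
    also have "\<dots> \<in> sets seq_space"
      by (intro sets.countable_UN'' countable_subset[OF _ cnt]) (auto intro: cube)
    finally show ?thesis .
  qed
  then show "sigma_sets UNIV {U. openin seq_topology U} \<subseteq> sets (seq_space :: (int \<Rightarrow> 'a) measure)"
    by (intro sets.sigma_sets_subset[of _ seq_space, unfolded space_seq_space]) auto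
qed

lemma append_word_snoc: "append_word x (w @ [a]) = snoc (append_word x w) a"
  by (simp add: append_word_def)

lemma append_word_nth:
  "append_word x w k = (if k < length w then rev w ! k else x (k - length w))"
proof (induction w arbitrary: k rule: rev_induct)
  case Nil
  then show ?case by (simp add: append_word_def)
next
  case (snoc a w)
  then show ?case
    by (cases k) (auto simp: append_word_snoc snoc_def)
qed

lemma last_word_append_word:
  assumes "k \<le> length w"
  shows "last_word (append_word z w) k = drop (length w - k) w"
  using assms by (intro nth_equalityI) (auto simp: last_word_def rev_nth append_word_nth)

lemma context_length_gt_iff:
  "context_length g x > enat n \<longleftrightarrow> (\<forall>k. 1 \<le> k \<and> k \<le> n \<longrightarrow>
     \<not> (\<forall>a y z. g (snoc (append_word y (last_word x k)) a) = g (snoc (append_word z (last_word x k)) a)))"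
  (is "_ \<longleftrightarrow> (\<forall>k. _ \<longrightarrow> \<not> ?P k)")
proof
  assume L: "context_length g x > enat n"
  show "\<forall>k. 1 \<le> k \<and> k \<le> n \<longrightarrow> \<not> ?P k"
  proof (intro allI impI notI)
    fix k assume k: "1 \<le> k \<and> k \<le> n" and "?P k"
    then have "context_length g x \<le> enat k"
      unfolding context_length_def by (intro Inf_lower) auto
    with L k show False by (metis enat_ord_simps(1) leD order_trans)
  qed
next
  assume R: "\<forall>k. 1 \<le> k \<and> k \<le> n \<longrightarrow> \<not> ?P k"
  have "enat (Suc n) \<le> context_length g x"
    unfolding context_length_def
  proof (rule Inf_greatest)
    fix e assume "e \<in> {enat k | k. 1 \<le> k \<and> ?P k}"
    then obtain k where "e = enat k" "1 \<le> k" "?P k" by blast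
    with R have "\<not> k \<le> n" by blast
    with \<open>e = enat k\<close> show "enat (Suc n) \<le> e" by simp
  qed
  then show "context_length g x > enat n"
    by (meson enat_ord_simps(2) lessI less_le_trans)
qed

lemma context_exceeds_iff:
  "context_exceeds g w \<longleftrightarrow> context_length g (append_word z w) > enat (length w)"
  by (auto simp: context_exceeds_def context_length_gt_iff last_word_append_word)

lemma past_coord_determined:
  assumes "C \<in> sets (coord_algebra {..-1})" "past y = past z"
  shows "y \<in> C \<longleftrightarrow> z \<in> C"
  using assms(1) unfolding sets_coord_algebra
proof induction
  case (Basic D)
  then obtain i B where D: "D = (\<lambda>x. x i) -` B" "i \<le> -1" by auto
  have "y i = z i"
    using fun_cong[OF assms(2), of "nat (- i - 1)"] D(2) by (simp add: past_def)
  with D show ?case by simp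
qed auto

lemma cylinder_Int:
  "cylinder v \<inter> cylinder w = {} \<or> cylinder v \<inter> cylinder w = cylinder v \<or> cylinder v \<inter> cylinder w = cylinder w"
proof -
  have *: "cylinder v \<inter> cylinder w = {} \<or> cylinder v \<inter> cylinder w = cylinder w"
    if "length v \<le> length w" for v w :: "'a list"
  proof (cases "\<forall>i<length v. v ! i = w ! i")
    case True
    with that have "cylinder w \<subseteq> cylinder v" by (auto simp: cylinder_def)
    then show ?thesis by blast
  next
    case False
    with that have "cylinder v \<inter> cylinder w = {}" by (force simp: cylinder_def)
    then show ?thesis by blast
  qed
  show ?thesis
    using *[of v w] *[of w v] by (cases "length v \<le> length w") (auto simp: Int_commute)
qed

lemma ex_past: "\<exists>y. past y = x"
  by (rule exI[of _ "\<lambda>i. x (nat (- 1 - i))"]) (auto simp: past_def)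

lemma is_past_measure_unique:
  fixes g :: "'a::finite lseq \<Rightarrow> real"
  assumes "is_past_measure g x \<mu>" "is_past_measure g x \<nu>"
  shows "\<mu> = \<nu>"
proof -
  define E where "E = {C \<inter> cylinder w | C w :: 'a list. C \<in> sets (coord_algebra {..-1})}"
  obtain z where z: "past z = x" using ex_past by blast
  interpret M: prob_space \<mu> using assms by (simp add: is_past_measure_def)
  interpret N: prob_space \<nu> using assms by (simp add: is_past_measure_def)
  have sets: "sets \<mu> = sets seq_space" "sets \<nu> = sets seq_space"
    using assms by (auto simp: is_past_measure_def)
  then have sp: "space \<mu> = UNIV" "space \<nu> = UNIV"
    using sets_eq_imp_space_eq[OF sets(1)] sets_eq_imp_space_eq[OF sets(2)] by simp_all
  have E_sets: "E \<subseteq> sets seq_space"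
    using subalgebra_coord_algebra cylinder_sets by (force simp: E_def)
  have gen: "sigma_sets UNIV E = sets seq_space"
  proof (rule antisym)
    show "sigma_sets UNIV E \<subseteq> sets seq_space"
      by (rule sets.sigma_sets_subset[of _ seq_space, unfolded space_seq_space, OF E_sets])
    interpret S: sigma_algebra UNIV "sigma_sets UNIV E"
      by (rule sigma_algebra_sigma_sets) simp
    have nil: "cylinder [] = (UNIV :: (int \<Rightarrow> 'a) set)" by (auto simp: cylinder_def)
    have "(\<lambda>x. x i) -` B \<in> sigma_sets UNIV E" for i and B :: "'a set"
    proof (cases "i < 0")
      case True
      then have "(\<lambda>x. x i) -` B \<in> sets (coord_algebra {..-1})"
        unfolding sets_coord_algebra
        by (intro sigma_sets.Basic CollectI exI[of _ i] exI[of _ B]) auto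
      then have "(\<lambda>x. x i) -` B \<inter> cylinder [] \<in> E" unfolding E_def by blast
      then show ?thesis by (auto simp: nil)
    next
      case False
      then obtain n where n: "i = int n" by (metis nonneg_int_cases not_le_imp_less)
      let ?W = "{w. length w = Suc n \<and> w ! n \<in> B}"
      have "(\<lambda>x. x i) -` B = (\<Union>w\<in>?W. UNIV \<inter> cylinder w)"
      proof (intro set_eqI iffI)
        fix y assume "y \<in> (\<lambda>x. x i) -` B"
        then show "y \<in> (\<Union>w\<in>?W. UNIV \<inter> cylinder w)"
          by (intro UN_I[of "initial_word y (Suc n)"])
            (auto simp: initial_word_def cylinder_def n simp del: upt_Suc)
      qed (auto simp: cylinder_def n)
      also have "\<dots> \<in> sigma_sets UNIV E"
      proof (rule S.finite_UN)
        show "finite ?W"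
          by (rule finite_subset[OF _ finite_lists_length_eq[of "UNIV :: 'a set" "Suc n"]]) auto
        show "UNIV \<inter> cylinder w \<in> sigma_sets UNIV E" for w :: "'a list"
          using sets.top[of "coord_algebra {..-1}"]
          by (intro sigma_sets.Basic) (auto simp: E_def)
      qed
      finally show ?thesis .
    qed
    then show "sets seq_space \<subseteq> sigma_sets UNIV E"
      unfolding sets_coord_algebra_UNIV[symmetric] sets_coord_algebra
      by (intro sigma_sets_mono) auto
  qed
  have eq: "emeasure \<mu> X = emeasure \<nu> X" if "X \<in> E" for X
  proof -
    obtain C w where X: "X = C \<inter> cylinder w" and C: "C \<in> sets (coord_algebra {..-1})"
      using \<open>X \<in> E\<close> unfolding E_def by blast
    have C': "C \<in> sets \<mu>" "C \<in> sets \<nu>"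
      using subsetD[OF subalgebra_coord_algebra C] sets by simp_all
    have m: "measure \<mu> C = indicator C z" "measure \<nu> C = indicator C z"
      using assms C z unfolding is_past_measure_def by blast+
    have cw: "measure \<mu> (cylinder w) = measure \<nu> (cylinder w)"
    proof (cases "w = []")
      case True
      then have "cylinder w = UNIV" by (auto simp: cylinder_def)
      then show ?thesis using M.prob_space N.prob_space sp by simp
    next
      case False
      have "measure \<mu> (cylinder w) = g_word g x w" "measure \<nu> (cylinder w) = g_word g x w"
        using assms False by (simp_all add: is_past_measure_def)
      then show ?thesis by simp
    qed
    have "measure \<mu> X = measure \<nu> X"
    proof (cases "z \<in> C")
      case True
      have "measure \<mu> X = measure \<mu> (cylinder w)"
      proof (rule M.finite_measure_eq_AE)
        have "AE y in \<mu>. y \<in> C" using m True C' by (intro M.AE_prob_1) auto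
        then show "AE y in \<mu>. y \<in> X \<longleftrightarrow> y \<in> cylinder w" by eventually_elim (simp add: X)
      qed (use C' cylinder_sets sets X in auto)
      moreover have "measure \<nu> X = measure \<nu> (cylinder w)"
      proof (rule N.finite_measure_eq_AE)
        have "AE y in \<nu>. y \<in> C" using m True C' by (intro N.AE_prob_1) auto
        then show "AE y in \<nu>. y \<in> X \<longleftrightarrow> y \<in> cylinder w" by eventually_elim (simp add: X)
      qed (use C' cylinder_sets sets X in auto)
      ultimately show ?thesis using cw by simp
    next
      case False
      then have "measure \<mu> X \<le> 0" "measure \<nu> X \<le> 0"
        using M.finite_measure_mono[of X C] N.finite_measure_mono[of X C] m C' X by auto
      then show ?thesis by (simp add: measure_le_0_iff)
    qed
    then show ?thesis by (simp add: M.emeasure_eq_measure N.emeasure_eq_measure)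
  qed
  have U: "UNIV \<in> E"
    using sets.top[of "coord_algebra {..-1}"]
    unfolding E_def by (intro CollectI exI[of _ UNIV] exI[of _ "[]"]) (auto simp: cylinder_def)
  show ?thesis
  proof (rule measure_eqI_generator_eq[where E=E and \<Omega>=UNIV and A="\<lambda>_. UNIV"])
    show "Int_stable E"
    proof (rule Int_stableI)
      fix X Y assume "X \<in> E" "Y \<in> E"
      then obtain C D v w where *: "X = C \<inter> cylinder v" "Y = D \<inter> cylinder w"
        "C \<in> sets (coord_algebra {..-1})" "D \<in> sets (coord_algebra {..-1})"
        unfolding E_def by blast
      then have CD: "C \<inter> D \<in> sets (coord_algebra {..-1})" by blast
      have XY: "X \<inter> Y = (C \<inter> D) \<inter> (cylinder v \<inter> cylinder w)" using * by blast
      from cylinder_Int[of v w] show "X \<inter> Y \<in> E"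
      proof (elim disjE)
        assume "cylinder v \<inter> cylinder w = {}"
        then have "X \<inter> Y = {} \<inter> cylinder v" using XY by blast
        then show ?thesis unfolding E_def by blast
      qed (use XY CD in \<open>auto simp: E_def\<close>)
    qed
  qed (use eq gen sets sp U M.emeasure_space_1 in \<open>auto simp: M.emeasure_eq_measure\<close>)
qed

lemma g_word_snoc: "g_word g x (w @ [a]) = g_word g x w * g (snoc (append_word x w) a)"
proof -
  have "(\<Prod>i=1..length w. g (append_word x (take i (w @ [a]))))
      = (\<Prod>i=1..length w. g (append_word x (take i w)))"
    by (intro prod.cong) auto
  then show ?thesis
    by (simp add: g_word_def append_word_snoc)
qed

lemma ex_future_measure:
  fixes g :: "'a::finite lseq \<Rightarrow> real"
  assumes g: "g_function g"
  shows "\<exists>L :: (nat \<Rightarrow> 'a) measure. prob_space L \<and> sets L = sets (PiM UNIV (\<lambda>_. count_space UNIV)) \<and>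
    (\<forall>w. emeasure L {f. \<forall>i<length w. f i = w ! i} = ennreal (g_word g x w))"
proof -
  define M where "M = (\<lambda>_::nat. count_space (UNIV :: 'a set))"
  define wd where "wd n \<omega> = append_word x (map \<omega> [0..<n])" for n and \<omega> :: "nat \<Rightarrow> 'a"
  define p where "p n \<omega> = embed_pmf (\<lambda>a. g (snoc (wd n \<omega>) a))" for n \<omega>
  have g0: "0 \<le> g y" for y using g by (simp add: g_function_def)
  have pmf_p: "pmf (p n \<omega>) a = g (snoc (wd n \<omega>) a)" for n \<omega> a
    unfolding p_def
  proof (rule pmf_embed_pmf)
    show "(\<integral>\<^sup>+ a. ennreal (g (snoc (wd n \<omega>) a)) \<partial>count_space UNIV) = 1"
      using g by (simp add: nn_integral_count_space_finite sum_ennreal g0 g_function_def)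
  qed (rule g0)
  have cs: "PiM {0..<n} M = count_space (PiE {0..<n} (\<lambda>_. UNIV))" for n
    unfolding M_def by (rule count_space_PiM_finite) (auto simp: countable_finite)
  interpret IT: Ionescu_Tulcea "\<lambda>n \<omega>. measure_pmf (p n \<omega>)" M
  proof
    show "(\<lambda>\<omega>. measure_pmf (p n \<omega>)) \<in> measurable (PiM {0..<n} M) (subprob_algebra (M n))" for n
      unfolding cs unfolding M_def by (auto simp: space_subprob_algebra prob_space_imp_subprob_space
        measure_pmf.prob_space_axioms)
  qed
  have "emeasure (IT.C 0 (length w) (\<lambda>_. undefined)) {restrict (nth w) {0..<length w}} = ennreal (g_word g x w)"
    for w
  proof (induction w rule: rev_induct)
    case Nil
    have "emeasure (return (PiM {} M) (\<lambda>_. undefined)) {\<lambda>_. undefined} = 1"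
      by (subst emeasure_return) (auto simp: PiM_empty)
    then show ?case by (simp add: g_word_def restrict_def)
  next
    case (snoc a w)
    let ?n = "length w"
    let ?w = "restrict (nth w) {0..<?n}" and ?wa = "restrict (nth (w @ [a])) {0..<Suc ?n}"
    have wa: "{?wa} \<in> sets (PiM {0..<Suc ?n} M)"
      unfolding cs by auto
    have eP: "emeasure (IT.eP ?n \<omega>) {?wa} = ennreal (g (snoc (append_word x w) a)) * indicator {?w} \<omega>"
      if "\<omega> \<in> space (PiM {0..<?n} M)" for \<omega>
    proof -
      have \<omega>: "\<omega> \<in> extensional {0..<?n}" using that by (auto simp: space_PiM PiE_def)
      have "emeasure (IT.eP ?n \<omega>) {?wa}
          = emeasure (measure_pmf (p ?n \<omega>)) ((\<lambda>b. fun_upd \<omega> ?n b) -` {?wa} \<inter> space (M ?n))"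
        by (rule IT.emeasure_eP[OF that wa])
      also have "\<dots> = ennreal (g (snoc (append_word x w) a)) * indicator {?w} \<omega>"
      proof (cases "\<omega> = ?w")
        case True
        have *: "fun_upd ?w ?n b = ?wa \<longleftrightarrow> b = a" for b
          by (auto simp: fun_eq_iff restrict_def nth_append less_Suc_eq)
        have "map ?w [0..<?n] = w" by (intro nth_equalityI) auto
        moreover have "(\<lambda>b. fun_upd \<omega> ?n b) -` {?wa} \<inter> space (M ?n) = {a}"
          using * by (auto simp: True M_def)
        ultimately show ?thesis
          by (simp add: True emeasure_pmf_single pmf_p wd_def)
      next
        case False
        have "fun_upd \<omega> ?n b \<noteq> ?wa" for b
        proof
          assume A: "fun_upd \<omega> ?n b = ?wa"
          have "\<omega> i = ?w i" for i
            using fun_cong[OF A, of i] \<omega>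
            by (cases "i < ?n"; cases "i = ?n") (auto simp: nth_append extensional_def)
          with False show False by blast
        qed
        then have "fun_upd \<omega> ?n -` {?wa} = {}" by blast
        then show ?thesis using False by simp
      qed
      finally show ?thesis .
    qed
    have wm: "{?w} \<in> sets (PiM {0..<?n} M)" unfolding cs by auto
    have spC: "space (IT.C 0 ?n (\<lambda>_. undefined)) = space (PiM {0..<?n} M)"
      and stC: "sets (IT.C 0 ?n (\<lambda>_. undefined)) = sets (PiM {0..<?n} M)"
      using IT.space_C[of "\<lambda>_. undefined" 0 ?n] IT.sets_C[of "\<lambda>_. undefined" 0 ?n] by simp_all
    have "space (IT.C 0 ?n (\<lambda>_. undefined)) \<noteq> {}"
      unfolding spC cs by auto
    then have "emeasure (IT.C 0 (Suc ?n) (\<lambda>_. undefined)) {?wa}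
        = (\<integral>\<^sup>+\<omega>. emeasure (IT.eP ?n \<omega>) {?wa} \<partial>IT.C 0 ?n (\<lambda>_. undefined))"
      using wa IT.measurable_eP[of ?n]
      by (simp add: emeasure_bind[where N="PiM {0..<Suc ?n} M"] measurable_cong_sets[OF stC])
    also have "\<dots> = (\<integral>\<^sup>+\<omega>. ennreal (g (snoc (append_word x w) a)) * indicator {?w} \<omega> \<partial>IT.C 0 ?n (\<lambda>_. undefined))"
      by (intro nn_integral_cong) (simp add: eP spC)
    also have "\<dots> = ennreal (g (snoc (append_word x w) a)) * ennreal (g_word g x w)"
      by (subst nn_integral_cmult_indicator) (simp only: wm stC, simp only: snoc.IH)
    also have "\<dots> = ennreal (g_word g x (w @ [a]))"
      by (simp add: g_word_snoc ennreal_mult'' g0 mult.commute)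
    finally show ?case
      by (simp only: length_append list.size add_Suc_right add_0_right)
  qed
  note C = this
  have lim: "emeasure IT.PF.lim {f. \<forall>i<length w. f i = w ! i} = ennreal (g_word g x w)" for w
  proof -
    let ?J = "{0..<length w}" and ?w = "restrict (nth w) {0..<length w}"
    have wm: "{?w} \<in> sets (PiM ?J M)" unfolding cs by auto
    have "restrict f ?J = ?w \<longleftrightarrow> (\<forall>i<length w. f i = w ! i)" for f
    proof
      assume A: "restrict f ?J = ?w"
      show "\<forall>i<length w. f i = w ! i"
      proof (intro allI impI)
        fix i assume "i < length w"
        with fun_cong[OF A, of i] show "f i = w ! i" by simp
      qed
    qed (auto intro: restrict_ext)
    then have "{f. \<forall>i<length w. f i = w ! i} = prod_emb UNIV M ?J {?w}"
      by (auto simp: prod_emb_def M_def)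
    then have "emeasure IT.PF.lim {f. \<forall>i<length w. f i = w ! i} = emeasure (IT.CI ?J) {?w}"
      using IT.lim[OF _ wm] by simp
    also have "\<dots> = emeasure (IT.C 0 (length w) (\<lambda>_. undefined)) (prod_emb ?J M ?J {?w})"
      by (rule IT.emeasure_CI[OF order_refl wm])
    also have "prod_emb ?J M ?J {?w} = {?w}"
      by (rule prod_emb_id) (auto simp: M_def)
    finally show ?thesis using C by simp
  qed
  have "emeasure IT.PF.lim (space IT.PF.lim) = 1"
    using lim[of "[]"] sets_eq_imp_space_eq[OF IT.PF.sets_lim]
    by (simp add: g_word_def M_def space_PiM)
  then show ?thesis
    using lim by (intro exI[of _ IT.PF.lim]) (auto intro!: prob_spaceI simp: M_def[symmetric])
qed

lemma ex_past_measure: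
  fixes g :: "'a::finite lseq \<Rightarrow> real"
  assumes g: "g_function g"
  shows "\<exists>\<mu>. is_past_measure g x \<mu>"
proof -
  obtain L :: "(nat \<Rightarrow> 'a) measure" where L: "prob_space L"
    "sets L = sets (PiM UNIV (\<lambda>_. count_space UNIV))"
    "\<And>w. emeasure L {f. \<forall>i<length w. f i = w ! i} = ennreal (g_word g x w)"
    using ex_future_measure[OF g, of x] by blast
  interpret L: prob_space L by fact
  have g0: "0 \<le> g_word g x w" for w
    using g by (auto simp: g_word_def g_function_def intro!: prod_nonneg)
  have spL: "space L = UNIV" using sets_eq_imp_space_eq[OF L(2)] by (simp add: space_PiM)
  define j where "j f = (\<lambda>i. if i < 0 then x (nat (- 1 - i)) else f (nat i))" for f :: "nat \<Rightarrow> 'a" and i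
  have j: "j \<in> measurable L seq_space"
    unfolding seq_space_def measurable_cong_sets[OF L(2) refl]
  proof (rule measurable_PiM_single')
    show "(\<lambda>f. j f i) \<in> measurable (PiM UNIV (\<lambda>_. count_space UNIV)) (count_space UNIV)" for i
      by (cases "i < 0") (auto simp: j_def intro: measurable_component_singleton)
  qed auto
  have past_j: "past (j f) = x" for f by (auto simp: past_def j_def)
  let ?\<mu> = "distr L seq_space j"
  have "measure ?\<mu> C = indicator C y" if C: "C \<in> sets (coord_algebra {..-1})" and y: "past y = x" for C y
  proof -
    have "j f \<in> C \<longleftrightarrow> y \<in> C" for f
      by (rule past_coord_determined[OF C]) (simp add: past_j y)
    then have "j -` C \<inter> space L = (if y \<in> C then space L else {})"
      by auto
    then show ?thesis
      using C subalgebra_coord_algebra[of "{..-1}"] L.prob_space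
      by (subst measure_distr[OF j]) auto
  qed
  moreover have "measure ?\<mu> (cylinder w) = g_word g x w" for w
  proof -
    have "j -` cylinder w \<inter> space L = {f. \<forall>i<length w. f i = w ! i}"
      by (auto simp: cylinder_def j_def spL)
    then show ?thesis
      using L(3)[of w] g0[of w] by (subst measure_distr[OF j cylinder_sets]) (simp add: measure_def)
  qed
  moreover have "prob_space ?\<mu>" by (rule L.prob_space_distr[OF j])
  ultimately show ?thesis
    by (intro exI[of _ ?\<mu>]) (auto simp: is_past_measure_def)
qed

lemma ex1_past_measure:
  "g_function g \<Longrightarrow> \<exists>!\<mu>. is_past_measure g x \<mu>"
  using ex_past_measure is_past_measure_unique by (intro ex_ex1I)

lemma past_measure: "g_function g \<Longrightarrow> is_past_measure g x (past_measure g x)"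
  unfolding past_measure_def by (rule theI'[OF ex1_past_measure])

lemma sets_averaged_past_measure [simp]: "sets (averaged_past_measure g x k) = sets seq_space"
  using sets.sigma_sets_eq[of seq_space] sets.space_closed[of seq_space]
  by (simp add: averaged_past_measure_def)

lemma emeasure_averaged_past_measure:
  assumes C: "C \<in> sets seq_space"
  shows "emeasure (averaged_past_measure g x k) C
           = (\<Sum>i<k. emeasure (shifted_past_measure g x i) C) / of_nat k"
  unfolding averaged_past_measure_def
proof (rule emeasure_measure_of_sigma)
  let ?m = "\<lambda>C. (\<Sum>i<k. emeasure (shifted_past_measure g x i) C) / of_nat k"
  have sets: "sets (shifted_past_measure g x i) = sets seq_space" for i
    by (simp add: shifted_past_measure_def)
  show "sigma_algebra UNIV (sets seq_space)"
    using sets.sigma_algebra_axioms[of seq_space] by simp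
  show "positive (sets seq_space) ?m" by (simp add: positive_def)
  show "countably_additive (sets seq_space) ?m"
  proof (rule countably_additiveI)
    fix A :: "nat \<Rightarrow> (int \<Rightarrow> 'a) set"
    assume "range A \<subseteq> sets seq_space" "disjoint_family A"
    then show "(\<Sum>n. ?m (A n)) = ?m (\<Union>n. A n)"
      by (simp add: divide_ennreal_def suminf_sum suminf_emeasure sets)
  qed
qed (rule C)

end

theory Submission
  imports Defs
begin

text \<open>
  Write \<open>\<mu>\<^sup>x\<close> for the law of the chain started from the past \<open>x\<close>, and call a string \<open>v\<close> good
  if \<open>g\<close> evaluated after \<open>v\<close> does not depend on what precedes \<open>v\<close>.

  \<^bold>\<open>Limits of averages.\<close> The averages of the shifted laws satisfy exactly the relation between
  the next symbol and the past that defines compatibility. It does not pass to a weak limit by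
  itself because \<open>g\<close> need not be continuous. For a good string \<open>v\<close>, however, the relation reads
  \<open>\<nu>(va) = g(\<dots>va) \<nu>(v)\<close> with a factor depending only on \<open>v\<close>, hence involves finitely many
  coordinates and survives the limit. The strings of length \<open>n\<close> that are not good have at any
  time probability at most \<open>sup\<^sub>x \<mu>\<^sup>x(\<ell> > n)\<close>, because the supremum also covers every past that
  the chain may have produced; this bound passes to the limit too and tends to zero, which
  removes the restriction to good strings (\<open>compatibleI_words\<close>, \<open>limit_of_averages_compatible\<close>).
  A compactness argument provides at least one limit (\<open>finitary_compactness\<close>), hence a
  compatible measure.

  \<^bold>\<open>Comparison of pasts.\<close> Suppose that \<open>g > 0\<close> and that almost surely all initial strings are
  good from some length \<open>N\<close> on. From that time on two chains with different pasts use the same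
  transition probabilities, so the likelihood ratio of \<open>\<mu>\<^sup>x\<close> and \<open>\<mu>\<^sup>z\<close> is the ratio of the
  probabilities of the first \<open>N\<close> symbols, which is positive and finite (\<open>law_exchange\<close>). All
  \<open>\<mu>\<^sup>x\<close> therefore have the same null sets in the future. Quantitatively, there is a function
  \<open>\<eta> > 0\<close> of the past such that each future event \<open>B\<close> satisfies \<open>\<mu>\<^sup>x(B) \<ge> \<eta>(x)\<close> for all \<open>x\<close>, or
  its complement does (\<open>ex_uniform_minorant\<close>).

  \<^bold>\<open>Tail triviality.\<close> Let \<open>\<nu>\<close> be compatible and \<open>A\<close> an event in the remote future. Up to a small
  error \<open>A\<close> is determined by the coordinates before some time \<open>n\<close>; translating by \<open>n\<close> gives a
  future event \<open>B\<close> which the past almost determines, so that \<open>\<mu>\<^sup>x(B)\<close> is close to \<open>0\<close> or to \<open>1\<close>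
  for typical \<open>x\<close>. By stationarity the distribution of the past, hence of \<open>\<eta>\<close>, has not changed,
  and \<open>\<eta>\<close> rules out one of the two alternatives: \<open>\<nu>(A)\<close> is \<open>0\<close> or \<open>1\<close> (\<open>tail_trivial\<close>). Equality
  of null sets then gives \<open>\<mu>\<^sup>x(A) = \<nu>(A)\<close> for every past (\<open>tail_event_law\<close>).

  \<^bold>\<open>From the tail to the far future.\<close> If \<open>P \<le> Q\<close> on the intersection of a decreasing sequence of
  \<open>\<sigma>\<close>-algebras, then \<open>P - Q\<close> is at most \<open>\<epsilon>\<close> on all of some member of the sequence
  (\<open>tail_domination_imp_uniform\<close>). For two compatible measures, which agree on the tail, this
  shows that they nearly agree on the far future, hence by stationarity that they are equal.
  For the joint law of past and future against the product \<open>\<nu> \<otimes> \<nu>\<close>, it shows that the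
  coefficients \<open>\<beta>(n)\<close> tend to zero: the sections of an event in the tail of the product
  \<open>\<sigma>\<close>-algebras are tail events, on which the conditional law of the future is \<open>\<nu>\<close>.
\<close>

section \<open>Monotone families of \<open>\<sigma>\<close>-algebras\<close>

text \<open>
  The sets that can be approximated form a \<open>\<sigma>\<close>-algebra. For a countable union, finitely many of
  the sets carry almost all of the mass, and their approximants lie in one common member of the
  increasing family.
\<close>

lemma sigma_union_approximation:
  fixes G :: "nat \<Rightarrow> 'b measure"
  assumes "finite_measure M"
    and sp: "\<And>n. space (G n) = space M"
    and sub: "\<And>n. sets (G n) \<subseteq> sets M"
    and mono: "\<And>m n. m \<le> n \<Longrightarrow> sets (G m) \<subseteq> sets (G n)"
    and A: "A \<in> sigma_sets (space M) (\<Union>n. sets (G n))"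
    and "0 < \<epsilon>"
  shows "\<exists>n. \<exists>L\<in>sets (G n). measure M (A - L) < \<epsilon> \<and> measure M (L - A) < \<epsilon>"
proof -
  interpret finite_measure M by fact
  have meas: "B \<in> sets M" if "B \<in> sigma_sets (space M) (\<Union>n. sets (G n))" for B
    using that sub sets.sigma_sets_subset[of "\<Union>n. sets (G n)" M] by blast
  show ?thesis using A \<open>0 < \<epsilon>\<close>
  proof (induction arbitrary: \<epsilon> rule: sigma_sets.induct)
    case (Basic L)
    then obtain n where "L \<in> sets (G n)" by blast
    with Basic.prems show ?case by (intro exI[of _ n] bexI[of _ L]) auto
  next
    case Empty
    then show ?case by (intro exI[of _ 0] bexI[of _ "{}"]) auto
  next
    case (Compl B)
    then obtain n L where L: "L \<in> sets (G n)" "measure M (B - L) < \<epsilon>" "measure M (L - B) < \<epsilon>"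
      by blast
    have "L \<subseteq> space M" "B \<subseteq> space M"
      using L(1) sub meas[OF Compl.hyps] by (auto dest: sets.sets_into_space)
    then have "space M - B - (space M - L) = L - B" "space M - L - (space M - B) = B - L" by auto
    with L show ?case
      by (intro exI[of _ n] bexI[of _ "space M - L"]) (auto simp flip: sp[of n])
  next
    case (Union B)
    have B: "B i \<in> sets M" for i using Union.hyps by (rule meas)
    have "(\<lambda>k. measure M ((\<Union>i. B i) - (\<Union>i<k. B i))) \<longlonglongrightarrow> measure M (\<Inter>k. (\<Union>i. B i) - (\<Union>i<k. B i))"
      using B by (intro finite_Lim_measure_decseq) (auto simp: decseq_def)
    also have "(\<Inter>k. (\<Union>i. B i) - (\<Union>i<k. B i)) = {}" by auto
    finally have "(\<lambda>k. measure M ((\<Union>i. B i) - (\<Union>i<k. B i))) \<longlonglongrightarrow> 0" by simp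
    then have "\<forall>\<^sub>F k in sequentially. measure M ((\<Union>i. B i) - (\<Union>i<k. B i)) < \<epsilon> / 2"
      using Union.prems by (intro order_tendstoD) auto
    then obtain k where k: "measure M ((\<Union>i. B i) - (\<Union>i<k. B i)) < \<epsilon> / 2"
      by (auto simp: eventually_sequentially)
    define \<delta> where "\<delta> = \<epsilon> / (2 * (k + 1))"
    have \<delta>: "\<delta> > 0" "k * \<delta> < \<epsilon> / 2" using Union.prems by (auto simp: \<delta>_def field_simps)
    have "\<forall>i. \<exists>n. \<exists>L\<in>sets (G n). measure M (B i - L) < \<delta> \<and> measure M (L - B i) < \<delta>"
      using Union.IH \<delta> by blast
    then obtain n L where L: "\<And>i. L i \<in> sets (G (n i))" "\<And>i. measure M (B i - L i) < \<delta>"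
      "\<And>i. measure M (L i - B i) < \<delta>" by metis
    define N where "N = Max (n ` {..<k})"
    have LN: "L i \<in> sets (G N)" if "i < k" for i
      using L(1)[of i] mono[of "n i" N] that by (auto simp: N_def)
    have LM: "L i \<in> sets M" for i using L(1) sub by blast
    have small: "measure M (\<Union>i<k. C i) < \<epsilon> / 2"
      if "\<And>i. C i \<in> sets M" "\<And>i. measure M (C i) < \<delta>" for C
    proof -
      have "measure M (\<Union>i<k. C i) \<le> (\<Sum>i<k. measure M (C i))"
        using that by (intro finite_measure_subadditive_finite) auto
      also have "\<dots> \<le> (\<Sum>i<k. \<delta>)" using that by (intro sum_mono) (auto intro: less_imp_le)
      also have "\<dots> < \<epsilon> / 2" using \<delta> by simp
      finally show ?thesis .
    qed
    have 1: "measure M ((\<Union>i. B i) - (\<Union>i<k. L i)) < \<epsilon>"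
    proof -
      have "measure M ((\<Union>i. B i) - (\<Union>i<k. L i)) \<le>
          measure M (((\<Union>i. B i) - (\<Union>i<k. B i)) \<union> (\<Union>i<k. B i - L i))"
        using B LM by (intro finite_measure_mono) auto
      also have "\<dots> \<le> measure M ((\<Union>i. B i) - (\<Union>i<k. B i)) + measure M (\<Union>i<k. B i - L i)"
        using B LM by (intro measure_Un_le) auto
      also have "measure M (\<Union>i<k. B i - L i) < \<epsilon> / 2"
        using B LM L by (intro small) auto
      finally show ?thesis using k by linarith
    qed
    have 2: "measure M ((\<Union>i<k. L i) - (\<Union>i. B i)) < \<epsilon>"
    proof -
      have "measure M ((\<Union>i<k. L i) - (\<Union>i. B i)) \<le> measure M (\<Union>i<k. L i - B i)"
        using B LM by (intro finite_measure_mono) auto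
      also have "\<dots> < \<epsilon> / 2" using B LM L by (intro small) auto
      finally show ?thesis using Union.prems by linarith
    qed
    show ?case
      using 1 2 LN by (intro exI[of _ N] bexI[of _ "\<Union>i<k. L i"] conjI) auto
  qed
qed

text \<open>
  This is the Hahn decomposition argument along a decreasing sequence of \<open>\<sigma>\<close>-algebras. Let
  \<open>\<sigma> = P - Q\<close> and let \<open>s\<close> be the limit of the suprema of \<open>\<sigma>\<close> over the members of the sequence. If
  \<open>s > 0\<close>, sets \<open>C\<^sub>k\<close> in later and later members with \<open>\<sigma>(C\<^sub>k)\<close> almost \<open>s\<close> lose little under
  unions, since \<open>\<sigma>(C \<union> W) = \<sigma>(C) + \<sigma>(W) - \<sigma>(C \<inter> W)\<close> and the last term is not much larger than
  \<open>s\<close>. The upper limit of the \<open>C\<^sub>k\<close> is then a tail event with \<open>\<sigma> > 0\<close>.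
\<close>

lemma tail_domination_imp_uniform:
  fixes G :: "nat \<Rightarrow> 'b measure"
  assumes "finite_measure P" "finite_measure Q"
    and sub: "\<And>n. sets (G n) \<subseteq> sets P" "\<And>n. sets (G n) \<subseteq> sets Q"
    and anti: "\<And>m n. m \<le> n \<Longrightarrow> sets (G n) \<subseteq> sets (G m)"
    and tail: "\<And>A. (\<And>n. A \<in> sets (G n)) \<Longrightarrow> measure P A \<le> measure Q A"
    and "0 < \<epsilon>"
  shows "\<exists>n. \<forall>C\<in>sets (G n). measure P C - measure Q C < \<epsilon>"
proof (rule ccontr)
  interpret P: finite_measure P by fact
  interpret Q: finite_measure Q by fact
  define \<sigma> where "\<sigma> C = measure P C - measure Q C" for C
  assume "\<not> ?thesis"
  then have large: "\<exists>C\<in>sets (G n). \<epsilon> \<le> \<sigma> C" for n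
    by (auto simp: \<sigma>_def not_less)
  \<comment> \<open>The infimum of \<open>S\<close> is the limit of the suprema of \<open>\<sigma>\<close> over the \<open>\<sigma>\<close>-algebras \<open>G n\<close>.\<close>
  define S where "S = {t. \<exists>n. \<forall>C\<in>sets (G n). \<sigma> C \<le> t}"
  have bound: "\<sigma> C \<le> measure P (space P)" for C
    using P.bounded_measure[of C] measure_nonneg[of Q C] unfolding \<sigma>_def by linarith
  have S_ne: "measure P (space P) \<in> S" using bound by (auto simp: S_def)
  have S_lower: "\<epsilon> \<le> t" if "t \<in> S" for t
    using that large by (force simp: S_def)
  have bdd: "bdd_below S" using S_lower by (auto simp: bdd_below_def)
  define s where "s = Inf S"
  have s: "\<epsilon> \<le> s" unfolding s_def using S_ne S_lower by (intro cInf_greatest) auto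
  \<comment> \<open>Errors of the approximations; the geometric decay makes the losses of all unions summable,
    and the total loss \<open>4 \<eta>\<^sub>0 = \<epsilon> / 3\<close> stays below \<open>s\<close>.\<close>
  define \<eta> where "\<eta> k = \<epsilon> / 12 / 2 ^ k" for k :: nat
  have \<eta>: "\<eta> k > 0" for k using \<open>0 < \<epsilon>\<close> by (simp add: \<eta>_def)
  have "\<exists>n. \<forall>C\<in>sets (G n). \<sigma> C \<le> s + \<eta> k" for k
  proof -
    have "Inf S < s + \<eta> k" using \<eta> by (simp add: s_def)
    then obtain t where "t \<in> S" "t < s + \<eta> k" using S_ne bdd by (subst (asm) cInf_less_iff) auto
    then show ?thesis by (force simp: S_def)
  qed
  then obtain n0 where n0: "\<And>k C. C \<in> sets (G (n0 k)) \<Longrightarrow> \<sigma> C \<le> s + \<eta> k" by metis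
  define n where "n k = k + Max (n0 ` {..k})" for k
  have n_mono: "n j \<le> n k" if "j \<le> k" for j k
    using that by (auto simp: n_def intro!: add_mono Max_mono)
  have n_upper: "\<sigma> C \<le> s + \<eta> k" if "C \<in> sets (G (n k))" for k C
    using that anti[of "n0 k" "n k"] n0 by (force simp: n_def intro: trans_le_add2)
  have "\<exists>C\<in>sets (G (n k)). s - \<eta> k < \<sigma> C" for k
  proof (rule ccontr)
    assume "\<not> ?thesis"
    then have "s - \<eta> k \<in> S" by (force simp: S_def not_less)
    then have "s \<le> s - \<eta> k" unfolding s_def by (rule cInf_lower[OF _ bdd])
    with \<eta>[of k] show False by simp
  qed
  then obtain C where C: "\<And>k. C k \<in> sets (G (n k))" "\<And>k. s - \<eta> k < \<sigma> (C k)" by metis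
  have Cn: "C j \<in> sets (G (n k))" if "k \<le> j" for j k
    using C(1)[of j] anti[OF n_mono[OF that]] by blast
  \<comment> \<open>The term \<open>\<eta> (k + d)\<close> is slack for the induction, which peels off the first set of the union.\<close>
  have union: "\<sigma> (\<Union>j\<in>{k..k+d}. C j) \<ge> s - 4 * \<eta> k + \<eta> (k + d)" for k d
  proof (induction d arbitrary: k)
    case 0
    show ?case using C(2)[of k] \<eta>[of k] by simp
  next
    case (Suc d)
    define W where "W = (\<Union>j\<in>{Suc k..Suc k + d}. C j)"
    have W: "W \<in> sets (G (n k))" unfolding W_def by (intro sets.finite_UN) (auto intro: Cn)
    have Un: "(\<Union>j\<in>{k..k + Suc d}. C j) = C k \<union> W"
    proof -
      have "{k..k + Suc d} = insert k {Suc k..Suc k + d}" by auto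
      then show ?thesis by (simp add: W_def)
    qed
    have [measurable]: "C k \<in> sets P" "C k \<in> sets Q" "W \<in> sets P" "W \<in> sets Q"
      using C(1) W sub by blast+
    have "\<sigma> (C k \<union> W) = \<sigma> (C k) + \<sigma> W - \<sigma> (C k \<inter> W)"
      using P.finite_measure_Union'[of "C k" W] P.finite_measure_Diff'[of W "C k"]
        Q.finite_measure_Union'[of "C k" W] Q.finite_measure_Diff'[of W "C k"]
      by (simp add: \<sigma>_def Int_commute)
    moreover have "\<sigma> (C k \<inter> W) \<le> s + \<eta> k" using C(1) W by (intro n_upper) auto
    moreover have "\<sigma> W \<ge> s - 4 * \<eta> (Suc k) + \<eta> (Suc k + d)"
      unfolding W_def by (rule Suc.IH)
    moreover have "2 * \<eta> (Suc k) = \<eta> k" by (simp add: \<eta>_def)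
    ultimately show ?case using C(2)[of k] unfolding Un by simp
  qed
  define U where "U k = (\<Union>j\<in>{k..}. C j)" for k
  have U_G: "U k \<in> sets (G (n k))" for k
    unfolding U_def by (intro sets.countable_UN'') (auto intro: Cn)
  have UPQ: "U k \<in> sets P" "U k \<in> sets Q" for k using U_G sub by blast+
  have U: "\<sigma> (U k) \<ge> s - 4 * \<eta> 0" for k
  proof -
    have lim: "(\<lambda>d. \<sigma> (\<Union>j\<in>{k..k+d}. C j)) \<longlonglongrightarrow> \<sigma> (\<Union>d. \<Union>j\<in>{k..k+d}. C j)"
      unfolding \<sigma>_def using C(1) sub
      by (intro tendsto_diff P.finite_Lim_measure_incseq Q.finite_Lim_measure_incseq)
        (fastforce simp: incseq_def)+
    have "(\<Union>d. \<Union>j\<in>{k..k+d}. C j) = U k"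
    proof (intro set_eqI iffI)
      fix y assume "y \<in> U k"
      then obtain j where "j \<ge> k" "y \<in> C j" by (auto simp: U_def)
      then show "y \<in> (\<Union>d. \<Union>j\<in>{k..k+d}. C j)"
        by (intro UN_I[of "j - k"] UN_I[of j]) auto
    qed (auto simp: U_def)
    moreover have "s - 4 * \<eta> 0 \<le> \<sigma> (\<Union>j\<in>{k..k+d}. C j)" for d
    proof -
      have "\<eta> k \<le> \<eta> 0" using \<open>0 < \<epsilon>\<close> by (simp add: \<eta>_def field_simps)
      with union[of k d] \<eta>[of "k + d"] show ?thesis by linarith
    qed
    ultimately show ?thesis using lim by (intro LIMSEQ_le_const) auto
  qed
  define A where "A = (\<Inter>k. U k)"
  have dec: "decseq U" by (force simp: U_def decseq_def)
  have AG: "A \<in> sets (G m)" for m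
  proof -
    have "A = (\<Inter>k\<in>{m..}. U k)"
    proof (intro antisym subsetI)
      fix y assume y: "y \<in> (\<Inter>k\<in>{m..}. U k)"
      have "y \<in> U k" for k
        using y dec[THEN decseqD, of k "max k m"] by auto
      then show "y \<in> A" by (simp add: A_def)
    qed (auto simp: A_def)
    moreover have "U k \<in> sets (G m)" if "m \<le> k" for k
    proof -
      have "m \<le> n k" using that by (simp add: n_def)
      with U_G[of k] anti show ?thesis by blast
    qed
    ultimately show ?thesis by (auto intro!: sets.countable_INT'')
  qed
  have "(\<lambda>k. \<sigma> (U k)) \<longlonglongrightarrow> \<sigma> A"
    unfolding \<sigma>_def A_def using UPQ dec
    by (intro tendsto_diff P.finite_Lim_measure_decseq Q.finite_Lim_measure_decseq) auto
  then have "s - 4 * \<eta> 0 \<le> \<sigma> A" using U by (intro LIMSEQ_le_const) auto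
  moreover have "s - 4 * \<eta> 0 > 0" using s \<open>0 < \<epsilon>\<close> by (simp add: \<eta>_def)
  ultimately have "\<sigma> A > 0" by linarith
  with tail[OF AG] show False by (simp add: \<sigma>_def)
qed

section \<open>Translations, finitary events and words\<close>

definition translate :: "int \<Rightarrow> (int \<Rightarrow> 'a) \<Rightarrow> (int \<Rightarrow> 'a)" where
  "translate k y = (\<lambda>i. y (i + k))"

lemma translate_translate [simp]: "translate j (translate k y) = translate (j + k) y"
  by (simp add: translate_def add.assoc)

lemma translate_0 [simp]: "translate 0 y = y"
  by (simp add: translate_def)

lemma shift_eq_translate: "shift = translate 1"
  by (simp add: fun_eq_iff shift_def translate_def)

lemma funpow_shift: "shift ^^ n = translate (int n)"
proof
  show "(shift ^^ n) y = translate (int n) y" for y :: "int \<Rightarrow> 'a"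
    by (induction n) (auto simp: shift_eq_translate)
qed

lemma measurable_translate [measurable]: "translate k \<in> measurable seq_space seq_space"
  unfolding translate_def[abs_def] seq_space_def
  by (intro measurable_PiM_single') (auto intro: measurable_component_singleton)

lemma vimage_translate_sets [measurable]: "A \<in> sets seq_space \<Longrightarrow> translate k -` A \<in> sets seq_space"
  using measurable_sets[OF measurable_translate, of A k] by simp

lemma coord_algebra_sets: "A \<in> sets (coord_algebra I) \<Longrightarrow> A \<in> sets seq_space"
  using subalgebra_coord_algebra by blast

lemma coord_algebra_mono: "I \<subseteq> J \<Longrightarrow> sets (coord_algebra I) \<subseteq> sets (coord_algebra J)"
  unfolding sets_coord_algebra by (intro sigma_sets_mono') blast

lemma coord_in_coord_algebra: "i \<in> I \<Longrightarrow> (\<lambda>y. y i) -` B \<in> sets (coord_algebra I)"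
  unfolding sets_coord_algebra by (intro sigma_sets.Basic) blast

lemma vimage_translate_coord_algebra:
  assumes "A \<in> sets (coord_algebra I)" "(\<lambda>i. i + k) ` I \<subseteq> J"
  shows "translate k -` A \<in> sets (coord_algebra J)"
  using assms(1) unfolding sets_coord_algebra
proof induction
  case (Basic D)
  then obtain i B where D: "D = (\<lambda>y. y i) -` B" "i \<in> I" by blast
  then have "translate k -` D = (\<lambda>y. y (i + k)) -` B" by (auto simp: translate_def)
  then show ?case using D(2) assms(2) by (intro sigma_sets.Basic) blast
next
  case (Compl D)
  then show ?case by (simp add: vimage_Diff sigma_sets.Compl)
qed (auto simp: vimage_Union intro: sigma_sets.Empty sigma_sets.Union)

text \<open>
  A finite set of coordinates is used instead of a window of consecutive ones, so that one notion
  covers cylinders at any position and unions of coordinate sets need no normalisation.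
\<close>

definition depends_on :: "int set \<Rightarrow> (int \<Rightarrow> 'a) set \<Rightarrow> bool" where
  "depends_on I C \<longleftrightarrow> (\<forall>y z. (\<forall>i\<in>I. y i = z i) \<longrightarrow> (y \<in> C \<longleftrightarrow> z \<in> C))"

definition finitary :: "(int \<Rightarrow> 'a) set \<Rightarrow> bool" where
  "finitary C \<longleftrightarrow> (\<exists>I. finite I \<and> depends_on I C)"

lemma depends_onD: "depends_on I C \<Longrightarrow> (\<And>i. i \<in> I \<Longrightarrow> y i = z i) \<Longrightarrow> y \<in> C \<longleftrightarrow> z \<in> C"
  by (auto simp: depends_on_def)

lemma depends_on_mono: "depends_on I C \<Longrightarrow> I \<subseteq> J \<Longrightarrow> depends_on J C"
  by (auto simp: depends_on_def)

lemma depends_on_Compl: "depends_on I C \<Longrightarrow> depends_on I (- C)"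
  by (auto simp: depends_on_def)

lemma depends_on_Int: "depends_on I C \<Longrightarrow> depends_on J D \<Longrightarrow> depends_on (I \<union> J) (C \<inter> D)"
  unfolding depends_on_def Int_iff Un_iff by blast

lemma depends_on_vimage_translate:
  "depends_on I C \<Longrightarrow> depends_on ((\<lambda>i. i + k) ` I) (translate k -` C)"
  by (force simp: depends_on_def translate_def)

lemma depends_on_Union_cubes:
  assumes "depends_on I C"
  shows "C = (\<Union>h\<in>(\<lambda>y. restrict y I) ` C. \<Inter>i\<in>I. (\<lambda>y. y i) -` {h i})"
proof (intro set_eqI iffI)
  fix y assume "y \<in> (\<Union>h\<in>(\<lambda>y. restrict y I) ` C. \<Inter>i\<in>I. (\<lambda>y. y i) -` {h i})"
  then obtain z where "z \<in> C" "\<forall>i\<in>I. y i = z i" by auto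
  then show "y \<in> C" using depends_onD[OF assms, of y z] by auto
qed auto

lemma finite_restrict_image:
  fixes C :: "(int \<Rightarrow> 'a::finite) set"
  shows "finite I \<Longrightarrow> finite ((\<lambda>y. restrict y I) ` C)"
  by (rule finite_subset[OF _ finite_PiE[of I "\<lambda>_. UNIV"]]) auto

lemma depends_on_coord_algebra:
  fixes C :: "(int \<Rightarrow> 'a::finite) set"
  assumes "finite I" "depends_on I C"
  shows "C \<in> sets (coord_algebra I)"
proof (cases "I = {}")
  case True
  have "C = {} \<or> C = UNIV" using assms(2) by (auto simp: True depends_on_def)
  then show ?thesis using sets.top[of "coord_algebra I"] by auto
next
  case False
  then show ?thesis
    using assms finite_restrict_image[OF assms(1)]
    by (subst depends_on_Union_cubes[OF assms(2)])
      (intro sets.finite_UN sets.finite_INT coord_in_coord_algebra)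
qed

lemma finitary_sets: "finitary C \<Longrightarrow> C \<in> sets (seq_space :: (int \<Rightarrow> 'a::finite) measure)"
  unfolding finitary_def using depends_on_coord_algebra coord_algebra_sets by blast

lemma sets_coord_algebra_finitary:
  "sets (coord_algebra J :: (int \<Rightarrow> 'a::finite) measure)
     = sigma_sets UNIV {C. \<exists>I\<subseteq>J. finite I \<and> depends_on I C}"
proof (rule antisym)
  have "\<exists>I\<subseteq>J. finite I \<and> depends_on I ((\<lambda>y. y i) -` B)" if "i \<in> J" for i and B :: "'a set"
    using that by (intro exI[of _ "{i}"]) (auto simp: depends_on_def)
  then show "sets (coord_algebra J) \<subseteq> sigma_sets UNIV {C :: (int \<Rightarrow> 'a) set. \<exists>I\<subseteq>J. finite I \<and> depends_on I C}"
    unfolding sets_coord_algebra by (intro sigma_sets_mono') blast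
  show "sigma_sets UNIV {C :: (int \<Rightarrow> 'a) set. \<exists>I\<subseteq>J. finite I \<and> depends_on I C} \<subseteq> sets (coord_algebra J)"
    using depends_on_coord_algebra coord_algebra_mono
    by (intro sets.sigma_sets_subset[of _ "coord_algebra J", unfolded space_coord_algebra]) blast
qed

lemma sets_seq_space_finitary:
  "sets (seq_space :: (int \<Rightarrow> 'a::finite) measure) = sigma_sets UNIV {C. finitary C}"
  using sets_coord_algebra_finitary[of UNIV] by (simp add: sets_coord_algebra_UNIV finitary_def)

text \<open>
  Events that depend on finitely many coordinates in \<open>J\<close> are stable under intersection and
  generate the \<open>\<sigma>\<close>-algebra, so this is an instance of Dynkin's uniqueness argument; it is stated
  for a sub-\<open>\<sigma>\<close>-algebra because measures are later compared on the past or on the future only.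
\<close>

lemma measure_eq_on_coord_algebra:
  fixes M N :: "(int \<Rightarrow> 'a::finite) measure"
  assumes "finite_measure M" "finite_measure N"
    and sets: "sets M = sets seq_space" "sets N = sets seq_space"
    and eq: "\<And>I C. I \<subseteq> J \<Longrightarrow> finite I \<Longrightarrow> depends_on I C \<Longrightarrow> measure M C = measure N C"
    and "B \<in> sets (coord_algebra J)"
  shows "measure M B = measure N B"
proof -
  interpret M: finite_measure M by fact
  interpret N: finite_measure N by fact
  let ?G = "{C :: (int \<Rightarrow> 'a) set. \<exists>I\<subseteq>J. finite I \<and> depends_on I C}"
  have sp: "space M = UNIV" "space N = UNIV"
    using sets_eq_imp_space_eq[OF sets(1)] sets_eq_imp_space_eq[OF sets(2)] by simp_all
  have meas: "C \<in> sets M" "C \<in> sets N" if "C \<in> sigma_sets UNIV ?G" for C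
    using that coord_algebra_sets[of C J] unfolding sets sets_coord_algebra_finitary by blast+
  have stable: "Int_stable ?G"
  proof (rule Int_stableI)
    fix C D assume "C \<in> ?G" "D \<in> ?G"
    then obtain I I' where "I \<subseteq> J" "finite I" "depends_on I C" "I' \<subseteq> J" "finite I'" "depends_on I' D"
      by blast
    then show "C \<inter> D \<in> ?G"
      by (intro CollectI exI[of _ "I \<union> I'"]) (simp add: depends_on_Int)
  qed
  have top: "measure M UNIV = measure N UNIV"
    by (rule eq[of "{}"]) (simp_all add: depends_on_def)
  have "B \<in> sigma_sets UNIV ?G" using assms(6) unfolding sets_coord_algebra_finitary .
  then show ?thesis
  proof (induction B rule: sigma_sets_induct_disjoint[OF stable subset_UNIV[of ?G, folded Pow_UNIV], consumes 1, case_names basic empty compl union])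
    case (basic C)
    then show ?case using eq by blast
  next
    case (compl C)
    then show ?case
      using M.finite_measure_compl[of C] N.finite_measure_compl[of C] meas[of C] top
      by (simp add: sp)
  next
    case (union C)
    have "(\<lambda>i. measure M (C i)) sums measure M (\<Union>i. C i)"
      using union meas by (intro M.finite_measure_UNION) auto
    moreover have "(\<lambda>i. measure N (C i)) sums measure N (\<Union>i. C i)"
      using union meas by (intro N.finite_measure_UNION) auto
    ultimately show ?case using union by (simp add: sums_iff)
  qed auto
qed

lemma seq_measure_eqI:
  fixes M N :: "(int \<Rightarrow> 'a::finite) measure"
  assumes "finite_measure M" "finite_measure N" "sets M = sets seq_space" "sets N = sets seq_space"
    and "\<And>C. finitary C \<Longrightarrow> measure M C = measure N C"
  shows "M = N"
proof (rule measure_eqI)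
  interpret M: finite_measure M by fact
  interpret N: finite_measure N by fact
  fix C assume "C \<in> sets M"
  then have "C \<in> sets (coord_algebra UNIV)" using assms(3) by (simp add: sets_coord_algebra_UNIV)
  then have "measure M C = measure N C"
  proof (rule measure_eq_on_coord_algebra[OF assms(1-4), rotated])
    show "measure M D = measure N D" if "finite I" "depends_on I D" for I D
      using that by (intro assms(5)) (auto simp: finitary_def)
  qed
  then show "emeasure M C = emeasure N C"
    by (simp add: M.emeasure_eq_measure N.emeasure_eq_measure)
qed (simp add: assms(3,4))

definition words :: "nat \<Rightarrow> 'a list set" where
  "words n = {w. length w = n}"

lemma finite_words [simp]: "finite (words n :: 'a::finite list set)"
  unfolding words_def using finite_lists_length_eq[of "UNIV :: 'a set" n] by simp

lemma words_0 [simp]: "words 0 = {[]}"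
  by (auto simp: words_def)

lemma length_initial_word [simp]: "length (initial_word y n) = n"
  by (simp add: initial_word_def)

lemma initial_word_in_words [simp]: "initial_word y n \<in> words n"
  by (simp add: words_def)

lemma nth_initial_word [simp]: "i < n \<Longrightarrow> initial_word y n ! i = y (int i)"
  by (simp add: initial_word_def)

lemma in_cylinder_iff: "y \<in> cylinder w \<longleftrightarrow> initial_word y (length w) = w"
  unfolding list_eq_iff_nth_eq[of "initial_word y (length w)" w] by (simp add: cylinder_def)

lemma cylinder_Nil [simp]: "cylinder [] = UNIV"
  by (simp add: cylinder_def)

lemma cylinder_append: "cylinder (u @ v) = cylinder u \<inter> translate (int (length u)) -` cylinder v"
proof (intro set_eqI iffI)
  fix y assume y: "y \<in> cylinder (u @ v)"
  have y: "y (int i) = (u @ v) ! i" if "i < length u + length v" for i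
    using y that by (simp add: cylinder_def)
  have "y (int i) = u ! i" if "i < length u" for i
    using y[of i] that by (simp add: nth_append)
  moreover have "y (int i + int (length u)) = v ! i" if "i < length v" for i
    using y[of "length u + i"] that by (simp add: nth_append add.commute)
  ultimately show "y \<in> cylinder u \<inter> translate (int (length u)) -` cylinder v"
    by (simp add: cylinder_def translate_def)
next
  fix y assume y: "y \<in> cylinder u \<inter> translate (int (length u)) -` cylinder v"
  have "y (int i) = (u @ v) ! i" if "i < length u + length v" for i
  proof (cases "i < length u")
    case True with y show ?thesis by (simp add: cylinder_def nth_append)
  next
    case False
    then obtain j where "i = length u + j" by (metis add_diff_inverse_nat)
    with y that show ?thesis by (simp add: cylinder_def translate_def nth_append add.commute)
  qed
  then show "y \<in> cylinder (u @ v)" by (simp add: cylinder_def)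
qed

lemma cylinder_Cons: "cylinder (a # w) = {y. y 0 = a} \<inter> translate 1 -` cylinder w"
proof -
  have "cylinder [a] = {y. y 0 = a}" by (simp add: cylinder_def)
  then show ?thesis using cylinder_append[of "[a]" w] by simp
qed

lemma depends_on_cylinder: "depends_on {0..<int (length w)} (cylinder w)"
  by (auto simp: depends_on_def cylinder_def)

lemma depends_on_initial_word: "depends_on {0..<int n} {y. initial_word y n \<in> W}"
  unfolding depends_on_def
proof (intro allI impI)
  fix y z :: "int \<Rightarrow> 'a" assume "\<forall>i\<in>{0..<int n}. y i = z i"
  then have "initial_word y n = initial_word z n" by (simp add: initial_word_def)
  then show "y \<in> {y. initial_word y n \<in> W} \<longleftrightarrow> z \<in> {y. initial_word y n \<in> W}" by simp
qed

lemma initial_word_sets [measurable]: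
  "{y. initial_word y n \<in> W} \<in> sets (seq_space :: (int \<Rightarrow> 'a::finite) measure)"
  by (intro finitary_sets) (auto simp: finitary_def intro: depends_on_initial_word)

lemma measure_words_decomposition:
  fixes C :: "(int \<Rightarrow> 'a::finite) set"
  assumes "finite_measure M" "sets M = sets seq_space" "C \<in> sets seq_space"
  shows "measure M C = (\<Sum>w\<in>words n. measure M (C \<inter> translate k -` cylinder w))"
proof -
  interpret finite_measure M by fact
  have m: "C \<inter> translate k -` cylinder w \<in> sets M" for w :: "'a list"
    unfolding assms(2) by (intro sets.Int assms(3) vimage_translate_sets cylinder_sets)
  have "C = (\<Union>w\<in>words n. C \<inter> translate k -` cylinder w)"
    by (auto simp: in_cylinder_iff words_def)
  then have "measure M C = measure M (\<Union>w\<in>words n. C \<inter> translate k -` cylinder w)"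
    by (rule arg_cong)
  also have "\<dots> = (\<Sum>w\<in>words n. measure M (C \<inter> translate k -` cylinder w))"
  proof (rule finite_measure_finite_Union)
    show "disjoint_family_on (\<lambda>w. C \<inter> translate k -` cylinder w) (words n)"
      by (auto simp: disjoint_family_on_def in_cylinder_iff words_def)
  qed (use m in auto)
  finally show ?thesis .
qed

section \<open>The laws started from a past\<close>

lemma append_word_append: "append_word x (u @ v) = append_word (append_word x u) v"
  by (simp add: append_word_def)

lemma append_word_Nil [simp]: "append_word x [] = x"
  by (simp add: append_word_def)

lemma append_word_Cons: "append_word x (a # w) = append_word (snoc x a) w"
  by (simp add: append_word_def)

text \<open>
  The left-infinite sequences that occur as arguments of \<open>g\<close> and \<open>law\<close> are always pasts of
  translated sequences; this is the dictionary between the two descriptions.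
\<close>

lemma past_translate:
  assumes "y \<in> cylinder w"
  shows "past (translate (int (length w)) y) = append_word (past y) w"
proof
  fix k
  show "past (translate (int (length w)) y) k = append_word (past y) w k"
  proof (cases "k < length w")
    case True
    then have "past (translate (int (length w)) y) k = y (int (length w - Suc k))"
      by (simp add: past_def translate_def of_nat_diff algebra_simps)
    also have "\<dots> = w ! (length w - Suc k)" 
      by (rule assms[unfolded cylinder_def mem_Collect_eq, rule_format]) (use True in simp)
    finally show ?thesis using True by (simp add: append_word_nth rev_nth)
  next
    case False
    then have "int (k - length w) = int k - int (length w)" by simp
    with False show ?thesis by (simp add: append_word_nth past_def translate_def algebra_simps)
  qed
qed

lemma measurable_snoc [measurable]:
  "(\<lambda>x. snoc x a) \<in> measurable (PiM UNIV (\<lambda>_. count_space UNIV)) (PiM UNIV (\<lambda>_. count_space UNIV))"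
proof (rule measurable_PiM_single')
  fix i :: nat
  show "(\<lambda>x. snoc x a i) \<in> measurable (PiM UNIV (\<lambda>_. count_space UNIV)) (count_space UNIV)"
    by (cases i) (simp_all add: snoc_def measurable_component_singleton)
qed auto

lemma measurable_append_word [measurable]:
  "(\<lambda>x. append_word x w) \<in> measurable (PiM UNIV (\<lambda>_. count_space UNIV)) (PiM UNIV (\<lambda>_. count_space UNIV))"
proof (induction w rule: rev_induct)
  case (snoc a w)
  from measurable_compose[OF snoc.IH measurable_snoc] show ?case by (simp add: append_word_snoc)
qed simp

lemma measurable_past_coord_algebra:
  "past \<in> measurable (coord_algebra {..-1}) (PiM UNIV (\<lambda>_. count_space (UNIV :: 'a set)))"
proof (rule measurable_PiM_single')
  fix k :: nat
  have "(\<lambda>y. past y k) -` B \<in> sets (coord_algebra {..-1})" for B :: "'a set"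
    using coord_in_coord_algebra[of "-1 - int k" "{..-1}" B] by (simp add: past_def)
  then show "(\<lambda>y :: int \<Rightarrow> 'a. past y k) \<in> measurable (coord_algebra {..-1}) (count_space UNIV)"
    by (intro measurableI) auto
qed auto

lemma measurable_past [measurable]:
  "past \<in> measurable seq_space (PiM UNIV (\<lambda>_. count_space (UNIV :: 'a set)))"
proof (rule measurable_from_subalg)
  show "subalgebra seq_space (coord_algebra {..-1} :: (int \<Rightarrow> 'a) measure)"
    by (simp add: subalgebra_def subalgebra_coord_algebra)
qed (rule measurable_past_coord_algebra)

text \<open>
  Once the finitely many nonnegative coordinates are fixed to a word \<open>w\<close>, membership depends
  on the past only.
\<close>

lemma depends_on_split:
  fixes C :: "(int \<Rightarrow> 'a::finite) set"
  assumes "finitary C"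
  shows "\<exists>n D. (\<forall>w\<in>words n. D w \<in> sets (coord_algebra {..-1})) \<and> C = (\<Union>w\<in>words n. D w \<inter> cylinder w)"
proof -
  obtain I where I: "finite I" "depends_on I C" using assms by (auto simp: finitary_def)
  define n where "n = nat (Max (insert 0 I) + 1)"
  have n: "i < int n" if "i \<in> I" for i
    using Max_ge[of "insert 0 I" i] I(1) that by (simp add: n_def)
  define glue where "glue w y = (\<lambda>i. if i < 0 then y i else w ! nat i)" for w and y :: "int \<Rightarrow> 'a"
  define D where "D w = {y. glue w y \<in> C}" for w
  have "depends_on (I \<inter> {..-1}) (D w)" for w
    unfolding depends_on_def D_def mem_Collect_eq
    by (intro allI impI depends_onD[OF I(2)]) (simp add: glue_def)
  then have "D w \<in> sets (coord_algebra {..-1})" for w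
    using depends_on_coord_algebra[of "I \<inter> {..-1}" "D w"] coord_algebra_mono[of "I \<inter> {..-1}" "{..-1}"] I(1)
    by blast
  moreover have "y \<in> D w \<longleftrightarrow> y \<in> C" if "w \<in> words n" "y \<in> cylinder w" for w y
    unfolding D_def mem_Collect_eq
  proof (rule depends_onD[OF I(2)])
    fix i assume "i \<in> I"
    show "glue w y i = y i"
    proof (cases "i < 0")
      case False
      then obtain k where k: "i = int k" using zero_le_imp_eq_int[of i] by auto
      then have "k < n" using n[OF \<open>i \<in> I\<close>] by simp
      then show ?thesis using k that unfolding cylinder_def words_def by (simp add: glue_def)
    qed (simp add: glue_def)
  qed
  then have "C = (\<Union>w\<in>words n. D w \<inter> cylinder w)"
    by (auto simp: in_cylinder_iff words_def)
  ultimately show ?thesis by blast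
qed

text \<open>
  The sets on which a law started from a past is known explicitly.
\<close>

definition past_future_sets :: "(int \<Rightarrow> 'a) set set" where
  "past_future_sets = {C \<inter> cylinder w | C w. C \<in> sets (coord_algebra {..-1})}"

lemma past_future_sets_measurable: "past_future_sets \<subseteq> sets seq_space"
  using coord_algebra_sets cylinder_sets by (auto simp: past_future_sets_def)

lemma Int_stable_past_future_sets: "Int_stable past_future_sets"
proof (rule Int_stableI)
  fix X Y :: "(int \<Rightarrow> 'a) set" assume "X \<in> past_future_sets" "Y \<in> past_future_sets"
  then obtain C D v w where XY: "X = C \<inter> cylinder v" "Y = D \<inter> cylinder w"
    and "C \<in> sets (coord_algebra {..-1})" "D \<in> sets (coord_algebra {..-1})"
    unfolding past_future_sets_def by blast
  then have CD: "C \<inter> D \<in> sets (coord_algebra {..-1})" by blast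
  have empty: "{} = {} \<inter> cylinder v" by simp
  from cylinder_Int[of v w] have "X \<inter> Y = {} \<or> X \<inter> Y = (C \<inter> D) \<inter> cylinder v \<or> X \<inter> Y = (C \<inter> D) \<inter> cylinder w"
    unfolding XY by blast
  then show "X \<inter> Y \<in> past_future_sets"
    using CD empty sets.empty_sets[of "coord_algebra {..-1}"] unfolding past_future_sets_def by blast
qed

lemma sets_seq_space_past_future:
  "sets (seq_space :: (int \<Rightarrow> 'a::finite) measure) = sigma_sets UNIV past_future_sets"
proof (rule antisym)
  interpret S: sigma_algebra UNIV "sigma_sets UNIV (past_future_sets :: (int \<Rightarrow> 'a) set set)"
    by (rule sigma_algebra_sigma_sets) simp
  have "C \<in> sigma_sets UNIV past_future_sets" if fin: "finitary C" for C :: "(int \<Rightarrow> 'a) set"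
  proof -
    obtain n D where D: "\<forall>w\<in>words n. D w \<in> sets (coord_algebra {..-1})"
      and C: "C = (\<Union>w\<in>words n. D w \<inter> cylinder w)"
      using depends_on_split[OF fin] by blast
    show ?thesis unfolding C
    proof (rule S.finite_UN)
      show "D w \<inter> cylinder w \<in> sigma_sets UNIV past_future_sets" if "w \<in> words n" for w
        using D that by (intro sigma_sets.Basic) (auto simp: past_future_sets_def)
    qed simp
  qed
  then show "sets (seq_space :: (int \<Rightarrow> 'a) measure) \<subseteq> sigma_sets UNIV past_future_sets"
    unfolding sets_seq_space_finitary by (intro sigma_sets_mono) auto
  show "sigma_sets UNIV past_future_sets \<subseteq> sets (seq_space :: (int \<Rightarrow> 'a) measure)"
    by (rule sets.sigma_sets_subset[of _ seq_space, unfolded space_seq_space, OF past_future_sets_measurable])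
qed

lemma sum_words_Suc:
  fixes f :: "'a::finite list \<Rightarrow> real"
  shows "(\<Sum>w\<in>words (Suc n). f w) = (\<Sum>w\<in>words n. \<Sum>a\<in>UNIV. f (w @ [a]))"
proof -
  have "(\<Sum>w\<in>words n. \<Sum>a\<in>UNIV. f (w @ [a])) = (\<Sum>(w, a)\<in>words n \<times> UNIV. f (w @ [a]))"
    by (simp add: sum.cartesian_product)
  also have "\<dots> = (\<Sum>w\<in>words (Suc n). f w)"
    by (rule sum.reindex_bij_witness[where i = "\<lambda>w. (butlast w, last w)" and j = "\<lambda>(w, a). w @ [a]"])
      (auto simp: words_def, metis append_butlast_last_id length_0_conv nat.distinct(1))
  finally show ?thesis by simp
qed

locale g_chain =
  fixes g :: "'a::finite lseq \<Rightarrow> real"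
  assumes g_fun: "g_function g"
begin

abbreviation law :: "'a lseq \<Rightarrow> (int \<Rightarrow> 'a) measure" where
  "law x \<equiv> past_measure g x"

lemma g_nonneg [simp]: "0 \<le> g x" and g_le_1 [simp]: "g x \<le> 1"
  and sum_g: "(\<Sum>a\<in>UNIV. g (snoc x a)) = 1"
  and measurable_g [measurable]: "g \<in> borel_measurable (PiM UNIV (\<lambda>_. count_space UNIV))"
  using g_fun by (simp_all add: g_function_def)

lemma g_word_nonneg [simp]: "0 \<le> g_word g x w"
  by (simp add: g_word_def prod_nonneg)

lemma g_word_le_1 [simp]: "g_word g x w \<le> 1"
  by (simp add: g_word_def prod_le_1)

lemma g_word_Nil [simp]: "g_word g x [] = 1"
  by (simp add: g_word_def)

lemma measurable_g_word [measurable]: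
  "(\<lambda>x. g_word g x w) \<in> borel_measurable (PiM UNIV (\<lambda>_. count_space UNIV))"
  unfolding g_word_def by measurable

lemma g_word_append: "g_word g x (u @ v) = g_word g x u * g_word g (append_word x u) v"
proof (induction v rule: rev_induct)
  case (snoc a v)
  then show ?case
    using g_word_snoc[of g x "u @ v" a] g_word_snoc[of g "append_word x u" v a]
    by (simp add: append_word_append)
qed simp

lemma g_word_Cons: "g_word g x (a # w) = g (snoc x a) * g_word g (snoc x a) w"
  using g_word_append[of x "[a]" w] by (simp add: g_word_def append_word_def)

lemma sum_g_word: "(\<Sum>w\<in>words n. g_word g x w) = 1"
proof (induction n)
  case (Suc n)
  then show ?case by (simp add: sum_words_Suc g_word_snoc sum_g flip: sum_distrib_left)
qed simp

lemma law: "is_past_measure g x (law x)"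
  by (rule past_measure[OF g_fun])

lemma prob_space_law: "prob_space (law x)"
  and sets_law [simp, measurable_cong]: "sets (law x) = sets seq_space"
  using law by (simp_all add: is_past_measure_def)

lemma space_law [simp]: "space (law x) = UNIV"
  using sets_eq_imp_space_eq[OF sets_law] by simp

sublocale law: prob_space "law x" for x
  by (rule prob_space_law)

lemma law_cylinder: "measure (law x) (cylinder w) = g_word g x w"
proof (cases "w = []")
  case True
  then show ?thesis using law.prob_space[of x] by simp
next
  case False
  then show ?thesis using law by (simp add: is_past_measure_def)
qed

text \<open>
  That the past equals \<open>x\<close> is an event of the past, being a countable intersection of coordinate
  events, so the defining property of the law applies to it.
\<close>

lemma AE_law_past: "AE y in law x. past y = x"
proof -
  obtain y where y: "past y = x" using ex_past by blast
  have eq: "{z. past z = x} = (\<Inter>k. (\<lambda>z. z (- 1 - int k)) -` {x k})"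
    by (auto simp: past_def fun_eq_iff)
  have m: "{z. past z = x} \<in> sets (coord_algebra {..-1})"
    unfolding eq using sets.top[of "coord_algebra {..-1}"]
    by (intro sets.countable_INT'' coord_in_coord_algebra) auto
  then have "measure (law x) {z. past z = x} = indicator {z. past z = x} y"
    using law y unfolding is_past_measure_def by blast
  then have "measure (law x) {z. past z = x} = 1" using y by simp
  then have "AE z in law x. z \<in> {z. past z = x}"
    using coord_algebra_sets[OF m] by (intro law.AE_prob_1) auto
  then show ?thesis by simp
qed

lemma law_Int_past:
  assumes C: "C \<in> sets (coord_algebra {..-1})" and B: "B \<in> sets seq_space" and y: "past y = x"
  shows "measure (law x) (C \<inter> B) = indicator C y * measure (law x) B"
proof -
  have "AE z in law x. z \<in> C \<longleftrightarrow> y \<in> C"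
    using AE_law_past by eventually_elim (rule past_coord_determined[OF C], simp add: y)
  then have "measure (law x) (C \<inter> B) = measure (law x) (if y \<in> C then B else {})"
    using coord_algebra_sets[OF C] B
    by (intro law.finite_measure_eq_AE) (auto elim!: AE_mp)
  then show ?thesis by simp
qed

text \<open>
  By the generator criterion for probability kernels it suffices to look at \<open>C \<inter> cylinder w\<close>,
  where the probability is the indicator of \<open>C\<close> times a product of values of \<open>g\<close>.
\<close>

lemma measurable_law: "law \<in> measurable (PiM UNIV (\<lambda>_. count_space UNIV)) (prob_algebra seq_space)"
proof (rule measurable_prob_algebra_generated[OF sets_seq_space_past_future Int_stable_past_future_sets])
  fix A :: "(int \<Rightarrow> 'a) set" assume "A \<in> past_future_sets"
  then obtain C w where A: "A = C \<inter> cylinder w" and C: "C \<in> sets (coord_algebra {..-1})"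
    unfolding past_future_sets_def by blast
  \<comment> \<open>A measurable choice of a two-sided sequence with past \<open>x\<close>.\<close>
  define glue where "glue x = (\<lambda>i. if i < 0 then x (nat (- 1 - i)) else undefined)" for x :: "'a lseq" and i :: int
  have past_glue: "past (glue x) = x" for x by (auto simp: past_def glue_def)
  have [measurable]: "glue \<in> measurable (PiM UNIV (\<lambda>_. count_space UNIV)) seq_space"
    unfolding seq_space_def
  proof (rule measurable_PiM_single')
    show "(\<lambda>x. glue x i) \<in> measurable (PiM UNIV (\<lambda>_. count_space UNIV)) (count_space UNIV)" for i
      by (cases "i < 0") (simp_all add: glue_def measurable_component_singleton)
  qed auto
  have [measurable]: "C \<in> sets seq_space" using C by (rule coord_algebra_sets)
  have "emeasure (law x) A = ennreal (indicator C (glue x) * g_word g x w)" for x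
    unfolding A law.emeasure_eq_measure
    by (subst law_Int_past[OF C cylinder_sets past_glue]) (simp add: law_cylinder)
  then show "(\<lambda>x. emeasure (law x) A) \<in> borel_measurable (PiM UNIV (\<lambda>_. count_space UNIV))"
    by simp
qed (simp_all add: prob_space_law past_future_sets_def)

lemma measurable_law_subprob [measurable]:
  "law \<in> measurable (PiM UNIV (\<lambda>_. count_space UNIV)) (subprob_algebra seq_space)"
  by (rule measurable_prob_algebraD[OF measurable_law])

lemma measurable_law_measure [measurable (raw)]:
  assumes [measurable]: "B \<in> sets seq_space" "f \<in> measurable N (PiM UNIV (\<lambda>_. count_space UNIV))"
  shows "(\<lambda>y. measure (law (f y)) B) \<in> borel_measurable N"
  by (rule measurable_compose[OF assms(2)])
    (rule measurable_compose[OF measurable_law_subprob measurable_measure_subprob_algebra[OF assms(1)]])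

lemma law_future:
  "measure (law x) {y. initial_word y n \<in> W} = (\<Sum>w\<in>W \<inter> words n. g_word g x w)"
proof -
  have "measure (law x) {y. initial_word y n \<in> W} =
      (\<Sum>w\<in>words n. measure (law x) ({y. initial_word y n \<in> W} \<inter> translate 0 -` cylinder w))"
    by (rule measure_words_decomposition) (simp_all add: law.finite_measure_axioms)
  also have "\<dots> = (\<Sum>w\<in>words n. if w \<in> W then g_word g x w else 0)"
  proof (rule sum.cong)
    fix w :: "'a list" assume "w \<in> words n"
    then have "{y. initial_word y n \<in> W} \<inter> translate 0 -` cylinder w = (if w \<in> W then cylinder w else {})"
      by (auto simp: in_cylinder_iff words_def)
    then show "measure (law x) ({y. initial_word y n \<in> W} \<inter> translate 0 -` cylinder w) =
        (if w \<in> W then g_word g x w else 0)"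
      by (simp add: law_cylinder)
  qed simp
  finally show ?thesis by (simp add: sum.If_cases Int_commute)
qed

text \<open>
  The Markov property: after the first \<open>n\<close> symbols \<open>u\<close> the chain starts afresh from the past
  extended by \<open>u\<close>.
\<close>

lemma law_translate_cylinder:
  "measure (law x) (translate (int n) -` cylinder v) =
     (\<Sum>u\<in>words n. g_word g x u * g_word g (append_word x u) v)"
proof -
  have "measure (law x) (translate (int n) -` cylinder v) =
      (\<Sum>u\<in>words n. measure (law x) (translate (int n) -` cylinder v \<inter> translate 0 -` cylinder u))"
    by (rule measure_words_decomposition)
      (simp_all add: law.finite_measure_axioms vimage_translate_sets cylinder_sets)
  also have "\<dots> = (\<Sum>u\<in>words n. g_word g x u * g_word g (append_word x u) v)"
  proof (rule sum.cong)
    fix u :: "'a list" assume "u \<in> words n"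
    then have "translate (int n) -` cylinder v \<inter> translate 0 -` cylinder u = cylinder (u @ v)"
      by (auto simp: cylinder_append words_def)
    then show "measure (law x) (translate (int n) -` cylinder v \<inter> translate 0 -` cylinder u) =
        g_word g x u * g_word g (append_word x u) v"
      by (simp add: law_cylinder g_word_append)
  qed simp
  finally show ?thesis .
qed

end

section \<open>Stationary measures as mixtures of the laws\<close>

lemma measure_density_real:
  assumes "f \<in> borel_measurable M" "\<And>y. 0 \<le> f y" "A \<in> sets M"
  shows "measure (density M (\<lambda>y. ennreal (f y))) A = (\<integral>y. indicator A y * f y \<partial>M)"
proof -
  have "(\<integral>y. indicator A y * f y \<partial>M) = enn2real (\<integral>\<^sup>+y. ennreal (indicator A y * f y) \<partial>M)"
    using assms by (intro integral_eq_nn_integral) auto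
  also have "(\<integral>\<^sup>+y. ennreal (indicator A y * f y) \<partial>M) = (\<integral>\<^sup>+y. ennreal (f y) * indicator A y \<partial>M)"
    by (intro nn_integral_cong) (simp split: split_indicator)
  also have "\<dots> = emeasure (density M (\<lambda>y. ennreal (f y))) A"
    using assms by (simp add: emeasure_density)
  finally show ?thesis by (simp add: measure_def)
qed

lemma (in finite_measure) finite_measure_density_real:
  assumes "f \<in> borel_measurable M" "\<And>y. 0 \<le> f y" "\<And>y. f y \<le> 1"
  shows "finite_measure (density M (\<lambda>y. ennreal (f y)))"
proof (rule finite_measureI)
  have "emeasure (density M (\<lambda>y. ennreal (f y))) (space M) = (\<integral>\<^sup>+y. ennreal (f y) * indicator (space M) y \<partial>M)"
    using assms by (intro emeasure_density) auto
  also have "\<dots> \<le> (\<integral>\<^sup>+y. 1 \<partial>M)"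
    using assms by (intro nn_integral_mono) (simp split: split_indicator)
  also have "\<dots> < \<infinity>" by (simp add: less_top[symmetric])
  finally show "emeasure (density M (\<lambda>y. ennreal (f y))) (space (density M (\<lambda>y. ennreal (f y)))) \<noteq> \<infinity>"
    by simp
qed

locale stationary_measure = prob_space \<nu> for \<nu> :: "(int \<Rightarrow> 'a::finite) measure" +
  assumes sets_nu [simp, measurable_cong]: "sets \<nu> = sets seq_space"
    and shift_invariant: "distr \<nu> seq_space shift = \<nu>"
begin

lemma space_nu [simp]: "space \<nu> = UNIV"
  using sets_eq_imp_space_eq[OF sets_nu] by simp

text \<open>
  The shift is invertible, so invariance extends to translations by negative amounts; this is
  what allows events to be moved between past and future.
\<close>

lemma distr_translate: "distr \<nu> seq_space (translate k) = \<nu>"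
proof -
  have pos: "distr \<nu> seq_space (translate (int n)) = \<nu>" for n
  proof (induction n)
    case 0
    have "translate 0 = (\<lambda>y. y :: int \<Rightarrow> 'a)" by (simp add: fun_eq_iff)
    then show ?case using distr_id2[of seq_space \<nu>] by simp
  next
    case (Suc n)
    have "translate (int (Suc n)) = shift \<circ> (translate (int n) :: (int \<Rightarrow> 'a) \<Rightarrow> _)"
      by (simp add: fun_eq_iff shift_eq_translate)
    then have "distr \<nu> seq_space (translate (int (Suc n))) = distr (distr \<nu> seq_space (translate (int n))) seq_space shift"
      by (simp only:) (rule distr_distr[symmetric], simp_all)
    then show ?case by (simp only: Suc.IH shift_invariant)
  qed
  show ?thesis
  proof (cases "k \<ge> 0")
    case True
    then show ?thesis using pos[of "nat k"] by simp
  next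
    case False
    define n where "n = nat (- k)"
    have "distr \<nu> seq_space (translate k) = distr (distr \<nu> seq_space (translate (int n))) seq_space (translate k)"
      by (simp only: pos)
    also have "\<dots> = distr \<nu> seq_space (translate k \<circ> translate (int n))"
      by (rule distr_distr) simp_all
    also have "translate k \<circ> translate (int n) = (\<lambda>y. y :: int \<Rightarrow> 'a)"
      using False by (simp add: fun_eq_iff n_def)
    finally show ?thesis using distr_id2[of seq_space \<nu>] by simp
  qed
qed

lemma measure_translate:
  assumes "A \<in> sets seq_space"
  shows "measure \<nu> (translate k -` A) = measure \<nu> A"
proof -
  have "measure (distr \<nu> seq_space (translate k)) A = measure \<nu> (translate k -` A)"
    using assms by (subst measure_distr) simp_all
  then show ?thesis by (simp add: distr_translate)
qed

lemma integral_translate: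
  assumes "f \<in> borel_measurable seq_space"
  shows "(\<integral>y. f (translate k y) \<partial>\<nu>) = (\<integral>y. (f y :: real) \<partial>\<nu>)"
  using integral_distr[of "translate k" \<nu> seq_space f] assms by (simp add: distr_translate)

sublocale past: finite_measure_subalgebra \<nu> "coord_algebra {..-1}"
  by unfold_locales (simp add: subalgebra_def subalgebra_coord_algebra)

end

context g_chain
begin

lemma measurable_past_function:
  assumes "h \<in> borel_measurable (PiM UNIV (\<lambda>_. count_space UNIV))"
  shows "(\<lambda>y. h (past y)) \<in> borel_measurable (coord_algebra {..-1})"
  by (rule measurable_compose[OF measurable_past_coord_algebra assms])

text \<open>
  The hypothesis is the defining property of the conditional expectation, tested on events of
  the past.
\<close>

lemma compatibleI:
  assumes "stationary_measure \<nu>"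
    and step: "\<And>C a. C \<in> sets (coord_algebra {..-1}) \<Longrightarrow>
      measure \<nu> (C \<inter> {y. y 0 = a}) = (\<integral>y. indicator C y * g (snoc (past y) a) \<partial>\<nu>)"
  shows "\<nu> \<in> compatible_measures g"
proof -
  interpret stationary_measure \<nu> by fact
  have "AE y in \<nu>. real_cond_exp \<nu> (coord_algebra {..-1}) (indicator {y. y 0 = a}) y = g (snoc (past y) a)" for a
  proof (rule past.real_cond_exp_charact)
    have [measurable]: "{y. y 0 = a} \<in> sets seq_space"
      using coord_in_seq_space[of 0 "{a}"] by (simp add: vimage_def)
    fix C :: "(int \<Rightarrow> 'a) set" assume C: "C \<in> sets (coord_algebra {..-1})"
    have [measurable]: "C \<in> sets seq_space" using C by (rule coord_algebra_sets)
    have "(\<integral>y\<in>C. indicator {y. y 0 = a} y \<partial>\<nu>) = measure \<nu> (C \<inter> {y. y 0 = a})"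
      unfolding set_lebesgue_integral_def
      by (simp add: indicator_inter_arith[symmetric] Int_commute)
    also have "\<dots> = (\<integral>y\<in>C. g (snoc (past y) a) \<partial>\<nu>)"
      by (simp add: step[OF C] set_lebesgue_integral_def)
    finally show "(\<integral>y\<in>C. indicator {y. y 0 = a} y \<partial>\<nu>) = (\<integral>y\<in>C. g (snoc (past y) a) \<partial>\<nu>)" .
  next
    have [measurable]: "{y. y 0 = a} \<in> sets seq_space"
      using coord_in_seq_space[of 0 "{a}"] by (simp add: vimage_def)
    show "integrable \<nu> (indicator {y. y 0 = a} :: _ \<Rightarrow> real)"
      by (rule integrable_real_indicator) (simp_all add: less_top[symmetric])
    show "integrable \<nu> (\<lambda>y. g (snoc (past y) a))"
      by (rule integrable_const_bound[where B = 1]) auto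
    show "(\<lambda>y. g (snoc (past y) a)) \<in> borel_measurable (coord_algebra {..-1})"
      using measurable_past_function[of "\<lambda>x. g (snoc x a)"] by simp
  qed
  then show ?thesis
    using prob_space_axioms sets_nu shift_invariant by (simp add: compatible_measures_def)
qed

end

locale compatible_measure = g_chain g for g :: "'a::finite lseq \<Rightarrow> real" +
  fixes \<nu> :: "(int \<Rightarrow> 'a) measure"
  assumes compatible: "\<nu> \<in> compatible_measures g"

sublocale compatible_measure \<subseteq> stationary_measure \<nu>
  using compatible by (simp add: compatible_measures_def stationary_measure_def stationary_measure_axioms_def)

context compatible_measure
begin

lemma measure_next_symbol:
  assumes h: "h \<in> borel_measurable (coord_algebra {..-1})" and "\<And>y. \<bar>h y\<bar> \<le> 1"
  shows "(\<integral>y. h y * indicator {y. y 0 = a} y \<partial>\<nu>) = (\<integral>y. h y * g (snoc (past y) a) \<partial>\<nu>)"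
proof -
  have [measurable]: "{y. y 0 = a} \<in> sets seq_space"
    using coord_in_seq_space[of 0 "{a}"] by (simp add: vimage_def)
  have hm [measurable]: "h \<in> borel_measurable \<nu>"
    by (rule measurable_from_subalg[OF past.subalg h])
  have "integrable \<nu> (\<lambda>y. h y * indicator {y. y 0 = a} y :: real)"
    by (rule integrable_const_bound[where B = 1])
      (use assms(2) in \<open>auto split: split_indicator\<close>)
  then have "(\<integral>y. h y * indicator {y. y 0 = a} y \<partial>\<nu>)
      = (\<integral>y. h y * real_cond_exp \<nu> (coord_algebra {..-1}) (indicator {y. y 0 = a}) y \<partial>\<nu>)"
    by (intro past.real_cond_exp_intg(2)[symmetric] h) simp_all
  also have "\<dots> = (\<integral>y. h y * g (snoc (past y) a) \<partial>\<nu>)"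
  proof (rule integral_cong_AE)
    have "AE y in \<nu>. real_cond_exp \<nu> (coord_algebra {..-1}) (indicator {y. y 0 = a}) y = g (snoc (past y) a)"
      using compatible by (simp add: compatible_measures_def)
    then show "AE y in \<nu>. h y * real_cond_exp \<nu> (coord_algebra {..-1}) (indicator {y. y 0 = a}) y
        = h y * g (snoc (past y) a)"
      by eventually_elim simp
  qed simp_all
  finally show ?thesis .
qed

lemma past_shift: "past (translate 1 y) = snoc (past y) (y 0)"
  using past_translate[of y "[y 0]"] by (simp add: in_cylinder_iff initial_word_def append_word_Cons)

text \<open>
  Compatibility only describes the symbol at time \<open>0\<close>. Longer words are reduced to it by
  splitting off the first symbol and translating it into the past, which is possible by
  stationarity.
\<close>

lemma measure_past_cylinder:
  assumes "C \<in> sets (coord_algebra {..-1})"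
  shows "measure \<nu> (C \<inter> cylinder w) = (\<integral>y. indicator C y * g_word g (past y) w \<partial>\<nu>)"
  using assms
proof (induction w arbitrary: C)
  case Nil
  then show ?case using coord_algebra_sets[of C] by simp
next
  case (Cons a w)
  define C' where "C' = translate (-1) -` (C \<inter> {y. y 0 = a})"
  have "{y. y 0 = a} \<in> sets (coord_algebra {..0})"
    using coord_in_coord_algebra[of 0 "{..0}" "{a}"] by (simp add: vimage_def)
  moreover have "C \<in> sets (coord_algebra {..0})"
    using Cons.prems coord_algebra_mono[of "{..-1}" "{..0}"] by auto
  ultimately have C': "C' \<in> sets (coord_algebra {..-1})"
    unfolding C'_def by (intro vimage_translate_coord_algebra[where I = "{..0}"]) auto
  note [measurable] = coord_algebra_sets[OF C'] coord_algebra_sets[OF Cons.prems]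
  have a: "{y. y 0 = a} \<in> sets seq_space"
    using coord_in_seq_space[of 0 "{a}"] by (simp add: vimage_def)
  have "C \<inter> cylinder (a # w) = translate 1 -` (C' \<inter> cylinder w)"
    by (auto simp: C'_def cylinder_Cons)
  then have "measure \<nu> (C \<inter> cylinder (a # w)) = measure \<nu> (C' \<inter> cylinder w)"
    using coord_algebra_sets[OF C'] cylinder_sets by (simp only:) (intro measure_translate sets.Int)
  also have "\<dots> = (\<integral>y. indicator C' y * g_word g (past y) w \<partial>\<nu>)"
    by (rule Cons.IH[OF C'])
  also have "\<dots> = (\<integral>y. indicator C' (translate 1 y) * g_word g (past (translate 1 y)) w \<partial>\<nu>)"
    by (rule integral_translate[symmetric]) simp
  also have "\<dots> = (\<integral>y. (indicator C y * g_word g (snoc (past y) a) w) * indicator {y. y 0 = a} y \<partial>\<nu>)"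
    by (intro Bochner_Integration.integral_cong) (auto simp: C'_def past_shift split: split_indicator)
  also have "\<dots> = (\<integral>y. (indicator C y * g_word g (snoc (past y) a) w) * g (snoc (past y) a) \<partial>\<nu>)"
  proof (rule measure_next_symbol)
    have "(\<lambda>y. g_word g (snoc (past y) a) w) \<in> borel_measurable (coord_algebra {..-1})"
      using measurable_past_function[of "\<lambda>x. g_word g (snoc x a) w"] by simp
    then show "(\<lambda>y. indicator C y * g_word g (snoc (past y) a) w) \<in> borel_measurable (coord_algebra {..-1})"
      using Cons.prems by simp
  qed (simp split: split_indicator)
  finally show ?case by (simp add: g_word_Cons mult_ac)
qed

text \<open>
  A compatible measure is a mixture of the laws, with its own past as mixing distribution.
  Both sides agree on the generator \<open>past_future_sets\<close>.
\<close>

theorem measure_eq_integral_law: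
  assumes "A \<in> sets seq_space"
  shows "measure \<nu> A = (\<integral>y. measure (law (past y)) A \<partial>\<nu>)"
proof -
  have ker: "(\<lambda>y. law (past y)) \<in> measurable \<nu> (subprob_algebra seq_space)" by simp
  have bind: "measure (\<nu> \<bind> (\<lambda>y. law (past y))) B = (\<integral>y. measure (law (past y)) B \<partial>\<nu>)"
    if "B \<in> sets seq_space" for B
    by (rule measure_bind[OF ker that])
  interpret B: prob_space "\<nu> \<bind> (\<lambda>y. law (past y))"
    by (rule prob_space_bind[OF _ ker]) (simp add: prob_space_law)
  have setsB: "sets (\<nu> \<bind> (\<lambda>y. law (past y))) = sets seq_space"
    by (rule sets_bind[OF _ ]) simp_all
  have "\<nu> = \<nu> \<bind> (\<lambda>y. law (past y))"
  proof (rule measure_eqI_generator_eq[OF Int_stable_past_future_sets])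
    fix X :: "(int \<Rightarrow> 'a) set" assume X: "X \<in> past_future_sets"
    then obtain C w where XC: "X = C \<inter> cylinder w" and C: "C \<in> sets (coord_algebra {..-1})"
      unfolding past_future_sets_def by blast
    have "measure (law (past y)) X = indicator C y * g_word g (past y) w" for y
      unfolding XC by (simp add: law_Int_past[OF C cylinder_sets] law_cylinder)
    moreover have "X \<in> sets seq_space"
      using X past_future_sets_measurable by blast
    ultimately have "measure \<nu> X = measure (\<nu> \<bind> (\<lambda>y. law (past y))) X"
      using measure_past_cylinder[OF C, of w] bind[of X] by (simp flip: XC)
    then show "emeasure \<nu> X = emeasure (\<nu> \<bind> (\<lambda>y. law (past y))) X"
      by (simp add: emeasure_eq_measure B.emeasure_eq_measure)
  next
    show "range (\<lambda>_. UNIV) \<subseteq> past_future_sets"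
      using sets.top[of "coord_algebra {..-1}"]
      by (auto simp: past_future_sets_def intro!: exI[of _ UNIV] exI[of _ "[]"])
  qed (simp_all add: setsB sets_seq_space_past_future)
  then show ?thesis using bind[OF assms] by simp
qed

lemma measure_Int_past:
  assumes C: "C \<in> sets (coord_algebra {..-1})" and B: "B \<in> sets seq_space"
  shows "measure \<nu> (C \<inter> B) = (\<integral>y. indicator C y * measure (law (past y)) B \<partial>\<nu>)"
  using measure_eq_integral_law[of "C \<inter> B"] law_Int_past[OF C B] coord_algebra_sets[OF C] B
  by simp

end

section \<open>Limits of averages are compatible\<close>

context g_chain
begin

lemma g_append_word_eq:
  assumes "\<not> context_exceeds g w"
  shows "g (snoc (append_word x w) a) = g (snoc (append_word z w) a)"
proof -
  have "\<not> enat (length w) < context_length g (append_word x w)"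
    using assms context_exceeds_iff by blast
  then obtain k where k: "1 \<le> k" "k \<le> length w"
    and eq: "\<forall>a y z. g (snoc (append_word y (last_word (append_word x w) k)) a)
      = g (snoc (append_word z (last_word (append_word x w) k)) a)"
    unfolding context_length_gt_iff by blast
  define v where "v = drop (length w - k) w"
  have w: "w = take (length w - k) w @ v" by (simp add: v_def)
  have eq: "g (snoc (append_word y v) a) = g (snoc (append_word z v) a)" for y z
    using eq k by (simp add: last_word_append_word v_def)
  have "append_word y w = append_word (append_word y (take (length w - k) w)) v" for y
    by (subst w) (rule append_word_append)
  then show ?thesis using eq by simp
qed

definition exceeding :: "nat \<Rightarrow> (int \<Rightarrow> 'a) set" where
  "exceeding n = {y. context_exceeds g (initial_word y n)}"

lemma exceeding_alt: "exceeding n = {y. initial_word y n \<in> {w. context_exceeds g w}}"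
  by (simp add: exceeding_def)

lemma exceeding_sets [measurable]: "exceeding n \<in> sets seq_space"
  unfolding exceeding_alt by (rule initial_word_sets)

text \<open>
  To test an event \<open>D\<close> of finitely many past coordinates, split it according to the last \<open>n\<close>
  symbols. The cells with a good last string contribute nothing to the difference by the
  hypothesis on such strings, and the other cells have total mass \<open>measure \<nu> (exceeding n)\<close>. As \<open>n\<close> is arbitrary,
  the difference vanishes.
\<close>

lemma compatibleI_words:
  assumes "stationary_measure \<nu>"
    and good: "\<And>v a z. \<not> context_exceeds g v \<Longrightarrow>
      measure \<nu> (cylinder (v @ [a])) = g (snoc (append_word z v) a) * measure \<nu> (cylinder v)"
    and rare: "(\<lambda>n. measure \<nu> (exceeding n)) \<longlonglongrightarrow> 0"
  shows "\<nu> \<in> compatible_measures g"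
proof (rule compatibleI[OF assms(1)])
  interpret stationary_measure \<nu> by fact
  fix C :: "(int \<Rightarrow> 'a) set" and a assume C: "C \<in> sets (coord_algebra {..-1})"
  define M where "M = density \<nu> (\<lambda>y. ennreal (indicator {y. y 0 = a} y))"
  define N where "N = density \<nu> (\<lambda>y. ennreal (g (snoc (past y) a)))"
  have a [measurable]: "{y. y 0 = a} \<in> sets seq_space"
    using coord_in_seq_space[of 0 "{a}"] by (simp add: vimage_def)
  have M: "measure M B = measure \<nu> (B \<inter> {y. y 0 = a})" if B: "B \<in> sets seq_space" for B
  proof -
    have "measure M B = (\<integral>y. indicator B y * indicator {y. y 0 = a} y \<partial>\<nu>)"
      unfolding M_def using B by (intro measure_density_real) simp_all
    then show ?thesis by (simp flip: indicator_inter_arith)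
  qed
  have N: "measure N B = (\<integral>y. indicator B y * g (snoc (past y) a) \<partial>\<nu>)" if B: "B \<in> sets seq_space" for B
    unfolding N_def using B by (intro measure_density_real) simp_all
  have sets: "sets M = sets seq_space" "sets N = sets seq_space"
    by (simp_all add: M_def N_def)
  have fin: "finite_measure M" "finite_measure N"
    unfolding M_def N_def by (intro finite_measure_density_real, simp_all)+
  have "measure M C = measure N C"
  proof (rule measure_eq_on_coord_algebra[OF fin sets _ C])
    fix I D assume I: "I \<subseteq> {..-1}" "finite I" "depends_on I (D :: (int \<Rightarrow> 'a) set)"
    have D: "D \<in> sets seq_space"
      by (rule finitary_sets) (use I in \<open>auto simp: finitary_def\<close>)
    \<comment> \<open>The event that the past ends with \<open>v\<close>.\<close>
    define last where "last v = translate (- int (length v)) -` cylinder v" for v :: "'a list"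
    have last: "last v \<in> sets seq_space" for v
      unfolding last_def by (intro vimage_translate_sets cylinder_sets)
    have M_last: "measure M (last v) = measure \<nu> (cylinder (v @ [a]))" for v
    proof -
      have "last v \<inter> {y. y 0 = a} = translate (- int (length v)) -` cylinder (v @ [a])"
        by (auto simp: last_def cylinder_append) (auto simp: cylinder_def)
      then show ?thesis using M[OF last, of v] by (simp add: measure_translate cylinder_sets)
    qed
    have nu_last: "measure \<nu> (last v) = measure \<nu> (cylinder v)" for v
      unfolding last_def by (rule measure_translate[OF cylinder_sets])
    have N_last: "measure N (last v) = g (snoc (append_word z v) a) * measure \<nu> (cylinder v)"
      if "\<not> context_exceeds g v" for v z
    proof -
      have "past y = append_word (past (translate (- int (length v)) y)) v" if "y \<in> last v" for y
        using past_translate[of "translate (- int (length v)) y" v] that by (simp add: last_def)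
      then have "indicator (last v) y * g (snoc (past y) a) =
          indicator (last v) y * g (snoc (append_word z v) a)" for y
        using g_append_word_eq[OF that] by (cases "y \<in> last v") simp_all
      then have "measure N (last v) = (\<integral>y. indicator (last v) y * g (snoc (append_word z v) a) \<partial>\<nu>)"
        unfolding N[OF last] by (intro Bochner_Integration.integral_cong refl)
      then show ?thesis using last[of v] nu_last by simp
    qed
    have M_le: "measure M B \<le> measure \<nu> B" and N_le: "measure N B \<le> measure \<nu> B"
      if B: "B \<in> sets seq_space" for B
    proof -
      show "measure M B \<le> measure \<nu> B"
        using B M[OF B] by (auto intro!: finite_measure_mono)
      have "measure N B \<le> (\<integral>y. indicator B y \<partial>\<nu>)"
        unfolding N[OF B]
      proof (rule integral_mono)
        show "integrable \<nu> (\<lambda>y. indicator B y * g (snoc (past y) a))"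
          using B by (intro integrable_const_bound[where B = 1]) (auto split: split_indicator)
        show "integrable \<nu> (\<lambda>y. indicator B y :: real)"
          using B by (intro integrable_const_bound[where B = 1]) (auto split: split_indicator)
      qed (simp split: split_indicator)
      then show "measure N B \<le> measure \<nu> B" using B by simp
    qed
    define m where "m = Min (insert 0 I)"
    have m: "m \<le> i" if "i \<in> I" for i
      unfolding m_def using I that by (intro Min_le) simp_all
    define n0 where "n0 = nat (- m)"
    have bound: "\<bar>measure M D - measure N D\<bar> \<le> measure \<nu> (exceeding n)" if n: "n \<ge> n0" for n
    proof -
      let ?L = "\<lambda>w. translate (- int n) -` cylinder w :: (int \<Rightarrow> 'a) set"
      have IL: "i \<in> {- int n..<0}" if "i \<in> I" for i
        using m[OF that] I(1) that n by (auto simp: n0_def nat_le_iff)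
      have DL: "D \<inter> ?L w = ?L w \<or> D \<inter> ?L w = {}" if w: "w \<in> words n" for w
      proof -
        have "y \<in> D \<longleftrightarrow> z \<in> D" if "y \<in> ?L w" "z \<in> ?L w" for y z
        proof (rule depends_onD[OF I(3)])
          fix i assume "i \<in> I"
          define k where "k = nat (i + int n)"
          have k: "i = int k - int n" "k < n"
            using IL[OF \<open>i \<in> I\<close>] by (auto simp: k_def)
          have "y' (int k - int n) = w ! k" if y': "y' \<in> ?L w" for y' :: "int \<Rightarrow> 'a"
            using y' w k(2) by (simp add: cylinder_def translate_def words_def)
          from this[OF \<open>y \<in> ?L w\<close>] this[OF \<open>z \<in> ?L w\<close>] show "y i = z i" using k(1) by simp
        qed
        then show ?thesis by blast
      qed
      have Lw: "?L w = last w" if "w \<in> words n" for w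
        using that by (simp add: last_def words_def)
      have diff: "\<bar>measure M (D \<inter> ?L w) - measure N (D \<inter> ?L w)\<bar>
          \<le> (if context_exceeds g w then measure \<nu> (cylinder w) else 0)" if w: "w \<in> words n" for w
      proof (cases "D \<inter> ?L w = {}")
        case True
        then show ?thesis by simp
      next
        case False
        then have [simp]: "D \<inter> ?L w = last w" using DL[OF w] Lw[OF w] by simp
        show ?thesis
        proof (cases "context_exceeds g w")
          case True
          have "\<bar>measure M (last w) - measure N (last w)\<bar> \<le> measure \<nu> (cylinder w)"
            using M_le[OF last, of w] N_le[OF last, of w] measure_nonneg[of M "last w"]
              measure_nonneg[of N "last w"] unfolding nu_last by linarith
          then show ?thesis using True by simp
        next
          case False
          then show ?thesis
            using M_last[of w] N_last[OF False, of undefined] good[OF False, of a undefined] by simp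
        qed
      qed
      have "measure M D - measure N D = (\<Sum>w\<in>words n. measure M (D \<inter> ?L w) - measure N (D \<inter> ?L w))"
        unfolding measure_words_decomposition[OF fin(1) sets(1) D, where n = n and k = "- int n"]
          measure_words_decomposition[OF fin(2) sets(2) D, where n = n and k = "- int n"] sum_subtractf ..
      also have "\<bar>\<dots>\<bar> \<le> (\<Sum>w\<in>words n. \<bar>measure M (D \<inter> ?L w) - measure N (D \<inter> ?L w)\<bar>)"
        by (rule sum_abs)
      also have "\<dots> \<le> (\<Sum>w\<in>words n. if context_exceeds g w then measure \<nu> (cylinder w) else 0)"
        by (rule sum_mono) (rule diff)
      also have "\<dots> = (\<Sum>w\<in>words n. measure \<nu> (exceeding n \<inter> translate 0 -` cylinder w))"
      proof (rule sum.cong)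
        fix w :: "'a list" assume "w \<in> words n"
        then have "exceeding n \<inter> translate 0 -` cylinder w = (if context_exceeds g w then cylinder w else {})"
          by (auto simp: in_cylinder_iff words_def exceeding_def)
        then show "(if context_exceeds g w then measure \<nu> (cylinder w) else 0) =
            measure \<nu> (exceeding n \<inter> translate 0 -` cylinder w)" by simp
      qed simp
      also have "\<dots> = measure \<nu> (exceeding n)"
        by (rule measure_words_decomposition[symmetric]) (simp_all add: finite_measure_axioms)
      finally show ?thesis .
    qed
    have "\<bar>measure M D - measure N D\<bar> \<le> 0"
    proof (rule LIMSEQ_le_const[OF rare])
      show "\<exists>N'. \<forall>n\<ge>N'. \<bar>measure M D - measure N D\<bar> \<le> measure \<nu> (exceeding n)"
        using bound by blast
    qed
    then show "measure M D = measure N D" by simp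
  qed
  then show "measure \<nu> (C \<inter> {y. y 0 = a}) = (\<integral>y. indicator C y * g (snoc (past y) a) \<partial>\<nu>)"
    using M N coord_algebra_sets[OF C] by simp
qed

lemma measure_averaged:
  assumes "C \<in> sets seq_space" "1 \<le> k"
  shows "measure (averaged_past_measure g x k) C =
    (\<Sum>i<k. measure (law x) (translate (int i) -` C)) / real k"
proof -
  have "emeasure (shifted_past_measure g x i) C = ennreal (measure (law x) (translate (int i) -` C))" for i
    unfolding shifted_past_measure_def funpow_shift
    using assms(1) by (subst emeasure_distr) (simp_all add: law.emeasure_eq_measure)
  then have "emeasure (averaged_past_measure g x k) C =
      ennreal ((\<Sum>i<k. measure (law x) (translate (int i) -` C)) / real k)"
    using assms
    by (simp add: emeasure_averaged_past_measure sum_ennreal divide_ennreal sum_nonneg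
        ennreal_of_nat_eq_real_of_nat)
  then show ?thesis
    by (simp add: measure_def sum_nonneg)
qed

text \<open>
  The relation holds exactly for each shifted law, including the time right after the start,
  since the factor does not depend on the past.
\<close>

lemma averaged_good:
  assumes "\<not> context_exceeds g v" "1 \<le> k"
  shows "measure (averaged_past_measure g x k) (cylinder (v @ [a])) =
    g (snoc (append_word z v) a) * measure (averaged_past_measure g x k) (cylinder v)"
proof -
  have "measure (law x) (translate (int i) -` cylinder (v @ [a])) =
      g (snoc (append_word z v) a) * measure (law x) (translate (int i) -` cylinder v)" for i
  proof -
    have "g_word g (append_word x u) (v @ [a]) = g (snoc (append_word z v) a) * g_word g (append_word x u) v" for u
      using g_append_word_eq[OF assms(1), of "append_word x u" a z] by (simp add: g_word_snoc)
    then show ?thesis by (simp add: law_translate_cylinder sum_distrib_left mult_ac)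
  qed
  then show ?thesis using assms(2) by (simp add: measure_averaged cylinder_sets sum_distrib_left)
qed

text \<open>
  At time \<open>i\<close> the law is a convex combination of laws started from other pasts, to each of which
  the uniform bound applies.
\<close>

lemma measure_translate_exceeding_le:
  assumes "\<And>x. measure (law x) (exceeding n) \<le> \<epsilon>"
  shows "measure (law x) (translate (int i) -` exceeding n) \<le> \<epsilon>"
proof -
  have fin: "finite_measure (law x)" by (rule law.finite_measure_axioms)
  have "measure (law x) (translate (int i) -` exceeding n) =
      (\<Sum>w\<in>words n. measure (law x) (translate (int i) -` exceeding n \<inter> translate (int i) -` cylinder w))"
    using fin by (rule measure_words_decomposition) simp_all
  also have "\<dots> = (\<Sum>w\<in>words n. if context_exceeds g w then measure (law x) (translate (int i) -` cylinder w) else 0)"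
  proof (rule sum.cong)
    fix w :: "'a list" assume "w \<in> words n"
    then have "translate (int i) -` exceeding n \<inter> translate (int i) -` cylinder w =
        (if context_exceeds g w then translate (int i) -` cylinder w else {})"
      by (auto simp: in_cylinder_iff words_def exceeding_def)
    then show "measure (law x) (translate (int i) -` exceeding n \<inter> translate (int i) -` cylinder w) =
      (if context_exceeds g w then measure (law x) (translate (int i) -` cylinder w) else 0)" by simp
  qed simp
  also have "\<dots> = (\<Sum>w\<in>words n. \<Sum>u\<in>words i. if context_exceeds g w then g_word g x u * g_word g (append_word x u) w else 0)"
    by (intro sum.cong) (simp_all add: law_translate_cylinder)
  also have "\<dots> = (\<Sum>u\<in>words i. \<Sum>w\<in>words n. if context_exceeds g w then g_word g x u * g_word g (append_word x u) w else 0)"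
    by (rule sum.swap)
  also have "\<dots> = (\<Sum>u\<in>words i. g_word g x u * measure (law (append_word x u)) (exceeding n))"
    unfolding exceeding_alt law_future
    by (intro sum.cong refl) (simp add: sum.If_cases sum_distrib_left Int_commute)
  also have "\<dots> \<le> (\<Sum>u\<in>words i. g_word g x u * \<epsilon>)"
    by (intro sum_mono mult_left_mono assms) simp
  also have "\<dots> = \<epsilon>" by (simp add: sum_g_word flip: sum_distrib_right)
  finally show ?thesis .
qed

lemma averaged_exceeding_le:
  assumes "\<And>x. measure (law x) (exceeding n) \<le> \<epsilon>" "1 \<le> k"
  shows "measure (averaged_past_measure g x k) (exceeding n) \<le> \<epsilon>"
proof -
  have "(\<Sum>i<k. measure (law x) (translate (int i) -` exceeding n)) \<le> (\<Sum>i<k. \<epsilon>)"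
    by (intro sum_mono measure_translate_exceeding_le assms)
  then show ?thesis using assms(2) by (simp add: measure_averaged field_simps)
qed

text \<open>
  The difference of the two averages telescopes.
\<close>

lemma averaged_almost_invariant:
  assumes "C \<in> sets seq_space" "1 \<le> k"
  shows "\<bar>measure (averaged_past_measure g x k) (shift -` C) - measure (averaged_past_measure g x k) C\<bar> \<le> 1 / k"
proof -
  define p where "p i = measure (law x) (translate (int i) -` C)" for i
  have "translate (int i) -` (shift -` C) = translate (int (Suc i)) -` C" for i
    by (auto simp: shift_eq_translate)
  then have "measure (averaged_past_measure g x k) (shift -` C) - measure (averaged_past_measure g x k) C
      = (\<Sum>i<k. p (Suc i) - p i) / k"
    using assms vimage_translate_sets[OF assms(1), of 1]
    by (simp add: measure_averaged p_def sum_subtractf diff_divide_distrib flip: shift_eq_translate)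
  also have "(\<Sum>i<k. p (Suc i) - p i) = p k - p 0" by (rule sum_lessThan_telescope)
  finally have eq: "measure (averaged_past_measure g x k) (shift -` C) - measure (averaged_past_measure g x k) C
      = (p k - p 0) / k" .
  have "0 \<le> p i" "p i \<le> 1" for i by (simp_all add: p_def)
  then have "\<bar>p k - p 0\<bar> \<le> 1" by (smt (verit))
  then show ?thesis unfolding eq using assms(2) by (simp add: abs_divide divide_right_mono)
qed

text \<open>
  Each of the three hypotheses of \<open>compatibleI_words\<close> concerns finitely many coordinates at a time
  and holds for the averages up to errors that are uniform or vanish, so it passes to the limit.
\<close>

theorem limit_of_averages_compatible:
  assumes "prob_space \<nu>" and sets: "sets \<nu> = sets seq_space"
    and r: "strict_mono r" "\<And>j. 1 \<le> r j"
    and lim: "\<And>C. finitary C \<Longrightarrow>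
      (\<lambda>j. measure (averaged_past_measure g x (r j)) C) \<longlonglongrightarrow> measure \<nu> C"
    and rare: "(\<lambda>n. SUP x. measure (law x) (exceeding n)) \<longlonglongrightarrow> 0"
  shows "\<nu> \<in> compatible_measures g"
proof -
  interpret prob_space \<nu> by fact
  let ?A = "\<lambda>j. averaged_past_measure g x (r j)"
  have sp: "space \<nu> = UNIV" using sets_eq_imp_space_eq[OF sets] by simp
  have msh: "shift \<in> measurable \<nu> seq_space" by (simp add: measurable_cong_sets[OF sets refl])
  have fin_cyl: "finitary (cylinder w)" for w :: "'a list"
    using depends_on_cylinder by (auto simp: finitary_def)
  have fin_exc: "finitary (exceeding n)" for n
    using depends_on_initial_word unfolding exceeding_alt finitary_def by blast
  have "stationary_measure \<nu>"
  proof (intro stationary_measure.intro stationary_measure_axioms.intro)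
    show "distr \<nu> seq_space shift = \<nu>"
    proof (rule seq_measure_eqI)
      show "finite_measure (distr \<nu> seq_space shift)"
        using prob_space_distr[OF msh] by (simp add: prob_space_def)
      fix C :: "(int \<Rightarrow> 'a) set" assume C: "finitary C"
      then have fin: "finitary (shift -` C)"
        unfolding finitary_def shift_eq_translate using depends_on_vimage_translate by blast
      have "(\<lambda>j. measure (?A j) (shift -` C) - measure (?A j) C) \<longlonglongrightarrow> measure \<nu> (shift -` C) - measure \<nu> C"
        by (intro tendsto_diff lim C fin)
      moreover have "(\<lambda>j. measure (?A j) (shift -` C) - measure (?A j) C) \<longlonglongrightarrow> 0"
      proof (rule Lim_null_comparison)
        show "\<forall>\<^sub>F j in sequentially. norm (measure (?A j) (shift -` C) - measure (?A j) C) \<le> 1 / real (r j)"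
          using averaged_almost_invariant[OF finitary_sets[OF C]] r(2) by (intro always_eventually) simp
        have "filterlim (\<lambda>j. real (r j)) at_top sequentially"
          by (rule filterlim_compose[OF filterlim_real_sequentially filterlim_subseq[OF r(1)]])
        then show "(\<lambda>j. 1 / real (r j)) \<longlonglongrightarrow> 0"
          by (intro tendsto_divide_0[OF tendsto_const] filterlim_at_top_imp_at_infinity)
      qed
      ultimately have "measure \<nu> (shift -` C) - measure \<nu> C = 0"
        by (rule LIMSEQ_unique)
      then show "measure (distr \<nu> seq_space shift) C = measure \<nu> C"
        using finitary_sets[OF C] by (subst measure_distr[OF msh]) (simp_all add: sp)
    qed (simp_all add: sets finite_measure_axioms)
  qed (fact assms(1) sets)+
  then show ?thesis
  proof (rule compatibleI_words)
    fix v :: "'a list" and a z assume v: "\<not> context_exceeds g v"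
    have "(\<lambda>j. measure (?A j) (cylinder (v @ [a]))) \<longlonglongrightarrow> measure \<nu> (cylinder (v @ [a]))"
      by (rule lim[OF fin_cyl])
    then have "(\<lambda>j. g (snoc (append_word z v) a) * measure (?A j) (cylinder v)) \<longlonglongrightarrow> measure \<nu> (cylinder (v @ [a]))"
      by (simp only: averaged_good[OF v r(2), where a = a and z = z])
    moreover have "(\<lambda>j. g (snoc (append_word z v) a) * measure (?A j) (cylinder v))
        \<longlonglongrightarrow> g (snoc (append_word z v) a) * measure \<nu> (cylinder v)"
      by (intro tendsto_mult_left lim fin_cyl)
    ultimately show "measure \<nu> (cylinder (v @ [a])) = g (snoc (append_word z v) a) * measure \<nu> (cylinder v)"
      by (rule LIMSEQ_unique)
  next
    have le: "measure \<nu> (exceeding n) \<le> (SUP x. measure (law x) (exceeding n))" for n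
    proof (rule LIMSEQ_le_const2[OF lim[OF fin_exc]])
      have "measure (law x) (exceeding n) \<le> (SUP x. measure (law x) (exceeding n))" for x
        by (rule cSUP_upper) (auto intro!: bdd_aboveI[where M = 1])
      then show "\<exists>N. \<forall>j\<ge>N. measure (?A j) (exceeding n) \<le> (SUP x. measure (law x) (exceeding n))"
        using averaged_exceeding_le[OF _ r(2)] by blast
    qed
    show "(\<lambda>n. measure \<nu> (exceeding n)) \<longlonglongrightarrow> 0"
      by (rule tendsto_sandwich[OF _ _ tendsto_const rare]) (simp_all add: le)
  qed
qed

end

section \<open>Weak limits and compactness\<close>

lemma topspace_seq_topology [simp]: "topspace seq_topology = UNIV"
  by (simp add: seq_topology_def)

lemma finitary_Compl: "finitary C \<Longrightarrow> finitary (- C)"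
  unfolding finitary_def using depends_on_Compl by blast

lemma finitary_Int: "finitary C \<Longrightarrow> finitary D \<Longrightarrow> finitary (C \<inter> D)"
  unfolding finitary_def using depends_on_Int finite_UnI by blast

lemma finitary_empty [simp]: "finitary {}" and finitary_UNIV [simp]: "finitary UNIV"
  unfolding finitary_def by (rule exI[of _ "{}"], simp add: depends_on_def)+

lemma finitary_Un: "finitary C \<Longrightarrow> finitary D \<Longrightarrow> finitary (C \<union> D)"
  using finitary_Compl[OF finitary_Int[OF finitary_Compl finitary_Compl], of C D] by simp

lemma openin_finitary:
  assumes "finitary C"
  shows "openin seq_topology C"
proof -
  obtain I where I: "finite I" "depends_on I C" using assms by (auto simp: finitary_def)
  have coord: "openin seq_topology ((\<lambda>y. y i) -` B)" for i and B :: "'a set"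
  proof -
    have "continuous_map seq_topology (discrete_topology UNIV) (\<lambda>y. y i :: 'a)"
      unfolding seq_topology_def by (rule continuous_map_product_projection) simp
    from openin_continuous_map_preimage[OF this, of B] show ?thesis by (simp add: vimage_def)
  qed
  have "openin seq_topology (\<Inter>i\<in>I. (\<lambda>y. y i) -` {h i})" for h :: "int \<Rightarrow> 'a"
    using openin_INT[OF I(1), of seq_topology "\<lambda>i. (\<lambda>y. y i) -` {h i}"] coord by simp
  then show ?thesis
    by (subst depends_on_Union_cubes[OF I(2)]) (rule openin_Union, blast)
qed

lemma closedin_finitary: "finitary C \<Longrightarrow> closedin seq_topology C"
  using openin_finitary[OF finitary_Compl] by (simp add: closedin_def Compl_eq_Diff_UNIV)

lemma continuous_indicator_finitary:
  assumes "finitary C"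
  shows "continuous_map seq_topology euclideanreal (indicator C)"
  unfolding continuous_map_def
proof (intro conjI allI impI)
  fix U :: "real set"
  have "finitary {y. indicator C y \<in> U}"
  proof -
    obtain I where I: "finite I" "depends_on I C" using assms by (auto simp: finitary_def)
    have "depends_on I {y. indicator C y \<in> U}"
      unfolding depends_on_def
    proof (intro allI impI)
      fix y z :: "int \<Rightarrow> 'a" assume "\<forall>i\<in>I. y i = z i"
      then have "y \<in> C \<longleftrightarrow> z \<in> C" by (intro depends_onD[OF I(2)]) blast
      then show "y \<in> {y. indicator C y \<in> U} \<longleftrightarrow> z \<in> {y. indicator C y \<in> U}"
        by (simp add: indicator_def)
    qed
    then show ?thesis using I(1) unfolding finitary_def by blast
  qed
  then show "openin seq_topology {y \<in> topspace seq_topology. indicator C y \<in> U}"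
    by (simp add: openin_finitary)
qed simp

lemma compact_space_seq_topology: "compact_space (seq_topology :: (int \<Rightarrow> 'a::finite) topology)"
  unfolding seq_topology_def
  by (simp add: compact_space_product_topology compact_space_discrete_topology)

text \<open>
  For each of the countably many finite coordinate sets \<open>I\<close>, an event depending on \<open>I\<close> is given by
  a set of restrictions to \<open>I\<close>, and there are finitely many of those.
\<close>

lemma countable_finitary: "countable {C :: (int \<Rightarrow> 'a::finite) set. finitary C}"
proof -
  let ?D = "\<lambda>I. (\<lambda>H. {y. restrict y I \<in> H}) ` Pow (PiE I (\<lambda>_. UNIV)) :: (int \<Rightarrow> 'a) set set"
  have D: "C \<in> ?D I" if C: "depends_on I C" for I C
  proof (rule image_eqI)
    show "C = {y. restrict y I \<in> (\<lambda>z. restrict z I) ` C}"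
    proof (intro set_eqI iffI)
      fix y assume "y \<in> {y. restrict y I \<in> (\<lambda>z. restrict z I) ` C}"
      then obtain z where z: "z \<in> C" "restrict y I = restrict z I" by blast
      have "y i = z i" if "i \<in> I" for i
        using fun_cong[OF z(2), of i] that by simp
      then show "y \<in> C" using depends_onD[OF C, of y z] z(1) by blast
    qed simp
  qed auto
  have "{C :: (int \<Rightarrow> 'a) set. finitary C} \<subseteq> (\<Union>I\<in>{I. finite I}. ?D I)"
  proof
    fix C :: "(int \<Rightarrow> 'a) set" assume "C \<in> {C. finitary C}"
    then obtain I where "finite I" "depends_on I C" by (auto simp: finitary_def)
    then show "C \<in> (\<Union>I\<in>{I. finite I}. ?D I)" using D by (intro UN_I[of I]) simp_all
  qed
  moreover have "countable (\<Union>I\<in>{I. finite I}. ?D I)"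
  proof (rule countable_UN)
    show "countable {I :: int set. finite I}" by (rule countable_Collect_finite)
    show "countable (?D I)" if "I \<in> {I. finite I}" for I
      using that by (intro countable_finite finite_imageI) (simp add: finite_PiE)
  qed
  ultimately show ?thesis by (rule countable_subset)
qed

text \<open>
  Finitary events are clopen in a compact space, so a decreasing sequence of them with empty
  intersection is eventually empty. Finite additivity therefore already implies continuity at
  the empty set, and Caratheodory's extension theorem applies.
\<close>

lemma finitary_limit_extends:
  fixes f :: "(int \<Rightarrow> 'a::finite) set \<Rightarrow> real"
  assumes nonneg: "\<And>C. finitary C \<Longrightarrow> 0 \<le> f C"
    and add: "\<And>C D. finitary C \<Longrightarrow> finitary D \<Longrightarrow> C \<inter> D = {} \<Longrightarrow> f (C \<union> D) = f C + f D"
    and one: "f UNIV = 1"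
  shows "\<exists>\<nu>. prob_space \<nu> \<and> sets \<nu> = sets seq_space \<and> (\<forall>C. finitary C \<longrightarrow> measure \<nu> C = f C)"
proof -
  let ?L = "{C :: (int \<Rightarrow> 'a) set. finitary C}"
  interpret L: algebra UNIV ?L
    unfolding algebra_iff_Un
    by (simp add: finitary_Un) (simp add: finitary_Compl flip: Compl_eq_Diff_UNIV)
  have empty: "f {} = 0" using add[of "{}" "{}"] by simp
  have "\<exists>\<mu>. (\<forall>C\<in>?L. \<mu> C = ennreal (f C)) \<and> measure_space UNIV (sigma_sets UNIV ?L) \<mu>"
  proof (rule L.caratheodory_empty_continuous)
    show "positive ?L (\<lambda>C. ennreal (f C))" by (simp add: positive_def empty)
    show "additive ?L (\<lambda>C. ennreal (f C))"
      by (auto simp: additive_def add nonneg simp flip: ennreal_plus)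
    fix A :: "nat \<Rightarrow> (int \<Rightarrow> 'a) set"
    assume A: "range A \<subseteq> ?L" "decseq A" "(\<Inter>i. A i) = {}"
    have "closedin seq_topology (A n)" for n
      using A(1) by (intro closedin_finitary) auto
    then have "\<exists>n. A n = {}"
      using compact_space_imp_nest[OF compact_space_seq_topology, of A] A by blast
    then obtain n where n: "A n = {}" by blast
    have "A m = {}" if "m \<ge> n" for m using decseqD[OF A(2) that] n by blast
    then have "\<forall>\<^sub>F m in sequentially. ennreal (f (A m)) = 0"
      unfolding eventually_sequentially by (intro exI[of _ n]) (simp add: empty)
    then show "(\<lambda>i. ennreal (f (A i))) \<longlonglongrightarrow> 0" by (rule tendsto_eventually)
  qed simp
  then obtain \<mu> where \<mu>: "\<And>C. finitary C \<Longrightarrow> \<mu> C = ennreal (f C)"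
    "measure_space UNIV (sigma_sets UNIV ?L) \<mu>" by blast
  define \<nu> where "\<nu> = measure_of UNIV (sets seq_space) \<mu>"
  have em: "emeasure \<nu> C = \<mu> C" if "C \<in> sets seq_space" for C
    unfolding \<nu>_def using \<mu>(2) that
    by (intro emeasure_measure_of_sigma) (simp_all add: measure_space_def flip: sets_seq_space_finitary)
  have sets: "sets \<nu> = sets seq_space"
    unfolding \<nu>_def using sets.sigma_sets_eq[of seq_space] by simp
  have sp: "space \<nu> = UNIV" using sets_eq_imp_space_eq[OF sets] by simp
  have "prob_space \<nu>"
    by (rule prob_spaceI) (simp add: sp em \<mu> one)
  moreover have "measure \<nu> C = f C" if "finitary C" for C
    using that by (simp add: measure_def em finitary_sets \<mu> nonneg)
  ultimately show ?thesis using sets by blast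
qed

text \<open>
  There are countably many finitary events, so a diagonal subsequence makes all their
  probabilities converge; the limits are finitely additive and extend to a measure.
\<close>

theorem finitary_compactness:
  fixes M :: "nat \<Rightarrow> (int \<Rightarrow> 'a::finite) measure"
  assumes M: "\<And>j. prob_space (M j)" and sets: "\<And>j. sets (M j) = sets seq_space"
  shows "\<exists>r \<nu>. strict_mono r \<and> prob_space \<nu> \<and> sets \<nu> = sets seq_space \<and>
    (\<forall>C. finitary C \<longrightarrow> (\<lambda>j. measure (M (r j)) C) \<longlonglongrightarrow> measure \<nu> C)"
proof -
  have sp: "space (M j) = UNIV" for j using sets_eq_imp_space_eq[OF sets[of j]] by simp
  let ?L = "{C :: (int \<Rightarrow> 'a) set. finitary C}"
  define e where "e = from_nat_into ?L"
  have surj: "\<exists>n. e n = C" if "finitary C" for C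
    unfolding e_def using from_nat_into_surj[OF countable_finitary, of C] that by auto
  let ?P = "\<lambda>n s. convergent (\<lambda>j. measure (M (s j)) (e n))"
  interpret diag: subseqs ?P
  proof
    fix n and s :: "nat \<Rightarrow> nat"
    have "seq_compact {0..1 :: real}" by (rule compact_imp_seq_compact[OF compact_Icc])
    moreover have "\<forall>j. measure (M (s j)) (e n) \<in> {0..1}"
      using prob_space.prob_le_1[OF M] by simp
    ultimately obtain l r where "strict_mono r" "((\<lambda>j. measure (M (s j)) (e n)) \<circ> r) \<longlonglongrightarrow> l"
      by (rule seq_compactE)
    then show "\<exists>r. strict_mono r \<and> ?P n (s \<circ> r)"
      by (auto simp: convergent_def o_def)
  qed
  define r where "r = diag.diagseq"
  have r: "strict_mono r" unfolding r_def by (rule diag.subseq_diagseq)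
  have conv: "convergent (\<lambda>j. measure (M (r j)) C)" if C: "finitary C" for C
  proof -
    obtain n where n: "e n = C" using surj[OF C] by blast
    have "?P n (diag.diagseq \<circ> ((+) (Suc n)))"
    proof (rule diag.diagseq_holds)
      fix q s :: "nat \<Rightarrow> nat" and k assume "strict_mono q" "?P k s"
      then obtain l where "(\<lambda>j. measure (M (s j)) (e k)) \<longlonglongrightarrow> l" by (auto simp: convergent_def)
      from LIMSEQ_subseq_LIMSEQ[OF this \<open>strict_mono q\<close>] show "?P k (s \<circ> q)"
        by (auto simp: convergent_def o_def)
    qed
    then have "convergent (\<lambda>j. measure (M (r (j + Suc n))) C)"
      by (simp add: o_def r_def n add.commute)
    then show ?thesis using convergent_ignore_initial_segment[of "\<lambda>j. measure (M (r j)) C" "Suc n"] by simp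
  qed
  define f where "f C = lim (\<lambda>j. measure (M (r j)) C)" for C
  have f: "(\<lambda>j. measure (M (r j)) C) \<longlonglongrightarrow> f C" if "finitary C" for C
    unfolding f_def using conv[OF that] by (simp add: convergent_LIMSEQ_iff)
  have "\<exists>\<nu>. prob_space \<nu> \<and> sets \<nu> = sets seq_space \<and> (\<forall>C. finitary C \<longrightarrow> measure \<nu> C = f C)"
  proof (rule finitary_limit_extends)
    show "0 \<le> f C" if "finitary C" for C
      by (rule LIMSEQ_le_const[OF f[OF that]]) simp
    show "f (C \<union> D) = f C + f D" if C: "finitary C" and D: "finitary D" and CD: "C \<inter> D = {}" for C D
    proof (rule LIMSEQ_unique)
      show "(\<lambda>j. measure (M (r j)) (C \<union> D)) \<longlonglongrightarrow> f (C \<union> D)"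
        by (intro f finitary_Un C D)
      have "measure (M (r j)) (C \<union> D) = measure (M (r j)) C + measure (M (r j)) D" for j
      proof -
        interpret prob_space "M (r j)" by (rule M)
        show ?thesis using C D CD by (intro finite_measure_Union) (simp_all add: sets finitary_sets)
      qed
      then show "(\<lambda>j. measure (M (r j)) (C \<union> D)) \<longlonglongrightarrow> f C + f D"
        using tendsto_add[OF f[OF C] f[OF D]] by simp
    qed
    show "f UNIV = 1"
    proof (rule LIMSEQ_unique[OF f])
      have "measure (M (r j)) UNIV = 1" for j
        using prob_space.prob_space[OF M, of "r j"] by (simp add: sp)
      then show "(\<lambda>j. measure (M (r j)) UNIV) \<longlonglongrightarrow> 1" by simp
    qed simp
  qed
  then obtain \<nu> where "prob_space \<nu>" "sets \<nu> = sets seq_space" "\<And>C. finitary C \<Longrightarrow> measure \<nu> C = f C"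
    by blast
  then show ?thesis using r f by (intro exI[of _ r] exI[of _ \<nu>]) simp
qed

context g_chain
begin

lemma prob_space_averaged:
  assumes "1 \<le> k"
  shows "prob_space (averaged_past_measure g x k)"
proof (rule prob_spaceI)
  have sp: "space (averaged_past_measure g x k) = UNIV"
    using sets_eq_imp_space_eq[OF sets_averaged_past_measure] by simp
  have "emeasure (shifted_past_measure g x i) UNIV = 1" for i
    unfolding shifted_past_measure_def funpow_shift
    using law.emeasure_space_1 by (subst emeasure_distr) simp_all
  then show "emeasure (averaged_past_measure g x k) (space (averaged_past_measure g x k)) = 1"
    using assms by (simp add: sp emeasure_averaged_past_measure ennreal_of_nat_eq_real_of_nat)
qed

text \<open>
  Indicators of finitary events are continuous, so weak convergence implies convergence of
  their probabilities.
\<close>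

theorem subsequential_limit_compatible:
  assumes "subsequential_limit g x \<nu>"
    and rare: "(\<lambda>n. SUP x. measure (law x) (exceeding n)) \<longlonglongrightarrow> 0"
  shows "\<nu> \<in> compatible_measures g"
proof -
  obtain r where \<nu>: "prob_space \<nu>" "sets \<nu> = sets seq_space"
    and r: "strict_mono r" "\<And>j. 1 \<le> r j"
    and weak: "weakly_converges (\<lambda>j. averaged_past_measure g x (r j)) \<nu>"
    using assms(1) unfolding subsequential_limit_def by blast
  show ?thesis
  proof (rule limit_of_averages_compatible[OF \<nu> r _ rare])
    fix C :: "(int \<Rightarrow> 'a) set" assume C: "finitary C"
    have "bounded (range (indicator C :: (int \<Rightarrow> 'a) \<Rightarrow> real))"
      by (rule boundedI[of _ 1]) (auto split: split_indicator)
    then have "(\<lambda>j. integral\<^sup>L (averaged_past_measure g x (r j)) (indicator C :: _ \<Rightarrow> real))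
        \<longlonglongrightarrow> integral\<^sup>L \<nu> (indicator C)"
      using weak continuous_indicator_finitary[OF C] unfolding weakly_converges_def by blast
    moreover have "space (averaged_past_measure g x k) = UNIV" "space \<nu> = UNIV" for k
      using sets_eq_imp_space_eq[OF sets_averaged_past_measure] sets_eq_imp_space_eq[OF \<nu>(2)]
      by simp_all
    ultimately show "(\<lambda>j. measure (averaged_past_measure g x (r j)) C) \<longlonglongrightarrow> measure \<nu> C"
      by simp
  qed
qed

theorem ex_compatible_measure:
  assumes rare: "(\<lambda>n. SUP x. measure (law x) (exceeding n)) \<longlonglongrightarrow> 0"
  shows "\<exists>\<nu>. \<nu> \<in> compatible_measures g"
proof -
  define x :: "'a lseq" where "x = (\<lambda>_. undefined)"
  obtain r \<nu> where r: "strict_mono r" and \<nu>: "prob_space \<nu>" "sets \<nu> = sets seq_space"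
    and lim: "\<And>C. finitary C \<Longrightarrow>
      (\<lambda>j. measure (averaged_past_measure g x (Suc (r j))) C) \<longlonglongrightarrow> measure \<nu> C"
    using finitary_compactness[of "\<lambda>j. averaged_past_measure g x (Suc j)",
        OF prob_space_averaged sets_averaged_past_measure] by auto
  have "strict_mono (\<lambda>j. Suc (r j))" using r by (simp add: strict_mono_def)
  then have "\<nu> \<in> compatible_measures g"
    by (rule limit_of_averages_compatible[OF \<nu> _ _ lim rare]) simp_all
  then show ?thesis ..
qed

end

section \<open>Comparison of the laws of two pasts\<close>

lemma vimage_translate_0 [simp]: "translate 0 -` A = A"
  by auto

context g_chain
begin

text \<open>
  Beyond the prefix \<open>u\<close> every factor of the two products is evaluated after a good string, where
  \<open>g\<close> does not see the past.
\<close>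

lemma g_word_exchange:
  assumes "\<And>n. length u \<le> n \<Longrightarrow> n < length (u @ v) \<Longrightarrow> \<not> context_exceeds g (take n (u @ v))"
  shows "g_word g z u * g_word g x (u @ v) = g_word g x u * g_word g z (u @ v)"
  using assms
proof (induction v rule: rev_induct)
  case Nil
  then show ?case by simp
next
  case (snoc a v)
  have "\<not> context_exceeds g (take n (u @ v))" if "length u \<le> n" "n < length (u @ v)" for n
    using snoc.prems[of n] that by simp
  then have IH: "g_word g z u * g_word g x (u @ v) = g_word g x u * g_word g z (u @ v)"
    by (rule snoc.IH)
  have "\<not> context_exceeds g (u @ v)"
    using snoc.prems[of "length (u @ v)"] by simp
  then have eq: "g (snoc (append_word x (u @ v)) a) = g (snoc (append_word z (u @ v)) a)"
    by (rule g_append_word_eq)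
  have "g_word g y (u @ v @ [a]) = g_word g y (u @ v) * g (snoc (append_word y (u @ v)) a)" for y
    using g_word_snoc[of g y "u @ v" a] by simp
  then show ?case using IH eq by (simp flip: mult.assoc)
qed

text \<open>
  From time \<open>N\<close> on, transition probabilities on this event are independent of the past.
\<close>

definition settled :: "nat \<Rightarrow> (int \<Rightarrow> 'a) set" where
  "settled N = (\<Inter>n\<in>{N..}. - exceeding n)"

lemma Compl_exceeding_sets: "- exceeding n \<in> sets seq_space"
  using sets.compl_sets[OF exceeding_sets, of n] by (simp add: Compl_eq_Diff_UNIV)

lemma settled_sets [measurable]: "settled N \<in> sets seq_space"
  unfolding settled_def by (intro sets.countable_INT'' Compl_exceeding_sets) auto

lemma depends_on_Int_settled_until:
  assumes "depends_on {0..<int m} C" "length u \<le> m"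
  shows "depends_on {0..<int m} (C \<inter> (cylinder u \<inter> (\<Inter>n\<in>{length u..<m}. - exceeding n)))"
proof -
  have "depends_on {0..<int m} (- exceeding n)" if "n < m" for n
    using depends_on_Compl[OF depends_on_initial_word[of n "{w. context_exceeds g w}"]] that
    unfolding exceeding_alt by (elim depends_on_mono) auto
  then have "depends_on {0..<int m} (\<Inter>n\<in>{length u..<m}. - exceeding n)"
    unfolding depends_on_def by fastforce
  moreover have "depends_on {0..<int m} (cylinder u)"
    using depends_on_cylinder[of u] assms(2) by (elim depends_on_mono) auto
  ultimately have "depends_on {0..<int m} (cylinder u \<inter> (\<Inter>n\<in>{length u..<m}. - exceeding n))"
    using depends_on_Int[of "{0..<int m}" _ "{0..<int m}"] by simp
  then show ?thesis
    using depends_on_Int[OF assms(1), of "{0..<int m}"] by simp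
qed

lemma law_exchange_until:
  assumes C: "depends_on {0..<int m} C" and m: "length u \<le> m"
  defines "S \<equiv> C \<inter> (cylinder u \<inter> (\<Inter>n\<in>{length u..<m}. - exceeding n))"
  shows "g_word g z u * measure (law x) S = g_word g x u * measure (law z) S"
proof -
  define W where "W = (\<lambda>y. initial_word y m) ` S"
  have S: "S = {y. initial_word y m \<in> W}"
  proof (intro set_eqI iffI)
    fix y assume "y \<in> {y. initial_word y m \<in> W}"
    then obtain z where "z \<in> S" and eq: "initial_word y m = initial_word z m" by (auto simp: W_def)
    moreover have "y i = z i" if i: "i \<in> {0..<int m}" for i
    proof -
      have "nat i < m" using i by auto
      then show ?thesis using i arg_cong[OF eq, of "\<lambda>w. w ! nat i"] by simp
    qed
    ultimately show "y \<in> S"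
      using depends_onD[OF depends_on_Int_settled_until[OF C m], of y z] unfolding S_def by blast
  qed (simp add: W_def)
  have "g_word g z u * g_word g x w = g_word g x u * g_word g z w" if wW: "w \<in> W" for w
  proof -
    obtain y where y: "y \<in> S" and w: "w = initial_word y m" using wW by (auto simp: W_def)
    have take_w: "take n w = initial_word y n" if "n \<le> m" for n
      using that by (intro nth_equalityI) (simp_all add: w)
    have "y \<in> cylinder u" using y by (simp add: S_def)
    then have "take (length u) w = u" using take_w[OF m] by (simp add: in_cylinder_iff)
    then have split: "w = u @ drop (length u) w" by (metis append_take_drop_id)
    have good: "\<not> context_exceeds g (take n w)" if "length u \<le> n" "n < length w" for n
      using y that take_w[of n] by (simp add: S_def exceeding_def w)
    show ?thesis
      using g_word_exchange[of u "drop (length u) w" z x] good by (simp flip: split)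
  qed
  then show ?thesis
    unfolding S law_future by (simp add: sum_distrib_left)
qed

text \<open>
  On the event that the chain starts with \<open>u\<close> and is settled from then on, the laws of any two
  pasts are proportional. The identity is stated in product form, which avoids division by a
  possibly vanishing probability. It holds for events of finitely many coordinates at each
  finite stage (\<open>law_exchange_until\<close>), hence in the limit, and then for all future events by
  uniqueness of measures.
\<close>

lemma law_exchange:
  assumes B: "B \<in> sets (coord_algebra {0..})"
  shows "g_word g z u * measure (law x) (B \<inter> (cylinder u \<inter> settled (length u)))
    = g_word g x u * measure (law z) (B \<inter> (cylinder u \<inter> settled (length u)))"
proof -
  define S where "S = cylinder u \<inter> settled (length u)"
  define M where "M x c = density (law x) (\<lambda>y. ennreal (c * indicator S y))" for x c
  have S [measurable]: "S \<in> sets seq_space"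
    unfolding S_def by (intro sets.Int cylinder_sets settled_sets)
  have M: "measure (M x c) D = c * measure (law x) (D \<inter> S)"
    if "0 \<le> c" "D \<in> sets seq_space" for x c D
  proof -
    have "measure (M x c) D = (\<integral>y. indicator D y * (c * indicator S y) \<partial>law x)"
      unfolding M_def using that by (intro measure_density_real) simp_all
    also have "\<dots> = (\<integral>y. c * indicator (D \<inter> S) y \<partial>law x)"
      by (intro Bochner_Integration.integral_cong) (simp_all split: split_indicator)
    finally show ?thesis using that(2) by simp
  qed
  have fin: "finite_measure (M x c)" if "0 \<le> c" "c \<le> 1" for x c
    unfolding M_def using that
    by (intro law.finite_measure_density_real) (simp_all split: split_indicator)
  have sets: "sets (M x c) = sets seq_space" for x c by (simp add: M_def)
  have "measure (M x (g_word g z u)) B = measure (M z (g_word g x u)) B"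
  proof (rule measure_eq_on_coord_algebra[OF fin fin sets sets _ B])
    fix I C assume I: "I \<subseteq> {0..}" "finite I" "depends_on I (C :: (int \<Rightarrow> 'a) set)"
    define b where "b = Max (insert 0 I)"
    have b: "i \<le> b" if "i \<in> I" for i
      unfolding b_def using I(2) that by (intro Max_ge) simp_all
    define n where "n = nat (b + 1) + length u"
    have C: "depends_on {0..<int m} C" if "m \<ge> n" for m
      using I(3)
    proof (rule depends_on_mono)
      show "I \<subseteq> {0..<int m}"
      proof
        fix i assume "i \<in> I"
        then show "i \<in> {0..<int m}" using b[of i] I(1) that by (auto simp: n_def)
      qed
    qed
    have [measurable]: "C \<in> sets seq_space"
      by (rule finitary_sets) (use I in \<open>auto simp: finitary_def\<close>)
    define T where "T m = C \<inter> (cylinder u \<inter> (\<Inter>k\<in>{length u..<m}. - exceeding k))" for m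
    have T: "T m \<in> sets seq_space" for m
      unfolding T_def
      by (intro sets.Int \<open>C \<in> sets seq_space\<close> cylinder_sets sets.countable_INT'' Compl_exceeding_sets) auto
    have "decseq T" unfolding T_def decseq_def by fastforce
    then have lim: "(\<lambda>m. measure (law y) (T m)) \<longlonglongrightarrow> measure (law y) (\<Inter>m. T m)" for y
      using T by (intro law.finite_Lim_measure_decseq) auto
    have INT: "(\<Inter>m. T m) = C \<inter> S"
    proof (intro antisym subsetI)
      fix y assume y: "y \<in> (\<Inter>m. T m)"
      have "y \<notin> exceeding k" if "length u \<le> k" for k
        using INT_D[OF y, of "Suc k"] that by (simp add: T_def)
      moreover have "y \<in> C \<inter> cylinder u" using INT_D[OF y, of 0] by (simp add: T_def)
      ultimately show "y \<in> C \<inter> S" by (simp add: S_def settled_def)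
    qed (auto simp: T_def S_def settled_def)
    have "g_word g z u * measure (law x) (C \<inter> S) = g_word g x u * measure (law z) (C \<inter> S)"
    proof (rule LIMSEQ_unique)
      show "(\<lambda>m. g_word g z u * measure (law x) (T m)) \<longlonglongrightarrow> g_word g z u * measure (law x) (C \<inter> S)"
        using lim[of x] unfolding INT by (rule tendsto_mult_left)
      have "(\<lambda>m. g_word g x u * measure (law z) (T m)) \<longlonglongrightarrow> g_word g x u * measure (law z) (C \<inter> S)"
        using lim[of z] unfolding INT by (rule tendsto_mult_left)
      moreover have "\<forall>\<^sub>F m in sequentially. g_word g x u * measure (law z) (T m) = g_word g z u * measure (law x) (T m)"
        unfolding eventually_sequentially
      proof (intro exI[of _ n] allI impI)
        fix m assume "n \<le> m"
        then show "g_word g x u * measure (law z) (T m) = g_word g z u * measure (law x) (T m)"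
          unfolding T_def by (intro law_exchange_until[symmetric] C) (simp_all add: n_def)
      qed
      ultimately show "(\<lambda>m. g_word g z u * measure (law x) (T m)) \<longlonglongrightarrow> g_word g x u * measure (law z) (C \<inter> S)"
        by (rule Lim_transform_eventually)
    qed
    then show "measure (M x (g_word g z u)) C = measure (M z (g_word g x u)) C"
      by (simp add: M)
  qed simp_all
  then show ?thesis using coord_algebra_sets[OF B] by (simp add: M S_def)
qed

lemma measure_settled_tendsto:
  assumes "measure (law x) (\<Union>N. settled N) = 1" and B: "B \<in> sets seq_space"
  shows "(\<lambda>N. measure (law x) (B \<inter> settled N)) \<longlonglongrightarrow> measure (law x) B"
proof -
  have "incseq (\<lambda>N. B \<inter> settled N)" unfolding settled_def incseq_def by fastforce
  then have "(\<lambda>N. measure (law x) (B \<inter> settled N)) \<longlonglongrightarrow> measure (law x) (\<Union>N. B \<inter> settled N)"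
    using B by (intro law.finite_Lim_measure_incseq) auto
  also have "measure (law x) (\<Union>N. B \<inter> settled N) = measure (law x) B"
  proof (rule law.finite_measure_eq_AE)
    have "AE y in law x. y \<in> (\<Union>N. settled N)"
      using assms(1) by (intro law.AE_prob_1) simp
    then show "AE y in law x. y \<in> (\<Union>N. B \<inter> settled N) \<longleftrightarrow> y \<in> B"
      by eventually_elim blast
  qed (use B in auto)
  finally show ?thesis .
qed

end

locale settling_chain = g_chain g for g :: "'a::finite lseq \<Rightarrow> real" +
  assumes g_pos: "\<And>x. 0 < g x"
    and settles: "\<And>x. measure (past_measure g x) (\<Union>N. settled N) = 1"
begin

lemma g_word_pos [simp]: "0 < g_word g x w"
  by (simp add: g_word_def prod_pos g_pos)

text \<open>
  Split according to the time \<open>N\<close> at which the chain is settled and to the first \<open>N\<close> symbols; on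
  each piece the two laws are proportional with a positive factor.
\<close>

lemma null_sets_independent_of_past:
  assumes B: "B \<in> sets (coord_algebra {0..})" and null: "measure (law z) B = 0"
  shows "measure (law x) B = 0"
proof (rule LIMSEQ_unique[OF measure_settled_tendsto[OF settles coord_algebra_sets[OF B]]])
  have Bm: "B \<in> sets seq_space" using B by (rule coord_algebra_sets)
  have "measure (law x) (B \<inter> settled N) = 0" for N
  proof -
    have "measure (law x) (B \<inter> settled N) =
        (\<Sum>u\<in>words N. measure (law x) (B \<inter> settled N \<inter> translate 0 -` cylinder u))"
      using Bm by (intro measure_words_decomposition) (simp_all add: law.finite_measure_axioms)
    also have "\<dots> = 0"
    proof (intro sum.neutral ballI)
      fix u :: "'a list" assume "u \<in> words N"
      then have N: "N = length u" by (simp add: words_def)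
      have "measure (law z) (B \<inter> (cylinder u \<inter> settled (length u))) \<le> measure (law z) B"
        using Bm by (intro law.finite_measure_mono) auto
      then have "measure (law z) (B \<inter> (cylinder u \<inter> settled (length u))) = 0"
        using null by (simp add: measure_le_0_iff)
      then have "g_word g z u * measure (law x) (B \<inter> (cylinder u \<inter> settled (length u))) = 0"
        using law_exchange[OF B, of z u x] by simp
      moreover have "g_word g z u \<noteq> 0" using g_word_pos[of z u] by linarith
      ultimately have "measure (law x) (B \<inter> (cylinder u \<inter> settled (length u))) = 0" by simp
      then show "measure (law x) (B \<inter> settled N \<inter> translate 0 -` cylinder u) = 0"
        by (simp add: N Int_ac)
    qed
    finally show ?thesis .
  qed
  then show "(\<lambda>N. measure (law x) (B \<inter> settled N)) \<longlonglongrightarrow> 0" by simp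
qed

text \<open>
  Fix one past \<open>x\<^sub>0\<close> and a time \<open>N\<close> at which the chain from \<open>x\<^sub>0\<close> is settled with probability above
  \<open>3/4\<close>. One of \<open>B\<close> and its complement has probability at least \<open>1/2\<close> from \<open>x\<^sub>0\<close>, hence at
  least \<open>1/4\<close> on the settled event, where the law from any other \<open>x\<close> is at least the law from
  \<open>x\<^sub>0\<close> times the probability under \<open>x\<close> of the first \<open>N\<close> symbols. Only the alternative, but not
  the function \<open>\<eta>\<close>, depends on \<open>B\<close>.
\<close>

lemma ex_uniform_minorant:
  "\<exists>\<eta>. \<eta> \<in> borel_measurable (PiM UNIV (\<lambda>_. count_space UNIV)) \<and> (\<forall>x. 0 < \<eta> x \<and> \<eta> x \<le> 1) \<and>
    (\<forall>B\<in>sets (coord_algebra {0..}).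
      (\<forall>x. \<eta> x \<le> measure (law x) B) \<or> (\<forall>x. \<eta> x \<le> measure (law x) (- B)))"
proof -
  define x0 :: "'a lseq" where "x0 = (\<lambda>_. undefined)"
  have "(\<lambda>N. measure (law x0) (UNIV \<inter> settled N)) \<longlonglongrightarrow> measure (law x0) UNIV"
    by (intro measure_settled_tendsto settles) simp
  then have "(\<lambda>N. measure (law x0) (settled N)) \<longlonglongrightarrow> 1"
    using law.prob_space[of x0] by simp
  then have "\<forall>\<^sub>F N in sequentially. measure (law x0) (settled N) > 3 / 4"
    by (rule order_tendstoD) simp
  then obtain N where N: "measure (law x0) (settled N) > 3 / 4"
    by (auto simp: eventually_sequentially)
  \<comment> \<open>A measurable positive lower bound for all the factors \<open>g_word g x u\<close> at once.\<close>
  define p where "p x = (\<Prod>u\<in>words N. g_word g x u)" for x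
  have p_pos: "0 < p x" for x unfolding p_def by (intro prod_pos) simp
  have p_le: "p x \<le> g_word g x u" if "u \<in> words N" for x u
  proof -
    have "p x = g_word g x u * (\<Prod>v\<in>words N - {u}. g_word g x v)"
      unfolding p_def using that by (simp add: prod.remove)
    also have "\<dots> \<le> g_word g x u * 1"
      by (intro mult_left_mono prod_le_1) simp_all
    finally show ?thesis by simp
  qed
  have minor: "p x / 4 \<le> measure (law x) B"
    if B: "B \<in> sets (coord_algebra {0..})" and half: "measure (law x0) B \<ge> 1 / 2" for B x
  proof -
    have Bm [measurable]: "B \<in> sets seq_space" using B by (rule coord_algebra_sets)
    have dec: "measure (law y) (B \<inter> settled N) =
        (\<Sum>u\<in>words N. measure (law y) (B \<inter> (cylinder u \<inter> settled N)))" for y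
    proof -
      have "measure (law y) (B \<inter> settled N) =
          (\<Sum>u\<in>words N. measure (law y) (B \<inter> settled N \<inter> translate 0 -` cylinder u))"
        by (intro measure_words_decomposition) (simp_all add: law.finite_measure_axioms)
      then show ?thesis by (simp add: Int_ac)
    qed
    have "measure (law x0) (B \<inter> settled N) \<ge> 1 / 4"
    proof -
      have "measure (law x0) (B \<union> settled N) = measure (law x0) B + measure (law x0) (settled N - B)"
        by (rule law.finite_measure_Union') simp_all
      moreover have "measure (law x0) (settled N - B) = measure (law x0) (settled N) - measure (law x0) (settled N \<inter> B)"
        by (rule law.finite_measure_Diff') simp_all
      moreover have "measure (law x0) (B \<union> settled N) \<le> 1" by simp
      moreover have "settled N \<inter> B = B \<inter> settled N" by blast
      ultimately show ?thesis using N half by simp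
    qed
    then have "p x / 4 \<le> p x * measure (law x0) (B \<inter> settled N)"
      using p_pos[of x] by (simp add: field_simps)
    also have "\<dots> = (\<Sum>u\<in>words N. p x * measure (law x0) (B \<inter> (cylinder u \<inter> settled N)))"
      unfolding dec by (rule sum_distrib_left)
    also have "\<dots> \<le> (\<Sum>u\<in>words N. measure (law x) (B \<inter> (cylinder u \<inter> settled N)))"
    proof (rule sum_mono)
      fix u :: "'a list" assume u: "u \<in> words N"
      then have len: "N = length u" by (simp add: words_def)
      have "p x * measure (law x0) (B \<inter> (cylinder u \<inter> settled N)) \<le>
          g_word g x u * measure (law x0) (B \<inter> (cylinder u \<inter> settled N))"
        by (intro mult_right_mono p_le u) simp
      also have "\<dots> = g_word g x0 u * measure (law x) (B \<inter> (cylinder u \<inter> settled N))"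
        unfolding len by (rule law_exchange[OF B])
      also have "\<dots> \<le> 1 * measure (law x) (B \<inter> (cylinder u \<inter> settled N))"
        by (intro mult_right_mono) simp_all
      finally show "p x * measure (law x0) (B \<inter> (cylinder u \<inter> settled N)) \<le>
          measure (law x) (B \<inter> (cylinder u \<inter> settled N))" by simp
    qed
    also have "\<dots> = measure (law x) (B \<inter> settled N)" by (rule dec[symmetric])
    also have "\<dots> \<le> measure (law x) B" by (intro law.finite_measure_mono) auto
    finally show ?thesis .
  qed
  have "(\<forall>x. p x / 4 \<le> measure (law x) B) \<or> (\<forall>x. p x / 4 \<le> measure (law x) (- B))"
    if B: "B \<in> sets (coord_algebra {0..})" for B
  proof (cases "measure (law x0) B \<ge> 1 / 2")
    case True
    then show ?thesis using minor[OF B] by blast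
  next
    case False
    have "- B \<in> sets (coord_algebra {0..})"
      using sets.compl_sets[OF B] by (simp add: Compl_eq_Diff_UNIV)
    moreover have "measure (law x0) (- B) \<ge> 1 / 2"
      using False law.prob_compl[of B x0] coord_algebra_sets[OF B] by (simp add: Compl_eq_Diff_UNIV)
    ultimately show ?thesis using minor by blast
  qed
  moreover have "(\<lambda>x. p x / 4) \<in> borel_measurable (PiM UNIV (\<lambda>_. count_space UNIV))"
    unfolding p_def by measurable
  moreover have "0 < p x / 4 \<and> p x / 4 \<le> 1" for x
  proof -
    have "p x \<le> 1" unfolding p_def by (intro prod_le_1) simp
    then show ?thesis using p_pos[of x] by simp
  qed
  ultimately show ?thesis by (intro exI[of _ "\<lambda>x. p x / 4"]) blast
qed

end

section \<open>Tail events and uniqueness\<close>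

lemma sets_seq_space_past_windows:
  "sets (seq_space :: (int \<Rightarrow> 'a) measure) = sigma_sets UNIV (\<Union>n. sets (coord_algebra {..<int n}))"
proof (rule antisym)
  have "(\<lambda>y. y i) -` B \<in> (\<Union>n. sets (coord_algebra {..<int n}))" for i and B :: "'a set"
    by (rule UN_I[of "nat (i + 1)"]) (auto intro: coord_in_coord_algebra)
  then show "sets (seq_space :: (int \<Rightarrow> 'a) measure) \<subseteq> sigma_sets UNIV (\<Union>n. sets (coord_algebra {..<int n}))"
    unfolding sets_coord_algebra_UNIV[symmetric] sets_coord_algebra[of UNIV]
    by (intro sigma_sets_mono') blast
  show "sigma_sets UNIV (\<Union>n. sets (coord_algebra {..<int n})) \<subseteq> sets (seq_space :: (int \<Rightarrow> 'a) measure)"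
    by (rule sets.sigma_sets_subset[of _ seq_space, unfolded space_seq_space])
      (auto intro: coord_algebra_sets)
qed

lemma Compl_coord_algebra: "A \<in> sets (coord_algebra I) \<Longrightarrow> - A \<in> sets (coord_algebra I)"
  using sets.compl_sets[of A "coord_algebra I"] by (simp add: Compl_eq_Diff_UNIV)

definition tail_event :: "(int \<Rightarrow> 'a) set \<Rightarrow> bool" where
  "tail_event A \<longleftrightarrow> (\<forall>n. A \<in> sets (coord_algebra {int n..}))"

locale settling_measure = settling_chain g + compatible_measure g \<nu>
  for g :: "'a::finite lseq \<Rightarrow> real" and \<nu> :: "(int \<Rightarrow> 'a) measure"
begin

text \<open>
  If \<open>0 < \<nu>(A) < 1\<close>, then the translated event \<open>B\<close> and the past event \<open>K\<close> approximating it satisfy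
  \<open>\<nu>(B - K) < \<epsilon>\<close> and \<open>\<nu>(K - B) < \<epsilon>\<close>, while both \<open>K\<close> and its complement have mass bounded below.
  On the other hand, \<open>\<nu>(B - K)\<close> is the integral of \<open>\<mu>\<^sup>x(B)\<close> over the pasts outside \<open>K\<close>. If
  \<open>\<mu>\<^sup>x(B) \<ge> \<eta>(x)\<close> for all \<open>x\<close>, it is bounded below independently of \<open>\<epsilon>\<close>; otherwise the same
  holds for \<open>\<nu>(K - B)\<close>. It matters that \<open>\<eta>\<close> and the distribution of the past do not change with the
  translation.
\<close>

lemma tail_trivial:
  assumes "tail_event A"
  shows "measure \<nu> A = 0 \<or> measure \<nu> A = 1"
proof (rule ccontr)
  assume nontrivial: "\<not> ?thesis"
  have tail: "A \<in> sets (coord_algebra {int n..})" for n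
    using assms by (simp add: tail_event_def)
  then have A [measurable]: "A \<in> sets seq_space" by (rule coord_algebra_sets)
  obtain \<eta> where \<eta>m [measurable]: "\<eta> \<in> borel_measurable (PiM UNIV (\<lambda>_. count_space UNIV))"
    and \<eta>: "\<And>x. 0 < \<eta> x" "\<And>x. \<eta> x \<le> 1"
    and minorant: "\<And>B. B \<in> sets (coord_algebra {0..}) \<Longrightarrow>
      (\<forall>x. \<eta> x \<le> measure (law x) B) \<or> (\<forall>x. \<eta> x \<le> measure (law x) (- B))"
    using ex_uniform_minorant by blast
  define \<delta> where "\<delta> = min (measure \<nu> A) (1 - measure \<nu> A)"
  have \<delta>: "0 < \<delta>" "\<delta> \<le> measure \<nu> A" "\<delta> \<le> 1 - measure \<nu> A"
    using nontrivial measure_nonneg[of \<nu> A] prob_le_1[of A]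
    by (auto simp: \<delta>_def less_le)
  define low where "low k = {y. \<eta> (past y) < 1 / real (Suc k)}" for k
  have low_sets [measurable]: "low k \<in> sets seq_space" for k
  proof -
    have "{y \<in> space seq_space. \<eta> (past y) < 1 / real (Suc k)} \<in> sets seq_space" by measurable
    then show ?thesis by (simp add: low_def)
  qed
  have "decseq low"
  proof (rule decseq_SucI)
    fix k
    have "1 / real (Suc (Suc k)) \<le> 1 / real (Suc k)" by (simp add: field_simps)
    then show "low (Suc k) \<subseteq> low k" unfolding low_def by force
  qed
  then have "(\<lambda>k. measure \<nu> (low k)) \<longlonglongrightarrow> measure \<nu> (\<Inter>k. low k)"
    by (intro finite_Lim_measure_decseq) auto
  moreover have "(\<Inter>k. low k) = {}"
  proof -
    have "\<exists>k. y \<notin> low k" for y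
      using reals_Archimedean[OF \<eta>(1)[of "past y"]]
      by (auto simp: low_def inverse_eq_divide not_less intro: less_imp_le)
    then show ?thesis by blast
  qed
  ultimately have "(\<lambda>k. measure \<nu> (low k)) \<longlonglongrightarrow> 0" by simp
  then have "\<forall>\<^sub>F k in sequentially. measure \<nu> (low k) < \<delta> / 4"
    by (rule order_tendstoD) (use \<delta> in simp)
  then obtain k where k: "measure \<nu> (low k) < \<delta> / 4" by (auto simp: eventually_sequentially)
  define h where "h = 1 / real (Suc k)"
  have h: "0 < h" "h \<le> 1" by (simp_all add: h_def)
  \<comment> \<open>Outside of a set of mass below \<open>\<delta> / 4\<close> the minorant is at least \<open>h\<close>, so a past event of mass
    at least \<open>3 \<delta> / 4\<close> retains at least \<open>\<delta> / 2\<close> there.\<close>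
  have mass: "h * \<delta> / 2 \<le> measure \<nu> (D \<inter> B)"
    if D: "D \<in> sets (coord_algebra {..-1})" and B: "B \<in> sets seq_space"
      and le: "\<And>x. \<eta> x \<le> measure (law x) B" and big: "3 * \<delta> / 4 \<le> measure \<nu> D" for D B
  proof -
    have [measurable]: "D \<in> sets seq_space" "B \<in> sets seq_space"
      using D B coord_algebra_sets by blast+
    have "measure \<nu> D \<le> measure \<nu> ((D - low k) \<union> low k)" by (intro finite_measure_mono) auto
    also have "\<dots> \<le> measure \<nu> (D - low k) + measure \<nu> (low k)" by (intro measure_Un_le) auto
    finally have "\<delta> / 2 \<le> measure \<nu> (D - low k)" using k big by simp
    then have "h * (\<delta> / 2) \<le> h * measure \<nu> (D - low k)" using h by (intro mult_left_mono) simp_all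
    also have "\<dots> = (\<integral>y. h * indicator (D - low k) y \<partial>\<nu>)" by simp
    also have "\<dots> \<le> (\<integral>y. indicator D y * measure (law (past y)) B \<partial>\<nu>)"
    proof (rule integral_mono)
      show "integrable \<nu> (\<lambda>y. h * indicator (D - low k) y)"
        by (rule integrable_const_bound[where B = h]) (use h in \<open>auto split: split_indicator\<close>)
      show "integrable \<nu> (\<lambda>y. indicator D y * measure (law (past y)) B)"
        by (rule integrable_const_bound[where B = 1]) (auto split: split_indicator)
      have "h \<le> measure (law (past y)) B" if "y \<notin> low k" for y
        using that le[of "past y"] by (simp add: low_def h_def)
      then show "h * indicator (D - low k) y \<le> indicator D y * measure (law (past y)) B" for y
        by (simp split: split_indicator)
    qed
    also have "\<dots> = measure \<nu> (D \<inter> B)" by (rule measure_Int_past[OF D B, symmetric])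
    finally show ?thesis by simp
  qed
  define \<epsilon> where "\<epsilon> = h * \<delta> / 4"
  have \<epsilon>: "0 < \<epsilon>" "\<epsilon> \<le> \<delta> / 4" "\<epsilon> < h * \<delta> / 2"
    using h \<delta> by (simp_all add: \<epsilon>_def mult_left_le_one_le)
  have "\<exists>n. \<exists>L\<in>sets (coord_algebra {..<int n}). measure \<nu> (A - L) < \<epsilon> \<and> measure \<nu> (L - A) < \<epsilon>"
  proof (rule sigma_union_approximation)
    show "sets (coord_algebra {..<int n}) \<subseteq> sets \<nu>" for n
      using subalgebra_coord_algebra by simp
    show "sets (coord_algebra {..<int m}) \<subseteq> sets (coord_algebra {..<int n})" if "m \<le> n" for m n
      using that by (intro coord_algebra_mono) auto
    show "A \<in> sigma_sets (space \<nu>) (\<Union>n. sets (coord_algebra {..<int n}))"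
      using A by (simp add: sets_seq_space_past_windows)
  qed (simp_all add: finite_measure_axioms \<epsilon>)
  then obtain n L where L: "L \<in> sets (coord_algebra {..<int n})"
    and AL: "measure \<nu> (A - L) < \<epsilon>" and LA: "measure \<nu> (L - A) < \<epsilon>" by blast
  define B where "B = translate (- int n) -` A"
  define K where "K = translate (- int n) -` L"
  have Lm [measurable]: "L \<in> sets seq_space" using L by (rule coord_algebra_sets)
  have B: "B \<in> sets (coord_algebra {0..})"
    unfolding B_def by (rule vimage_translate_coord_algebra[OF tail[of n]]) auto
  have K: "K \<in> sets (coord_algebra {..-1})"
    unfolding K_def by (rule vimage_translate_coord_algebra[OF L]) auto
  note [measurable] = coord_algebra_sets[OF B] coord_algebra_sets[OF K]
  have inv: "measure \<nu> (translate (- int n) -` X) = measure \<nu> X" if "X \<in> sets seq_space" for X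
    using that by (rule measure_translate)
  have BK: "measure \<nu> (- K \<inter> B) < \<epsilon>" and KB: "measure \<nu> (K \<inter> - B) < \<epsilon>"
    using AL LA inv[of "A - L"] inv[of "L - A"]
    by (simp_all add: B_def K_def vimage_Diff Diff_eq vimage_Compl Int_commute)
  have A_split: "measure \<nu> (A \<inter> L) + measure \<nu> (A - L) = measure \<nu> A"
    "measure \<nu> (A \<inter> L) + measure \<nu> (L - A) = measure \<nu> L"
    using finite_measure_Diff'[of A L] finite_measure_Diff'[of L A] by (simp_all add: Int_commute)
  have K_L: "measure \<nu> K = measure \<nu> L" unfolding K_def by (rule inv) simp
  from minorant[OF B] show False
  proof
    assume le: "\<forall>x. \<eta> x \<le> measure (law x) B"
    have "measure \<nu> (- K) = 1 - measure \<nu> L"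
      using prob_compl[of K] by (simp add: Compl_eq_Diff_UNIV K_L)
    then have "3 * \<delta> / 4 \<le> measure \<nu> (- K)"
      using A_split LA \<delta>(3) \<epsilon>(2) measure_nonneg[of \<nu> "A - L"] by linarith
    then have "h * \<delta> / 2 \<le> measure \<nu> (- K \<inter> B)"
      using le by (intro mass Compl_coord_algebra K) simp_all
    with BK \<epsilon>(3) show False by linarith
  next
    assume le: "\<forall>x. \<eta> x \<le> measure (law x) (- B)"
    have "3 * \<delta> / 4 \<le> measure \<nu> K"
      using A_split AL \<delta>(2) \<epsilon>(2) measure_nonneg[of \<nu> "L - A"] unfolding K_L by linarith
    then have "h * \<delta> / 2 \<le> measure \<nu> (K \<inter> - B)"
      using le coord_algebra_sets[OF Compl_coord_algebra[OF B]] by (intro mass K) simp_all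
    with KB \<epsilon>(3) show False by linarith
  qed
qed

text \<open>
  Since \<open>\<nu>\<close> is the mixture of the laws, an event that is null for \<open>\<nu>\<close> is null for the law of at
  least one past, and then for the laws of all pasts.
\<close>

lemma tail_event_law:
  assumes "tail_event A"
  shows "measure (law x) A = measure \<nu> A"
proof -
  have zero: "measure (law x) B = 0" if B: "B \<in> sets (coord_algebra {0..})" and null: "measure \<nu> B = 0" for B
  proof -
    have [measurable]: "B \<in> sets seq_space" using B by (rule coord_algebra_sets)
    have "(\<integral>y. measure (law (past y)) B \<partial>\<nu>) = 0"
      using null measure_eq_integral_law[of B] by simp
    moreover have "integrable \<nu> (\<lambda>y. measure (law (past y)) B)"
      by (rule integrable_const_bound[where B = 1]) auto
    ultimately have "AE y in \<nu>. measure (law (past y)) B = 0"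
      by (subst (asm) integral_nonneg_eq_0_iff_AE) auto
    then have "\<exists>y. measure (law (past y)) B = 0"
      using eventually_happens'[of "ae_filter \<nu>"] ae_filter_bot by blast
    then obtain y where "measure (law (past y)) B = 0" ..
    then show ?thesis by (rule null_sets_independent_of_past[OF B])
  qed
  have A: "A \<in> sets (coord_algebra {0..})" using assms by (auto simp: tail_event_def dest: spec[of _ 0])
  have [measurable]: "A \<in> sets seq_space" using A by (rule coord_algebra_sets)
  from tail_trivial[OF assms] show ?thesis
  proof
    assume "measure \<nu> A = 0"
    then show ?thesis using zero[OF A] by simp
  next
    assume one: "measure \<nu> A = 1"
    then have "measure \<nu> (- A) = 0" using prob_compl[of A] by (simp add: Compl_eq_Diff_UNIV)
    then have "measure (law x) (- A) = 0" by (rule zero[OF Compl_coord_algebra[OF A]])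
    then show ?thesis using one law.prob_compl[of A x] by (simp add: Compl_eq_Diff_UNIV)
  qed
qed

end

context settling_chain
begin

text \<open>
  The two measures agree on tail events, so they differ by less than \<open>\<epsilon>\<close> on the future of some
  time \<open>n\<close>; a finitary event can be translated into that future.
\<close>

lemma compatible_measure_le:
  assumes \<nu>: "\<nu> \<in> compatible_measures g" and \<nu>': "\<nu>' \<in> compatible_measures g" and C: "finitary C"
  shows "measure \<nu> C \<le> measure \<nu>' C"
proof (rule field_le_epsilon)
  interpret N: settling_measure g \<nu> by unfold_locales (rule \<nu>)
  interpret N': settling_measure g \<nu>' by unfold_locales (rule \<nu>')
  fix \<epsilon> :: real assume "0 < \<epsilon>"
  have "\<exists>n. \<forall>D\<in>sets (coord_algebra {int n..}). measure \<nu> D - measure \<nu>' D < \<epsilon>"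
  proof (rule tail_domination_imp_uniform)
    fix A :: "(int \<Rightarrow> 'a) set" assume "\<And>n. A \<in> sets (coord_algebra {int n..})"
    then have "tail_event A" by (simp add: tail_event_def)
    then show "measure \<nu> A \<le> measure \<nu>' A"
      using N.tail_event_law[of A undefined] N'.tail_event_law[of A undefined] by simp
  next
    show "sets (coord_algebra {int n..}) \<subseteq> sets (coord_algebra {int m..})" if "m \<le> n" for m n
      using that by (intro coord_algebra_mono) auto
  qed (simp_all add: N.finite_measure_axioms N'.finite_measure_axioms subalgebra_coord_algebra \<open>0 < \<epsilon>\<close>)
  then obtain n where n: "\<And>D. D \<in> sets (coord_algebra {int n..}) \<Longrightarrow> measure \<nu> D - measure \<nu>' D < \<epsilon>" by blast
  obtain I where I: "finite I" "depends_on I C" using C by (auto simp: finitary_def)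
  define m where "m = Min (insert 0 I)"
  have m: "m \<le> i" if "i \<in> I" for i
    unfolding m_def using I(1) that by (intro Min_le) simp_all
  have "translate (int n - m) -` C \<in> sets (coord_algebra {int n..})"
    by (rule vimage_translate_coord_algebra[OF depends_on_coord_algebra[OF I]]) (auto dest: m)
  from n[OF this] show "measure \<nu> C \<le> measure \<nu>' C + \<epsilon>"
    using finitary_sets[OF C] by (simp add: N.measure_translate N'.measure_translate)
qed

theorem compatible_measure_unique:
  assumes "\<nu> \<in> compatible_measures g" "\<nu>' \<in> compatible_measures g"
  shows "\<nu> = \<nu>'"
proof (rule seq_measure_eqI)
  interpret N: compatible_measure g \<nu> by unfold_locales (rule assms)
  interpret N': compatible_measure g \<nu>' by unfold_locales (rule assms)
  show "finite_measure \<nu>" "finite_measure \<nu>'" "sets \<nu> = sets seq_space" "sets \<nu>' = sets seq_space"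
    by (simp_all add: N.finite_measure_axioms N'.finite_measure_axioms)
  show "measure \<nu> C = measure \<nu>' C" if "finitary C" for C
    using that by (intro antisym compatible_measure_le assms)
qed

end

section \<open>Absolute regularity\<close>

context settling_measure
begin

text \<open>
  The pair (past, future) has the distribution of \<open>(y, y)\<close> on the product \<open>\<sigma>\<close>-algebra. For an
  event \<open>D\<close> in all of the product \<open>\<sigma>\<close>-algebras, given the past of \<open>y\<close> the first component can be
  frozen, and the section of \<open>D\<close> at \<open>y\<close> is a tail event, of conditional probability equal to its
  probability under \<open>\<nu>\<close>. So the joint law and the product measure agree on \<open>D\<close>.
\<close>

lemma past_future_domination:
  assumes "0 < \<epsilon>"
  shows "\<exists>n. \<forall>D\<in>sets (coord_algebra {..-1} \<Otimes>\<^sub>M coord_algebra {int n..}).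
    measure \<nu> {y. (y, y) \<in> D} - measure (\<nu> \<Otimes>\<^sub>M \<nu>) D < \<epsilon>"
proof -
  let ?G = "\<lambda>n. (coord_algebra {..-1} \<Otimes>\<^sub>M coord_algebra {int n..} :: ((int \<Rightarrow> 'a) \<times> (int \<Rightarrow> 'a)) measure)"
  let ?S = "seq_space \<Otimes>\<^sub>M seq_space :: ((int \<Rightarrow> 'a) \<times> (int \<Rightarrow> 'a)) measure"
  interpret NN: pair_prob_space \<nu> \<nu> ..
  have diag [measurable]: "(\<lambda>y. (y, y)) \<in> measurable \<nu> ?S" by simp
  define P where "P = distr \<nu> ?S (\<lambda>y. (y, y))"
  interpret P: prob_space P unfolding P_def by (rule prob_space_distr[OF diag])
  have P: "measure P D = measure \<nu> {y. (y, y) \<in> D}" if "D \<in> sets ?S" for D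
    unfolding P_def using that by (subst measure_distr[OF diag]) (simp_all add: vimage_def)
  have pair_mono: "sets (coord_algebra {..-1} \<Otimes>\<^sub>M M) \<subseteq> sets (coord_algebra {..-1} \<Otimes>\<^sub>M N)"
    if "sets M \<subseteq> sets N" "space M = UNIV" "space N = UNIV" for M N :: "(int \<Rightarrow> 'a) measure"
    unfolding sets_pair_measure space_coord_algebra that(2,3)
    using that(1) by (intro sigma_sets_mono') blast
  have G_sub: "sets (?G n) \<subseteq> sets ?S" for n
    unfolding sets_pair_measure space_coord_algebra space_seq_space
    by (intro sigma_sets_mono') (use subalgebra_coord_algebra in blast)
  have tail: "measure P D \<le> measure (\<nu> \<Otimes>\<^sub>M \<nu>) D" if D: "\<And>n. D \<in> sets (?G n)" for D
  proof -
    have D_S: "D \<in> sets ?S" using D[of 0] G_sub[of 0] by blast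
    have tail_section: "tail_event (Pair y -` D)" for y
      unfolding tail_event_def using sets_Pair1[OF D] by blast
    have diag_sets: "{y. (y, y) \<in> D} \<in> sets seq_space"
      using measurable_sets[OF diag D_S] by (simp add: vimage_def)
    have "measure (law (past y)) {z. (z, z) \<in> D} = measure \<nu> (Pair y -` D)" for y
    proof -
      have eq: "(z, z) \<in> D \<longleftrightarrow> (y, z) \<in> D" if "past z = past y" for z
        using past_coord_determined[OF sets_Pair2[OF D[of 0], of z] that] by simp
      have "AE z in law (past y). z \<in> {z. (z, z) \<in> D} \<longleftrightarrow> z \<in> Pair y -` D"
        using AE_law_past[of "past y"] by eventually_elim (simp add: eq)
      then have "measure (law (past y)) {z. (z, z) \<in> D} = measure (law (past y)) (Pair y -` D)"
        using diag_sets sets_Pair1[OF D_S, of y] by (intro law.finite_measure_eq_AE) simp_all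
      then show ?thesis by (simp add: tail_event_law[OF tail_section])
    qed
    then have "measure P D = (\<integral>y. measure \<nu> (Pair y -` D) \<partial>\<nu>)"
      using measure_eq_integral_law[OF diag_sets] by (simp add: P[OF D_S])
    also have "\<dots> = measure (\<nu> \<Otimes>\<^sub>M \<nu>) D"
    proof -
      have D': "D \<in> sets (\<nu> \<Otimes>\<^sub>M \<nu>)" using D_S by (simp cong: sets_pair_measure_cong)
      have "(\<lambda>y. enn2real (emeasure \<nu> (Pair y -` D))) \<in> borel_measurable \<nu>"
        using measurable_emeasure_Pair[OF D'] by simp
      then have "(\<integral>y. measure \<nu> (Pair y -` D) \<partial>\<nu>) = enn2real (\<integral>\<^sup>+y. ennreal (measure \<nu> (Pair y -` D)) \<partial>\<nu>)"
        by (intro integral_eq_nn_integral) (simp_all add: measure_def)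
      also have "(\<integral>\<^sup>+y. ennreal (measure \<nu> (Pair y -` D)) \<partial>\<nu>) = emeasure (\<nu> \<Otimes>\<^sub>M \<nu>) D"
        unfolding emeasure_pair_measure_alt[OF D'] by (simp add: emeasure_eq_measure)
      finally show ?thesis by (simp add: measure_def)
    qed
    finally show ?thesis by simp
  qed
  have "\<exists>n. \<forall>D\<in>sets (?G n). measure P D - measure (\<nu> \<Otimes>\<^sub>M \<nu>) D < \<epsilon>"
  proof (rule tail_domination_imp_uniform[OF P.finite_measure_axioms NN.finite_measure_axioms])
    show "sets (?G n) \<subseteq> sets P" for n using G_sub by (simp add: P_def)
    show "sets (?G n) \<subseteq> sets (\<nu> \<Otimes>\<^sub>M \<nu>)" for n
      using G_sub by (simp cong: sets_pair_measure_cong)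
    show "sets (?G n) \<subseteq> sets (?G m)" if "m \<le> n" for m n
      using that by (intro pair_mono coord_algebra_mono) auto
  qed (rule tail, assumption, rule assms)
  then obtain n where n: "\<And>D. D \<in> sets (?G n) \<Longrightarrow> measure P D - measure (\<nu> \<Otimes>\<^sub>M \<nu>) D < \<epsilon>" by blast
  have "measure \<nu> {y. (y, y) \<in> D} - measure (\<nu> \<Otimes>\<^sub>M \<nu>) D < \<epsilon>" if D: "D \<in> sets (?G n)" for D
    using n[OF D] P[OF subsetD[OF G_sub D]] by simp
  then show ?thesis by blast
qed

text \<open>
  The signed differences over all pairs of cells sum to zero, so half of the sum of their absolute
  values is the sum of the nonnegative ones. That sum is the difference of the joint law and
  the product measure on the union of the corresponding rectangles. The translation by \<open>-1\<close> moves
  the coordinates up to \<open>0\<close> to the coordinates up to \<open>-1\<close>.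
\<close>

lemma sum_partition_dependence:
  assumes P: "finite P" "partition_on UNIV P" "P \<subseteq> sets (coord_algebra {..0})"
    and Q: "finite Q" "partition_on UNIV Q" "Q \<subseteq> sets (coord_algebra {int (Suc n)..})"
    and bound: "\<And>D. D \<in> sets (coord_algebra {..-1} \<Otimes>\<^sub>M coord_algebra {int n..}) \<Longrightarrow>
      measure \<nu> {y. (y, y) \<in> D} - measure (\<nu> \<Otimes>\<^sub>M \<nu>) D < \<epsilon>"
  shows "1 / 2 * (\<Sum>A\<in>P. \<Sum>B\<in>Q. \<bar>measure \<nu> (A \<inter> B) - measure \<nu> A * measure \<nu> B\<bar>) < \<epsilon>"
proof -
  interpret NN: pair_prob_space \<nu> \<nu> ..
  let ?t = "\<lambda>A. translate (- 1) -` A :: (int \<Rightarrow> 'a) set"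
  define R where "R = (\<lambda>(A, B). ?t A \<times> ?t B)"
  define d where "d = (\<lambda>(A, B). measure \<nu> (A \<inter> B) - measure \<nu> A * measure \<nu> B)"
  have fin: "finite S" if "S \<subseteq> P \<times> Q" for S
    using that P(1) Q(1) finite_subset by blast
  have PS: "A \<in> sets seq_space" "?t A \<in> sets (coord_algebra {..-1})" if "A \<in> P" for A
  proof -
    have A: "A \<in> sets (coord_algebra {..0})" using that P(3) by blast
    then show "A \<in> sets seq_space" by (rule coord_algebra_sets)
    show "?t A \<in> sets (coord_algebra {..-1})"
      by (rule vimage_translate_coord_algebra[OF A]) auto
  qed
  have QS: "B \<in> sets seq_space" "?t B \<in> sets (coord_algebra {int n..})" if "B \<in> Q" for B
  proof -
    have B: "B \<in> sets (coord_algebra {int (Suc n)..})" using that Q(3) by blast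
    then show "B \<in> sets seq_space" by (rule coord_algebra_sets)
    show "?t B \<in> sets (coord_algebra {int n..})"
      by (rule vimage_translate_coord_algebra[OF B]) auto
  qed
  have disj: "disjoint_family_on R (P \<times> Q)"
  proof -
    have "A = A' \<and> B = B'" if "A \<in> P" "A' \<in> P" "B \<in> Q" "B' \<in> Q" "R (A, B) \<inter> R (A', B') \<noteq> {}" for A A' B B'
    proof -
      have "A \<inter> A' \<noteq> {}" "B \<inter> B' \<noteq> {}" using that(5) by (auto simp: R_def)
      then show ?thesis
        using partition_onD2[OF P(2)] partition_onD2[OF Q(2)] that(1-4) unfolding disjoint_def by blast
    qed
    then show ?thesis unfolding disjoint_family_on_def by fast
  qed
  have sum: "(\<Sum>p\<in>S. d p) = measure \<nu> {y. (y, y) \<in> (\<Union>p\<in>S. R p)} - measure (\<nu> \<Otimes>\<^sub>M \<nu>) (\<Union>p\<in>S. R p)"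
    if S: "S \<subseteq> P \<times> Q" for S
  proof -
    have "measure \<nu> (\<Union>p\<in>S. {y. (y, y) \<in> R p}) = (\<Sum>p\<in>S. measure \<nu> {y. (y, y) \<in> R p})"
    proof (rule finite_measure_finite_Union[OF fin[OF S]])
      show "disjoint_family_on (\<lambda>p. {y. (y, y) \<in> R p}) S"
        using disjoint_family_on_mono[OF S disj] unfolding disjoint_family_on_def by blast
      have "{y. (y, y) \<in> R (A, B)} = ?t A \<inter> ?t B" for A B by (auto simp: R_def)
      then show "(\<lambda>p. {y. (y, y) \<in> R p}) ` S \<subseteq> sets \<nu>"
        using S PS(1) QS(1) by (auto intro!: sets.Int vimage_translate_sets)
    qed
    moreover have "measure (\<nu> \<Otimes>\<^sub>M \<nu>) (\<Union>p\<in>S. R p) = (\<Sum>p\<in>S. measure (\<nu> \<Otimes>\<^sub>M \<nu>) (R p))"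
    proof (rule NN.finite_measure_finite_Union[OF fin[OF S]])
      show "disjoint_family_on R S" by (rule disjoint_family_on_mono[OF S disj])
      show "R ` S \<subseteq> sets (\<nu> \<Otimes>\<^sub>M \<nu>)"
        using S PS(1) QS(1) by (auto simp: R_def intro!: pair_measureI vimage_translate_sets)
    qed
    moreover have "d p = measure \<nu> {y. (y, y) \<in> R p} - measure (\<nu> \<Otimes>\<^sub>M \<nu>) (R p)" if pS: "p \<in> S" for p
    proof -
      obtain A B where p: "p = (A, B)" "A \<in> P" "B \<in> Q" using pS S by blast
      have "{y. (y, y) \<in> R p} = ?t (A \<inter> B)" by (auto simp: R_def p(1))
      then have "measure \<nu> {y. (y, y) \<in> R p} = measure \<nu> (A \<inter> B)"
        using PS(1)[OF p(2)] QS(1)[OF p(3)] by (simp only:) (intro measure_translate sets.Int)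
      moreover have "measure (\<nu> \<Otimes>\<^sub>M \<nu>) (R p) = measure \<nu> (?t A) * measure \<nu> (?t B)"
      proof -
        have "emeasure (\<nu> \<Otimes>\<^sub>M \<nu>) (?t A \<times> ?t B) = emeasure \<nu> (?t A) * emeasure \<nu> (?t B)"
          using PS(1)[OF p(2)] QS(1)[OF p(3)]
          by (intro emeasure_pair_measure_Times) (simp_all add: vimage_translate_sets)
        then show ?thesis by (simp add: p(1) R_def measure_def enn2real_mult)
      qed
      ultimately show ?thesis
        using PS(1)[OF p(2)] QS(1)[OF p(3)] by (simp add: d_def p(1) measure_translate)
    qed
    ultimately show ?thesis by (simp add: sum_subtractf UN_iff flip: Collect_bex_eq)
  qed
  define S where "S = {p \<in> P \<times> Q. 0 \<le> d p}"
  have S: "S \<subseteq> P \<times> Q" by (auto simp: S_def)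
  have "(\<Union>p\<in>P \<times> Q. R p) = UNIV"
  proof -
    have "z \<in> (\<Union>p\<in>P \<times> Q. R p)" for z
    proof -
      obtain A where "translate (- 1) (fst z) \<in> A" "A \<in> P" using partition_onD1[OF P(2)] by blast
      moreover obtain B where "translate (- 1) (snd z) \<in> B" "B \<in> Q" using partition_onD1[OF Q(2)] by blast
      ultimately show ?thesis by (intro UN_I[of "(A, B)"]) (auto simp: R_def mem_Times_iff)
    qed
    then show ?thesis by blast
  qed
  then have zero: "(\<Sum>p\<in>P \<times> Q. d p) = 0"
    using sum[OF order_refl] prob_space NN.prob_space by (simp add: space_pair_measure)
  have D: "(\<Union>p\<in>S. R p) \<in> sets (coord_algebra {..-1} \<Otimes>\<^sub>M coord_algebra {int n..})"
    using PS(2) QS(2) S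
    by (intro sets.finite_UN fin) (auto simp: R_def intro!: pair_measureI)
  have "(\<Sum>A\<in>P. \<Sum>B\<in>Q. \<bar>measure \<nu> (A \<inter> B) - measure \<nu> A * measure \<nu> B\<bar>) = (\<Sum>p\<in>P \<times> Q. \<bar>d p\<bar>)"
    by (simp add: sum.cartesian_product d_def case_prod_beta)
  also have "\<dots> = (\<Sum>p\<in>P \<times> Q. 2 * (if 0 \<le> d p then d p else 0) - d p)"
    by (intro sum.cong) auto
  also have "\<dots> = 2 * (\<Sum>p\<in>P \<times> Q. if 0 \<le> d p then d p else 0)"
    by (simp add: sum_subtractf zero flip: sum_distrib_left)
  also have "(\<Sum>p\<in>P \<times> Q. if 0 \<le> d p then d p else 0) = (\<Sum>p\<in>S. d p)"
    unfolding S_def using P(1) Q(1) by (intro sum.inter_filter[symmetric]) simp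
  finally show ?thesis using bound[OF D] sum[OF S] by simp
qed

theorem weak_bernoulli: "weak_bernoulli \<nu>"
  unfolding weak_bernoulli_def
proof (rule LIMSEQ_I)
  fix \<epsilon> :: real assume "0 < \<epsilon>"
  then obtain n where n: "\<And>D. D \<in> sets (coord_algebra {..-1} \<Otimes>\<^sub>M coord_algebra {int n..}) \<Longrightarrow>
      measure \<nu> {y. (y, y) \<in> D} - measure (\<nu> \<Otimes>\<^sub>M \<nu>) D < \<epsilon> / 2"
    using past_future_domination[of "\<epsilon> / 2"] by auto
  show "\<exists>N. \<forall>m\<ge>N. norm (beta \<nu> m - 0) < \<epsilon>"
  proof (intro exI[of _ "Suc n"] allI impI)
    fix m assume "Suc n \<le> m"
    define X where "X = {(P, Q). finite P \<and> partition_on UNIV P \<and> P \<subseteq> sets (coord_algebra {..0} :: (int \<Rightarrow> 'a) measure) \<and>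
      finite Q \<and> partition_on UNIV Q \<and> Q \<subseteq> sets (coord_algebra {int m..} :: (int \<Rightarrow> 'a) measure)}"
    define b where "b = (\<lambda>(P, Q). 1 / 2 * (\<Sum>A\<in>P. \<Sum>B\<in>Q. \<bar>measure \<nu> (A \<inter> B) - measure \<nu> A * measure \<nu> B\<bar>))"
    have beta: "beta \<nu> m = (SUP p\<in>X. b p)"
      unfolding beta_def X_def b_def ..
    have sub: "sets (coord_algebra {int m..}) \<subseteq> sets (coord_algebra {int (Suc n)..})"
      using \<open>Suc n \<le> m\<close> by (intro coord_algebra_mono) auto
    have le: "b p \<le> \<epsilon> / 2" if pX: "p \<in> X" for p
    proof -
      obtain P Q where p: "p = (P, Q)" and "finite P" "partition_on UNIV P" "P \<subseteq> sets (coord_algebra {..0})"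
        "finite Q" "partition_on UNIV Q" "Q \<subseteq> sets (coord_algebra {int m..})"
        using pX unfolding X_def by blast
      then have "b p < \<epsilon> / 2"
        unfolding b_def p prod.case using sub by (intro sum_partition_dependence n) auto
      then show ?thesis by simp
    qed
    have trivial: "({UNIV}, {UNIV}) \<in> X"
      using sets.top[of "coord_algebra {..0}"] sets.top[of "coord_algebra {int m..}"]
      by (simp add: X_def partition_on_def)
    have "0 \<le> b ({UNIV}, {UNIV})" by (simp add: b_def)
    also have "\<dots> \<le> (SUP p\<in>X. b p)"
      by (rule cSUP_upper[OF trivial bdd_aboveI2[OF le]])
    finally have "0 \<le> beta \<nu> m" unfolding beta .
    moreover have "beta \<nu> m \<le> \<epsilon> / 2"
      unfolding beta using trivial le by (intro cSUP_least) auto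
    ultimately show "norm (beta \<nu> m - 0) < \<epsilon>" using \<open>0 < \<epsilon>\<close> by simp
  qed
qed

end

section \<open>Existence, uniqueness and mixing\<close>

text \<open>
  A sum of indicators is finite only if finitely many of them are nonzero. The sum starts with
  strings of length \<open>1\<close>, which accounts for the successors.
\<close>

lemma (in g_chain) measure_settled_eq_1:
  assumes "measure (law x) {y. (\<Sum>n. of_bool (context_exceeds g (initial_word y (Suc n))) :: ennreal) < \<infinity>} = 1"
  shows "measure (law x) (\<Union>N. settled N) = 1"
proof -
  define E where "E = {y. (\<Sum>n. of_bool (context_exceeds g (initial_word y (Suc n))) :: ennreal) < \<infinity>}"
  have "E \<subseteq> (\<Union>N. settled N)"
  proof
    fix y assume y: "y \<in> E"
    define T where "T = {n. y \<in> exceeding (Suc n)}"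
    have "(\<Sum>n. of_bool (context_exceeds g (initial_word y (Suc n))) :: ennreal) =
        (\<integral>\<^sup>+n. of_bool (context_exceeds g (initial_word y (Suc n))) \<partial>count_space UNIV)"
      by (rule nn_integral_count_space_nat[symmetric])
    also have "\<dots> = (\<integral>\<^sup>+n. indicator T n \<partial>count_space UNIV)"
      by (intro nn_integral_cong) (simp add: T_def exceeding_def indicator_def)
    also have "\<dots> = emeasure (count_space UNIV) T" by simp
    finally have "emeasure (count_space UNIV) T < \<infinity>" using y by (simp add: E_def)
    then have "finite T" by (cases "finite T") simp_all
    then obtain N where N: "\<And>n. n \<in> T \<Longrightarrow> n < N" unfolding finite_nat_set_iff_bounded by blast
    have "y \<notin> exceeding n" if n: "Suc N \<le> n" for n
    proof -
      obtain k where k: "n = Suc k" using n by (cases n) simp_all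
      then have "k \<notin> T" using N[of k] n by auto
      then show ?thesis by (simp add: T_def k)
    qed
    then have "y \<in> settled (Suc N)" by (simp add: settled_def)
    then show "y \<in> (\<Union>N. settled N)" by blast
  qed
  then have "measure (law x) E \<le> measure (law x) (\<Union>N. settled N)"
    by (intro law.finite_measure_mono) auto
  moreover have "measure (law x) E = 1" unfolding E_def by (rule assms)
  moreover have "measure (law x) (\<Union>N. settled N) \<le> 1" by (rule law.prob_le_1)
  ultimately show ?thesis by linarith
qed

theorem theorem3:
  fixes g :: "'a::finite lseq \<Rightarrow> real"
  assumes "g_function g"
    and "(\<lambda>n. SUP x. measure (past_measure g x) {y. context_exceeds g (initial_word y n)})
           \<longlonglongrightarrow> 0"
  shows "(\<forall>x \<nu>. subsequential_limit g x \<nu> \<longrightarrow> \<nu> \<in> compatible_measures g) \<and>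
    ((\<forall>x. g x > 0) \<and>
     (\<forall>x. measure (past_measure g x)
        {y. (\<Sum>n. of_bool (context_exceeds g (initial_word y (Suc n))) :: ennreal) < \<infinity>} = 1) \<longrightarrow>
     (\<exists>\<mu>. compatible_measures g = {\<mu>} \<and> weak_bernoulli \<mu>))"
proof (intro conjI allI impI)
  interpret g_chain g by unfold_locales (rule assms(1))
  have rare: "(\<lambda>n. SUP x. measure (past_measure g x) (exceeding n)) \<longlonglongrightarrow> 0"
    using assms(2) by (simp add: exceeding_def)
  show "\<nu> \<in> compatible_measures g" if "subsequential_limit g x \<nu>" for x \<nu>
    by (rule subsequential_limit_compatible[OF that rare])
  assume A: "(\<forall>x. g x > 0) \<and> (\<forall>x. measure (past_measure g x)
        {y. (\<Sum>n. of_bool (context_exceeds g (initial_word y (Suc n))) :: ennreal) < \<infinity>} = 1)"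
  interpret settling_chain g
  proof unfold_locales
    show "0 < g x" for x using A by blast
    show "measure (past_measure g x) (\<Union>N. settled N) = 1" for x
      by (rule measure_settled_eq_1) (rule conjunct2[OF A, rule_format])
  qed
  obtain \<mu> where \<mu>: "\<mu> \<in> compatible_measures g" using ex_compatible_measure[OF rare] by blast
  interpret settling_measure g \<mu> by unfold_locales (rule \<mu>)
  have "compatible_measures g = {\<mu>}"
    using \<mu> compatible_measure_unique[OF _ \<mu>] by blast
  then show "\<exists>\<mu>. compatible_measures g = {\<mu>} \<and> weak_bernoulli \<mu>"
    using weak_bernoulli by blast
qed

end
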